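(* Let $(M,g)$ be a compact, oriented Riemannian manifold and $(N,h,J)$ a compact Kähler manifold with Kähler form $\omega=h(J\cdot,\cdot)$. If $\phi:M\to N$ is an immersion which is a critical point of the energy functional $E(\phi)=\frac12\int_M|\phi^*\omega|^2\,{\ast 1}$, then $\phi$ is stable. In particular, the identity map of any compact Kähler manifold is stable.
   Context: $\ast 1$ is the volume form of $M$; the pointwise norm on $p$-forms is induced by $\langle\alpha,\beta\rangle=\frac1{p!}\sum_{i_1,\dots,i_p}\alpha(e_{i_1},\dots,e_{i_p})\beta(e_{i_1},\dots,e_{i_p})$ for a local orthonormal frame. A critical point of $E$ is a map $\phi$ with $\frac{d}{dt}E(\phi_t)|_{t=0}=0$ for every smooth variation $\phi_t$ of $\phi=\phi_0$. The Hessian of $E$ at a critical point $\phi$ is the symmetric bilinear form on $\Gamma(\phi^{-1}TN)$ given by $H_\phi(X,Y)=\frac{\partial^2}{\partial s\,\partial t}\big|_{s=t=0}E(\phi_{s,t})$, where $\phi_{s,t}$ is a smooth $2$-parameter variation of $\phi=\phi_{0,0}$ with $X=\partial_t\phi_{s,t}|_{s=t=0}$ and $Y=\partial_s\phi_{s,t}|_{s=t=0}$. A critical point $\phi$ is stable if $H_\phi(X,X)\ge0$ for all $X\in\Gamma(\phi^{-1}TN)$. *)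

theory Defs
  imports "HOL-Analysis.Analysis"
begin

section \<open>Smooth maps between open subsets of Euclidean spaces\<close>

(* Only used on open sets of finite-dimensional spaces, where this is the usual class C^k. *)
primrec Ck_on :: "nat \<Rightarrow> 'x set \<Rightarrow> ('x::real_normed_vector \<Rightarrow> 'y::real_normed_vector) \<Rightarrow> bool" where
  "Ck_on 0 S f \<longleftrightarrow> continuous_on S f"
| "Ck_on (Suc k) S f \<longleftrightarrow>
     (\<forall>x\<in>S. f differentiable (at x)) \<and> (\<forall>v. Ck_on k S (\<lambda>x. frechet_derivative f (at x) v))"

definition smooth_on :: "'x set \<Rightarrow> ('x::real_normed_vector \<Rightarrow> 'y::real_normed_vector) \<Rightarrow> bool" where
  "smooth_on S f \<longleftrightarrow> (\<forall>k. Ck_on k S f)"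


section \<open>Smooth manifolds\<close>

(* A manifold is a (Hausdorff, second countable) topological type together with a smooth atlas.
   A chart is a pair (U, x) of its domain and its coordinate map. *)
type_synonym ('a, 'm) chart = "'a set \<times> ('a \<Rightarrow> real ^ 'm)"

abbreviation chart_dom :: "('a, 'm) chart \<Rightarrow> 'a set" where
  "chart_dom c \<equiv> fst c"

abbreviation chart_inv :: "('a, 'm) chart \<Rightarrow> real ^ 'm \<Rightarrow> 'a" where
  "chart_inv c \<equiv> inv_into (fst c) (snd c)"

abbreviation chart_img :: "('a, 'm) chart \<Rightarrow> (real ^ 'm) set" where
  "chart_img c \<equiv> snd c ` fst c"

definition is_chart :: "('a::topological_space, 'm::finite) chart \<Rightarrow> bool" where
  "is_chart c \<longleftrightarrow> open (chart_dom c) \<and> open (chart_img c) \<and>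
     homeomorphism (chart_dom c) (chart_img c) (snd c) (chart_inv c)"

definition smooth_transition ::
  "('a::topological_space, 'm::finite) chart \<Rightarrow> ('a, 'm) chart \<Rightarrow> bool" where
  "smooth_transition c c' \<longleftrightarrow>
     smooth_on (snd c ` (chart_dom c \<inter> chart_dom c')) (snd c' \<circ> chart_inv c)"

definition smooth_atlas :: "('a::topological_space, 'm::finite) chart set \<Rightarrow> bool" where
  "smooth_atlas A \<longleftrightarrow> (\<forall>c\<in>A. is_chart c) \<and> (\<Union>c\<in>A. chart_dom c) = UNIV \<and>
     (\<forall>c\<in>A. \<forall>c'\<in>A. smooth_transition c c')"

definition compatible_chart ::
  "('a::topological_space, 'm::finite) chart set \<Rightarrow> ('a, 'm) chart \<Rightarrow> bool" where
  "compatible_chart A d \<longleftrightarrow> is_chart d \<and>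
     (\<forall>c\<in>A. smooth_transition c d \<and> smooth_transition d c)"

definition transition_deriv ::
  "('a, 'm::finite) chart \<Rightarrow> ('a, 'm) chart \<Rightarrow> 'a \<Rightarrow> real ^ 'm \<Rightarrow> real ^ 'm" where
  "transition_deriv c c' p = frechet_derivative (snd c' \<circ> chart_inv c) (at (snd c p))"

(* An orientation is given by an atlas all of whose transition maps preserve the
   orientation of R^m; its charts are the positively oriented ones. *)
definition oriented_atlas :: "('a::topological_space, 'm::finite) chart set \<Rightarrow> bool" where
  "oriented_atlas A \<longleftrightarrow> smooth_atlas A \<and>
     (\<forall>c\<in>A. \<forall>c'\<in>A. \<forall>p\<in>chart_dom c \<inter> chart_dom c'. det (matrix (transition_deriv c c' p)) > 0)"


section \<open>Tangent vectors\<close>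

(* A tangent vector at p is the family of its component vectors in the charts around p,
   related by the Jacobians of the transition maps.  The value at all other charts is set
   to 0, so that equality of tangent vectors is equality of functions. *)
type_synonym ('a, 'm) tvec = "('a, 'm) chart \<Rightarrow> real ^ 'm"

definition tangent_space :: "('a, 'm::finite) chart set \<Rightarrow> 'a \<Rightarrow> ('a, 'm) tvec set" where
  "tangent_space A p = {v.
     (\<forall>c. \<not> (c \<in> A \<and> p \<in> chart_dom c) \<longrightarrow> v c = 0) \<and>
     (\<forall>c\<in>A. \<forall>c'\<in>A. p \<in> chart_dom c \<inter> chart_dom c' \<longrightarrow> v c' = transition_deriv c c' p (v c))}"

(* The tangent vector at p with components u in the chart c.  Here c may be any chart
   compatible with A; it need not belong to A. *)
definition coord_vec ::
  "('a, 'm::finite) chart set \<Rightarrow> ('a, 'm) chart \<Rightarrow> 'a \<Rightarrow> real ^ 'm \<Rightarrow> ('a, 'm) tvec" where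
  "coord_vec A c p u =
     (\<lambda>c'. if c' \<in> A \<and> p \<in> chart_dom c' then transition_deriv c c' p u else 0)"

(* The velocity at time 0 of a curve. *)
definition velocity :: "('a, 'm::finite) chart set \<Rightarrow> (real \<Rightarrow> 'a) \<Rightarrow> ('a, 'm) tvec" where
  "velocity A \<gamma> =
     (\<lambda>c. if c \<in> A \<and> \<gamma> 0 \<in> chart_dom c then vector_derivative (snd c \<circ> \<gamma>) (at 0) else 0)"

(* The differential of \<phi> at p.  By the chain rule it does not depend on the chart c. *)
definition differential ::
  "('a, 'm::finite) chart set \<Rightarrow> ('b, 'n::finite) chart set \<Rightarrow> ('a \<Rightarrow> 'b) \<Rightarrow> 'a
     \<Rightarrow> ('a, 'm) tvec \<Rightarrow> ('b, 'n) tvec" where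
  "differential A B \<phi> p v =
     (let c = (SOME c. c \<in> A \<and> p \<in> chart_dom c)
      in (\<lambda>d. if d \<in> B \<and> \<phi> p \<in> chart_dom d
              then frechet_derivative (snd d \<circ> \<phi> \<circ> chart_inv c) (at (snd c p)) (v c) else 0))"


section \<open>Smooth functions, maps, families and sections\<close>

definition smooth_fun :: "('a, 'm::finite) chart set \<Rightarrow> ('a \<Rightarrow> real) \<Rightarrow> bool" where
  "smooth_fun A f \<longleftrightarrow> (\<forall>c\<in>A. smooth_on (chart_img c) (f \<circ> chart_inv c))"

definition smooth_map ::
  "('a::topological_space, 'm::finite) chart set \<Rightarrow> ('b::topological_space, 'n::finite) chart set
     \<Rightarrow> ('a \<Rightarrow> 'b) \<Rightarrow> bool" where
  "smooth_map A B \<phi> \<longleftrightarrow> continuous_on UNIV \<phi> \<and>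
     (\<forall>c\<in>A. \<forall>d\<in>B. smooth_on {x \<in> chart_img c. \<phi> (chart_inv c x) \<in> chart_dom d}
        (snd d \<circ> \<phi> \<circ> chart_inv c))"

(* Smoothness of (t, p) \<mapsto> \<Phi> t p on T \<times> M for an open set T of parameters. *)
definition smooth_family ::
  "('a::topological_space, 'm::finite) chart set \<Rightarrow> ('b::topological_space, 'n::finite) chart set
     \<Rightarrow> 't::real_normed_vector set \<Rightarrow> ('t \<Rightarrow> 'a \<Rightarrow> 'b) \<Rightarrow> bool" where
  "smooth_family A B T \<Phi> \<longleftrightarrow> continuous_on (T \<times> UNIV) (\<lambda>(t, p). \<Phi> t p) \<and>
     (\<forall>c\<in>A. \<forall>d\<in>B.
        smooth_on {(t, x). t \<in> T \<and> x \<in> chart_img c \<and> \<Phi> t (chart_inv c x) \<in> chart_dom d}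
          (\<lambda>(t, x). snd d (\<Phi> t (chart_inv c x))))"

definition immersion ::
  "('a::topological_space, 'm::finite) chart set \<Rightarrow> ('b::topological_space, 'n::finite) chart set
     \<Rightarrow> ('a \<Rightarrow> 'b) \<Rightarrow> bool" where
  "immersion A B \<phi> \<longleftrightarrow> smooth_map A B \<phi> \<and>
     (\<forall>p. inj_on (differential A B \<phi> p) (tangent_space A p))"

(* The space of smooth sections of the pull-back bundle \<phi>^{-1} TN. *)
definition sections_along ::
  "('a, 'm::finite) chart set \<Rightarrow> ('b, 'n::finite) chart set \<Rightarrow> ('a \<Rightarrow> 'b)
     \<Rightarrow> ('a \<Rightarrow> ('b, 'n) tvec) set" where
  "sections_along A B \<phi> = {X.
     (\<forall>p. X p \<in> tangent_space B (\<phi> p)) \<and>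
     (\<forall>c\<in>A. \<forall>d\<in>B. smooth_on {x \<in> chart_img c. \<phi> (chart_inv c x) \<in> chart_dom d}
        (\<lambda>x. X (chart_inv c x) d))}"


section \<open>Riemannian and Kaehler metrics\<close>

(* Tensor fields are functions of a point and of tangent vectors at that point; only their
   values on the tangent space matter. *)
type_synonym ('a, 'm) two_tensor = "'a \<Rightarrow> ('a, 'm) tvec \<Rightarrow> ('a, 'm) tvec \<Rightarrow> real"

definition local_rep ::
  "('a, 'm::finite) chart set \<Rightarrow> ('a, 'm) two_tensor \<Rightarrow> ('a, 'm) chart
     \<Rightarrow> real ^ 'm \<Rightarrow> real ^ 'm \<Rightarrow> real ^ 'm \<Rightarrow> real" where
  "local_rep A \<alpha> c x u v =
     (let p = chart_inv c x in \<alpha> p (coord_vec A c p u) (coord_vec A c p v))"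

definition riemannian_metric ::
  "('a, 'm::finite) chart set \<Rightarrow> ('a, 'm) two_tensor \<Rightarrow> bool" where
  "riemannian_metric A g \<longleftrightarrow>
     (\<forall>c\<in>A. (\<forall>x\<in>chart_img c. bilinear (local_rep A g c x)) \<and>
             (\<forall>u v. smooth_on (chart_img c) (\<lambda>x. local_rep A g c x u v))) \<and>
     (\<forall>p. \<forall>v\<in>tangent_space A p.
        (\<forall>w\<in>tangent_space A p. g p v w = g p w v) \<and> (v \<noteq> (\<lambda>_. 0) \<longrightarrow> g p v v > 0))"

definition almost_complex_structure ::
  "('b, 'n::finite) chart set \<Rightarrow> ('b \<Rightarrow> ('b, 'n) tvec \<Rightarrow> ('b, 'n) tvec) \<Rightarrow> bool" where
  "almost_complex_structure B J \<longleftrightarrow>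
     (\<forall>p. \<forall>v\<in>tangent_space B p. J p v \<in> tangent_space B p \<and> J p (J p v) = (\<lambda>d. - v d)) \<and>
     (\<forall>d\<in>B. (\<forall>p\<in>chart_dom d. linear (\<lambda>u. J p (coord_vec B d p u) d)) \<and>
             (\<forall>u. smooth_on (chart_img d)
                (\<lambda>y. J (chart_inv d y) (coord_vec B d (chart_inv d y) u) d)))"

(* J comes from an atlas of holomorphic charts: around every point there are smooth coordinates
   in which J is a constant matrix J0 with square -1.  Identifying (R^n, J0) linearly with C^k,
   the transition maps between such charts are holomorphic. *)
definition complex_structure ::
  "('b::topological_space, 'n::finite) chart set \<Rightarrow> ('b \<Rightarrow> ('b, 'n) tvec \<Rightarrow> ('b, 'n) tvec) \<Rightarrow> bool"
  where
  "complex_structure B J \<longleftrightarrow> almost_complex_structure B J \<and>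
     (\<forall>p. \<exists>d J0. compatible_chart B d \<and> p \<in> chart_dom d \<and> linear J0 \<and>
        (\<forall>q\<in>chart_dom d. \<forall>u. J q (coord_vec B d q u) = coord_vec B d q (J0 u)))"

(* The Kaehler form h(J \<cdot>, \<cdot>). *)
definition kaehler_form ::
  "('b, 'n) two_tensor \<Rightarrow> ('b \<Rightarrow> ('b, 'n) tvec \<Rightarrow> ('b, 'n) tvec) \<Rightarrow> ('b, 'n) two_tensor" where
  "kaehler_form h J p v w = h p (J p v) w"

(* d \<alpha> = 0 for a 2-form \<alpha>: in a chart, for constant vector fields u, v, w,
   d \<alpha> (u, v, w) = u(\<alpha>(v, w)) + v(\<alpha>(w, u)) + w(\<alpha>(u, v)). *)
definition closed_two_form :: "('b, 'n::finite) chart set \<Rightarrow> ('b, 'n) two_tensor \<Rightarrow> bool" where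
  "closed_two_form B \<alpha> \<longleftrightarrow> (\<forall>d\<in>B. \<forall>y\<in>chart_img d. \<forall>u v w.
     frechet_derivative (\<lambda>z. local_rep B \<alpha> d z v w) (at y) u +
     frechet_derivative (\<lambda>z. local_rep B \<alpha> d z w u) (at y) v +
     frechet_derivative (\<lambda>z. local_rep B \<alpha> d z u v) (at y) w = 0)"

definition kaehler_manifold ::
  "('b::topological_space, 'n::finite) chart set \<Rightarrow> ('b, 'n) two_tensor
     \<Rightarrow> ('b \<Rightarrow> ('b, 'n) tvec \<Rightarrow> ('b, 'n) tvec) \<Rightarrow> bool" where
  "kaehler_manifold B h J \<longleftrightarrow> smooth_atlas B \<and> riemannian_metric B h \<and> complex_structure B J \<and>
     (\<forall>p. \<forall>v\<in>tangent_space B p. \<forall>w\<in>tangent_space B p. h p (J p v) (J p w) = h p v w) \<and>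
     closed_two_form B (kaehler_form h J)"


section \<open>Pull-back, pointwise norm and integration\<close>

definition pullback_form ::
  "('a, 'm::finite) chart set \<Rightarrow> ('b, 'n::finite) chart set \<Rightarrow> ('a \<Rightarrow> 'b)
     \<Rightarrow> ('b, 'n) two_tensor \<Rightarrow> ('a, 'm) two_tensor" where
  "pullback_form A B \<phi> \<alpha> p v w =
     \<alpha> (\<phi> p) (differential A B \<phi> p v) (differential A B \<phi> p w)"

definition orthonormal_frame ::
  "('a, 'm::finite) chart set \<Rightarrow> ('a, 'm) two_tensor \<Rightarrow> 'a \<Rightarrow> ('m \<Rightarrow> ('a, 'm) tvec) \<Rightarrow> bool" where
  "orthonormal_frame A g p e \<longleftrightarrow> (\<forall>i. e i \<in> tangent_space A p) \<and>
     (\<forall>i j. g p (e i) (e j) = (if i = j then 1 else 0))"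

(* The value does not depend on the choice of the orthonormal frame. *)
definition two_form_inner ::
  "('a, 'm::finite) chart set \<Rightarrow> ('a, 'm) two_tensor
     \<Rightarrow> ('a, 'm) two_tensor \<Rightarrow> ('a, 'm) two_tensor \<Rightarrow> 'a \<Rightarrow> real" where
  "two_form_inner A g \<alpha> \<beta> p =
     (let e = (SOME e. orthonormal_frame A g p e)
      in 1 / fact 2 * (\<Sum>i\<in>UNIV. \<Sum>j\<in>UNIV. \<alpha> p (e i) (e j) * \<beta> p (e i) (e j)))"

definition partition_of_unity ::
  "('a::topological_space, 'm::finite) chart set \<Rightarrow> ('a, 'm) chart set
     \<Rightarrow> (('a, 'm) chart \<Rightarrow> 'a \<Rightarrow> real) \<Rightarrow> bool" where
  "partition_of_unity A F \<rho> \<longleftrightarrow> finite F \<and> F \<subseteq> A \<and>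
     (\<forall>c\<in>F. smooth_fun A (\<rho> c) \<and> (\<forall>p. 0 \<le> \<rho> c p) \<and> closure {p. \<rho> c p \<noteq> 0} \<subseteq> chart_dom c) \<and>
     (\<forall>p. (\<Sum>c\<in>F. \<rho> c p) = 1)"

(* The coefficient sqrt(det(g_ij)) of the volume form *1 with respect to dx^1 \<and> ... \<and> dx^m
   in a positively oriented chart. *)
definition volume_coeff ::
  "('a, 'm::finite) chart set \<Rightarrow> ('a, 'm) two_tensor \<Rightarrow> ('a, 'm) chart \<Rightarrow> real ^ 'm \<Rightarrow> real" where
  "volume_coeff A g c x = sqrt (det (\<chi> i j. local_rep A g c x (axis i 1) (axis j 1)))"

(* The integral of f *1 over a compact manifold.  It does not depend on the choice of the
   partition of unity.  In a chart that reverses the orientation both the coefficient of *1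
   and the integral of an m-form change sign, so the formula holds for charts of either sign
   and A need not be an oriented atlas. *)
definition volume_integral ::
  "('a::topological_space, 'm::finite) chart set \<Rightarrow> ('a, 'm) two_tensor \<Rightarrow> ('a \<Rightarrow> real) \<Rightarrow> real"
  where
  "volume_integral A g f =
     (let (F, \<rho>) = (SOME (F, \<rho>). partition_of_unity A F \<rho>)
      in \<Sum>c\<in>F. integral (chart_img c)
           (\<lambda>x. \<rho> c (chart_inv c x) * f (chart_inv c x) * volume_coeff A g c x))"


section \<open>The energy functional, critical points and stability\<close>

definition energy ::
  "('a::topological_space, 'm::finite) chart set \<Rightarrow> ('a, 'm) two_tensor
     \<Rightarrow> ('b, 'n::finite) chart set \<Rightarrow> ('b, 'n) two_tensor
     \<Rightarrow> ('b \<Rightarrow> ('b, 'n) tvec \<Rightarrow> ('b, 'n) tvec) \<Rightarrow> ('a \<Rightarrow> 'b) \<Rightarrow> real" where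
  "energy A g B h J \<phi> =
     (let \<alpha> = pullback_form A B \<phi> (kaehler_form h J)
      in 1 / 2 * volume_integral A g (two_form_inner A g \<alpha> \<alpha>))"

definition variation ::
  "('a::topological_space, 'm::finite) chart set \<Rightarrow> ('b::topological_space, 'n::finite) chart set
     \<Rightarrow> ('a \<Rightarrow> 'b) \<Rightarrow> (real \<Rightarrow> 'a \<Rightarrow> 'b) \<Rightarrow> bool" where
  "variation A B \<phi> \<Phi> \<longleftrightarrow> (\<exists>\<epsilon>>0. smooth_family A B {-\<epsilon><..<\<epsilon>} \<Phi>) \<and> \<Phi> 0 = \<phi>"

definition critical_point ::
  "('a::topological_space, 'm::finite) chart set \<Rightarrow> ('a, 'm) two_tensor
     \<Rightarrow> ('b::topological_space, 'n::finite) chart set \<Rightarrow> ('b, 'n) two_tensor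
     \<Rightarrow> ('b \<Rightarrow> ('b, 'n) tvec \<Rightarrow> ('b, 'n) tvec) \<Rightarrow> ('a \<Rightarrow> 'b) \<Rightarrow> bool" where
  "critical_point A g B h J \<phi> \<longleftrightarrow> smooth_map A B \<phi> \<and>
     (\<forall>\<Phi>. variation A B \<phi> \<Phi> \<longrightarrow>
        ((\<lambda>t. energy A g B h J (\<Phi> t)) has_real_derivative 0) (at 0))"

(* The parameter of a 2-parameter variation is (s, t); X is its t-derivative and Y its
   s-derivative at (0, 0). *)
definition variation2 ::
  "('a::topological_space, 'm::finite) chart set \<Rightarrow> ('b::topological_space, 'n::finite) chart set
     \<Rightarrow> ('a \<Rightarrow> 'b) \<Rightarrow> ('a \<Rightarrow> ('b, 'n) tvec) \<Rightarrow> ('a \<Rightarrow> ('b, 'n) tvec)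
     \<Rightarrow> (real \<times> real \<Rightarrow> 'a \<Rightarrow> 'b) \<Rightarrow> bool" where
  "variation2 A B \<phi> X Y \<Phi> \<longleftrightarrow>
     (\<exists>\<epsilon>>0. smooth_family A B ({-\<epsilon><..<\<epsilon>} \<times> {-\<epsilon><..<\<epsilon>}) \<Phi>) \<and> \<Phi> (0, 0) = \<phi> \<and>
     (\<forall>p. velocity B (\<lambda>t. \<Phi> (0, t) p) = X p) \<and>
     (\<forall>p. velocity B (\<lambda>s. \<Phi> (s, 0) p) = Y p)"

(* At a critical point the value does not depend on the choice of the variation. *)
definition hessian ::
  "('a::topological_space, 'm::finite) chart set \<Rightarrow> ('a, 'm) two_tensor
     \<Rightarrow> ('b::topological_space, 'n::finite) chart set \<Rightarrow> ('b, 'n) two_tensor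
     \<Rightarrow> ('b \<Rightarrow> ('b, 'n) tvec \<Rightarrow> ('b, 'n) tvec) \<Rightarrow> ('a \<Rightarrow> 'b)
     \<Rightarrow> ('a \<Rightarrow> ('b, 'n) tvec) \<Rightarrow> ('a \<Rightarrow> ('b, 'n) tvec) \<Rightarrow> real" where
  "hessian A g B h J \<phi> X Y =
     (let \<Phi> = (SOME \<Phi>. variation2 A B \<phi> X Y \<Phi>)
      in deriv (\<lambda>s. deriv (\<lambda>t. energy A g B h J (\<Phi> (s, t))) 0) 0)"

definition stable_critical_point ::
  "('a::topological_space, 'm::finite) chart set \<Rightarrow> ('a, 'm) two_tensor
     \<Rightarrow> ('b::topological_space, 'n::finite) chart set \<Rightarrow> ('b, 'n) two_tensor
     \<Rightarrow> ('b \<Rightarrow> ('b, 'n) tvec \<Rightarrow> ('b, 'n) tvec) \<Rightarrow> ('a \<Rightarrow> 'b) \<Rightarrow> bool" where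
  "stable_critical_point A g B h J \<phi> \<longleftrightarrow> critical_point A g B h J \<phi> \<and>
     (\<forall>X\<in>sections_along A B \<phi>. hessian A g B h J \<phi> X X \<ge> 0)"

end

(* The energy is half the squared L^2-norm of the closed 2-form phi^*omega.  Along a family of maps the
   derivative of the pull-back is exact, with primitive the contraction of the pull-back form with the
   variation field X.  At a critical immersion every 1-form on M is such a contraction, because omega is
   nondegenerate; hence phi^*omega is orthogonal to all exact forms, i.e. coclosed.  The second variation
   then reduces to the squared norm of d(phi^* i_X omega), which is nonnegative.  For the identity of a
   Kaehler manifold, coclosedness of omega itself is the divergence identity d_k(sqrt(det g) omega^kl) = 0,
   a contraction of d omega = 0, combined with integration by parts. *)
theory Submission
  imports Defs
begin

section \<open>Smooth maps\<close>

text \<open>Everything is carried out on coefficients in charts. Exactness of the time derivative is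
  obtained by pulling the form back to the product of the parameter space and \<open>M\<close>:
  closedness there, evaluated on one parameter direction and two spatial ones, is Cartan's formula.
  The primitive of the mixed second derivative is again a global 1-form, which is why coclosedness
  also removes that term. Coclosedness is used in its weak form, as orthogonality to all exact
  forms. Two obstacles shape the rest. The Hessian is defined through a chosen variation, so one
  with prescribed velocity has to be built; this is done by translating inside charts of
  \<open>N\<close>, one cut-off piece at a time. And the identity is not assumed to be critical, so
  its coclosedness rests on a divergence theorem: the integral is a sum over charts, integration by
  parts in a chart leaves derivatives of the cut-off functions behind, and these cancel only after a
  change of variables between charts.\<close>

abbreviation dd :: "('x::real_normed_vector \<Rightarrow> 'y::real_normed_vector) \<Rightarrow> 'x \<Rightarrow> 'x \<Rightarrow> 'y" where
  "dd f v x \<equiv> frechet_derivative f (at x) v"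

lemma has_derivative_dd: "f differentiable (at x) \<Longrightarrow> (f has_derivative (\<lambda>v. dd f v x)) (at x)"
  by (simp add: frechet_derivative_works)

lemma dd_eqI: "(f has_derivative f') (at x) \<Longrightarrow> dd f v x = f' v"
  using frechet_derivative_at by metis

lemma dd_cong_open:
  assumes "open X" "x \<in> X" "\<And>y. y \<in> X \<Longrightarrow> f y = g y" "f differentiable (at x)"
  shows "dd f v x = dd g v x"
  using assms by (metis frechet_derivative_transform_within_open)

lemma linear_dd: "f differentiable (at x) \<Longrightarrow> linear (\<lambda>v. dd f v x)"
  by (rule linear_frechet_derivative)

lemma dd_chain:
  assumes "f differentiable (at x)" "g differentiable (at (f x))"
  shows "dd (\<lambda>x. g (f x)) v x = dd g (dd f v x) (f x)"
  using diff_chain_at[OF has_derivative_dd[OF assms(1)] has_derivative_dd[OF assms(2)]]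
  by (intro dd_eqI[THEN trans]) (auto simp: o_def)

lemma differentiable_cong_open:
  assumes "open X" "x \<in> X" "\<And>y. y \<in> X \<Longrightarrow> f y = g y" "f differentiable (at x)"
  shows "g differentiable (at x)"
  using assms by (meson differentiable_def has_derivative_transform_within_open)

lemma Ck_on_continuous: "Ck_on k S f \<Longrightarrow> continuous_on S f"
  by (cases k) (auto intro!: differentiable_imp_continuous_on simp: differentiable_on_def
      differentiable_at_withinI)

lemma Ck_on_SucD: "Ck_on (Suc k) S f \<Longrightarrow> Ck_on k S f"
proof (induction k arbitrary: f)
  case 0
  then show ?case using Ck_on_continuous[of "Suc 0"] by simp
next
  case (Suc k)
  then show ?case by auto
qed

lemma Ck_on_subset: "Ck_on k S f \<Longrightarrow> T \<subseteq> S \<Longrightarrow> Ck_on k T f"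
  by (induction k arbitrary: f) (auto intro: continuous_on_subset)

lemma Ck_on_cong:
  assumes "open S" "\<And>x. x \<in> S \<Longrightarrow> f x = g x" "Ck_on k S f"
  shows "Ck_on k S g"
  using assms(2,3)
proof (induction k arbitrary: f g)
  case 0
  then show ?case using continuous_on_cong by force
next
  case (Suc k)
  have d: "g differentiable (at x)" if "x \<in> S" for x
    using Suc.prems that differentiable_cong_open[OF assms(1) that, of f g] by auto
  moreover have "dd f v x = dd g v x" if "x \<in> S" for x v
    using Suc.prems that dd_cong_open[OF assms(1) that, of f g] by auto
  ultimately show ?case
    using Suc.IH[of "dd f v" "dd g v" for v] Suc.prems by auto
qed

lemma Ck_on_local:
  assumes "\<And>x. x \<in> S \<Longrightarrow> \<exists>T. open T \<and> x \<in> T \<and> Ck_on k T f"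
  shows "Ck_on k S f"
  using assms
proof (induction k arbitrary: f)
  case 0
  then have "continuous (at x) f" if "x \<in> S" for x
    using that by (meson Ck_on.simps(1) continuous_on_eq_continuous_at)
  then show ?case by (auto intro: continuous_at_imp_continuous_on)
next
  case (Suc k)
  have "f differentiable (at x)" if "x \<in> S" for x
    using Suc.prems[OF that] by auto
  moreover have "Ck_on k S (dd f v)" for v
  proof (rule Suc.IH)
    fix x assume "x \<in> S"
    from Suc.prems[OF this] show "\<exists>T. open T \<and> x \<in> T \<and> Ck_on k T (dd f v)" by auto
  qed
  ultimately show ?case by simp
qed

lemma Ck_on_const: "Ck_on k S (\<lambda>x. c)"
  by (induction k arbitrary: c) auto

lemma Ck_on_linear:
  assumes "bounded_linear f"
  shows "Ck_on k S f"
proof (cases k)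
  case 0
  then show ?thesis using assms by (simp add: linear_continuous_on)
next
  case (Suc n)
  have "dd f v x = f v" for v x
    by (rule dd_eqI) (rule bounded_linear_imp_has_derivative[OF assms])
  then show ?thesis using Suc
    by (auto intro!: bounded_linear_imp_differentiable[OF assms] simp: Ck_on_const)
qed

lemma Ck_on_linear_compose:
  assumes "open S" "bounded_linear L" "Ck_on k S f"
  shows "Ck_on k S (\<lambda>x. L (f x))"
  using assms(3)
proof (induction k arbitrary: f)
  case 0
  then show ?case using assms by (auto intro: bounded_linear.continuous_on)
next
  case (Suc k)
  have d: "((\<lambda>x. L (f x)) has_derivative (\<lambda>v. L (dd f v x))) (at x)" if "x \<in> S" for x
    using Suc.prems that by (intro bounded_linear.has_derivative[OF assms(2)] has_derivative_dd) auto
  have "Ck_on k S (dd (\<lambda>x. L (f x)) v)" for v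
    by (rule Ck_on_cong[OF assms(1) _ Suc.IH[of "dd f v"]])
      (use d dd_eqI[OF d] Suc.prems in auto)
  then show ?case using d by (auto simp: differentiable_def)
qed

lemma Ck_on_add:
  assumes "open S" "Ck_on k S f" "Ck_on k S g"
  shows "Ck_on k S (\<lambda>x. f x + g x)"
  using assms(2,3)
proof (induction k arbitrary: f g)
  case 0
  then show ?case by (auto intro: continuous_on_add)
next
  case (Suc k)
  have d: "((\<lambda>x. f x + g x) has_derivative (\<lambda>v. dd f v x + dd g v x)) (at x)" if "x \<in> S" for x
    using Suc.prems that by (intro has_derivative_add has_derivative_dd) auto
  have "Ck_on k S (dd (\<lambda>x. f x + g x) v)" for v
    by (rule Ck_on_cong[OF assms(1) _ Suc.IH[of "dd f v" "dd g v"]])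
      (use d dd_eqI[OF d] Suc.prems in auto)
  then show ?case using d by (auto simp: differentiable_def)
qed

lemma Ck_on_bilinear:
  assumes "open S" "bounded_bilinear b" "Ck_on k S f" "Ck_on k S g"
  shows "Ck_on k S (\<lambda>x. b (f x) (g x))"
  using assms(3,4)
proof (induction k arbitrary: f g)
  case 0
  then show ?case using assms(2) by (auto intro: bounded_bilinear.continuous_on)
next
  case (Suc k)
  have d: "((\<lambda>x. b (f x) (g x)) has_derivative (\<lambda>v. b (f x) (dd g v x) + b (dd f v x) (g x))) (at x)"
    if "x \<in> S" for x
    using Suc.prems that by (intro bounded_bilinear.FDERIV[OF assms(2)] has_derivative_dd) auto
  have "Ck_on k S (dd (\<lambda>x. b (f x) (g x)) v)" for v
  proof (rule Ck_on_cong[OF assms(1)])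
    show "Ck_on k S (\<lambda>x. b (f x) (dd g v x) + b (dd f v x) (g x))"
      using Suc.prems Ck_on_SucD[OF Suc.prems(1)] Ck_on_SucD[OF Suc.prems(2)]
      by (intro Ck_on_add[OF assms(1)] Suc.IH) auto
  qed (use dd_eqI[OF d] in auto)
  then show ?case using d by (auto simp: differentiable_def)
qed

lemma Ck_on_sum:
  assumes "open S" "\<And>i. i \<in> I \<Longrightarrow> Ck_on k S (f i)"
  shows "Ck_on k S (\<lambda>x. \<Sum>i\<in>I. f i x)"
  using assms(2)
  by (induction I rule: infinite_finite_induct) (auto intro: Ck_on_add[OF assms(1)] Ck_on_const)

text \<open>The chain rule differentiates \<open>g\<close> in the direction \<open>dd f v x\<close>,
  which moves with \<open>x\<close>, whereas the definition controls fixed directions only.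
  Expanding this direction in \<open>Basis\<close> turns the derivative into a finite sum of
  products, and for this the intermediate space has to be Euclidean.\<close>

lemma Ck_on_compose:
  fixes f :: "'x::real_normed_vector \<Rightarrow> 'y::euclidean_space" and g :: "'y \<Rightarrow> 'z::real_normed_vector"
  assumes "open S" "open T" "f ` S \<subseteq> T" "Ck_on k S f" "Ck_on k T g"
  shows "Ck_on k S (\<lambda>x. g (f x))"
  using assms(4,5)
proof (induction k arbitrary: g)
  case 0
  then show ?case using assms(3) by (auto intro: continuous_on_compose2)
next
  case (Suc k)
  have fd: "f differentiable (at x)" if "x \<in> S" for x using Suc.prems that by auto
  have gd: "g differentiable (at (f x))" if "x \<in> S" for x using Suc.prems assms(3) that by auto
  have "Ck_on k S (dd (\<lambda>x. g (f x)) v)" for v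
  proof (rule Ck_on_cong[OF assms(1)])
    show "Ck_on k S (\<lambda>x. \<Sum>b\<in>Basis. (dd f v x \<bullet> b) *\<^sub>R dd g b (f x))"
    proof (rule Ck_on_sum[OF assms(1)], rule Ck_on_bilinear[OF assms(1) bounded_bilinear_scaleR])
      fix b :: 'y
      show "Ck_on k S (\<lambda>x. dd f v x \<bullet> b)"
        using Suc.prems by (intro Ck_on_linear_compose[OF assms(1) bounded_linear_inner_left]) auto
      show "Ck_on k S (\<lambda>x. dd g b (f x))"
        using Suc.prems Ck_on_SucD[OF Suc.prems(1)] by (intro Suc.IH) auto
    qed
    fix x assume x: "x \<in> S"
    have "dd (\<lambda>x. g (f x)) v x = dd g (dd f v x) (f x)"
      by (rule dd_chain[OF fd[OF x] gd[OF x]])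
    also have "\<dots> = dd g (\<Sum>b\<in>Basis. (dd f v x \<bullet> b) *\<^sub>R b) (f x)"
      by (simp add: euclidean_representation)
    also have "\<dots> = (\<Sum>b\<in>Basis. (dd f v x \<bullet> b) *\<^sub>R dd g b (f x))"
      using linear_dd[OF gd[OF x]] by (simp add: linear_sum linear_scale)
    finally show "(\<Sum>b\<in>Basis. (dd f v x \<bullet> b) *\<^sub>R dd g b (f x)) = dd (\<lambda>x. g (f x)) v x" ..
  qed
  moreover have "(\<lambda>x. g (f x)) differentiable (at x)" if "x \<in> S" for x
    using differentiable_chain_at[OF fd[OF that] gd[OF that]] by (simp add: o_def)
  ultimately show ?case by simp
qed

lemma smooth_on_continuous: "smooth_on S f \<Longrightarrow> continuous_on S f"
  using Ck_on_continuous smooth_on_def by blast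

lemma smooth_on_differentiable: "smooth_on S f \<Longrightarrow> x \<in> S \<Longrightarrow> f differentiable (at x)"
  unfolding smooth_on_def by (metis Ck_on.simps(2))

lemma smooth_on_has_derivative: "smooth_on S f \<Longrightarrow> x \<in> S \<Longrightarrow> (f has_derivative (\<lambda>v. dd f v x)) (at x)"
  by (intro has_derivative_dd smooth_on_differentiable)

lemma smooth_on_dd: "smooth_on S f \<Longrightarrow> smooth_on S (dd f v)"
  unfolding smooth_on_def by (metis Ck_on.simps(2))

lemma smooth_on_subset: "smooth_on S f \<Longrightarrow> T \<subseteq> S \<Longrightarrow> smooth_on T f"
  unfolding smooth_on_def using Ck_on_subset by blast

lemma smooth_on_cong: "open S \<Longrightarrow> smooth_on S f \<Longrightarrow> (\<And>x. x \<in> S \<Longrightarrow> f x = g x) \<Longrightarrow> smooth_on S g"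
  unfolding smooth_on_def using Ck_on_cong[of S f g] by blast

lemma smooth_on_local:
  assumes "\<And>x. x \<in> S \<Longrightarrow> \<exists>T. open T \<and> x \<in> T \<and> smooth_on T f"
  shows "smooth_on S f"
  unfolding smooth_on_def using assms by (auto intro!: Ck_on_local simp: smooth_on_def)

lemma smooth_on_Un: "open S \<Longrightarrow> open T \<Longrightarrow> smooth_on S f \<Longrightarrow> smooth_on T f \<Longrightarrow> smooth_on (S \<union> T) f"
  by (rule smooth_on_local) blast

lemma smooth_on_const: "smooth_on S (\<lambda>x. c)"
  by (simp add: smooth_on_def Ck_on_const)

lemma smooth_on_linear: "bounded_linear f \<Longrightarrow> smooth_on S f"
  by (simp add: smooth_on_def Ck_on_linear)

lemma smooth_on_linear_compose:
  "open S \<Longrightarrow> bounded_linear L \<Longrightarrow> smooth_on S f \<Longrightarrow> smooth_on S (\<lambda>x. L (f x))"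
  by (simp add: smooth_on_def Ck_on_linear_compose)

lemma smooth_on_id: "smooth_on S (\<lambda>x. x)"
  by (rule smooth_on_linear) (rule bounded_linear_ident)

lemma smooth_on_add: "open S \<Longrightarrow> smooth_on S f \<Longrightarrow> smooth_on S g \<Longrightarrow> smooth_on S (\<lambda>x. f x + g x)"
  by (simp add: smooth_on_def Ck_on_add)

lemma smooth_on_sum:
  "open S \<Longrightarrow> (\<And>i. i \<in> I \<Longrightarrow> smooth_on S (f i)) \<Longrightarrow> smooth_on S (\<lambda>x. \<Sum>i\<in>I. f i x)"
  by (simp add: smooth_on_def Ck_on_sum)

lemma smooth_on_scaleR: "open S \<Longrightarrow> smooth_on S f \<Longrightarrow> smooth_on S g \<Longrightarrow> smooth_on S (\<lambda>x. f x *\<^sub>R g x)"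
  by (simp add: smooth_on_def Ck_on_bilinear[OF _ bounded_bilinear_scaleR])

lemma smooth_on_mult:
  fixes f g :: "'x::real_normed_vector \<Rightarrow> real"
  shows "open S \<Longrightarrow> smooth_on S f \<Longrightarrow> smooth_on S g \<Longrightarrow> smooth_on S (\<lambda>x. f x * g x)"
  by (simp add: smooth_on_def Ck_on_bilinear[OF _ bounded_bilinear_mult])

lemma smooth_on_inner: "open S \<Longrightarrow> smooth_on S f \<Longrightarrow> smooth_on S g \<Longrightarrow> smooth_on S (\<lambda>x. f x \<bullet> g x)"
  by (simp add: smooth_on_def Ck_on_bilinear[OF _ bounded_bilinear_inner])

lemma smooth_on_minus: "open S \<Longrightarrow> smooth_on S f \<Longrightarrow> smooth_on S (\<lambda>x. - f x)"
  by (rule smooth_on_linear_compose[OF _ bounded_linear_minus[OF bounded_linear_ident]])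

lemma smooth_on_diff: "open S \<Longrightarrow> smooth_on S f \<Longrightarrow> smooth_on S g \<Longrightarrow> smooth_on S (\<lambda>x. f x - g x)"
  using smooth_on_add[OF _ _ smooth_on_minus] by fastforce

lemma smooth_on_prod:
  fixes f :: "'i \<Rightarrow> 'x::real_normed_vector \<Rightarrow> real"
  shows "open S \<Longrightarrow> (\<And>i. i \<in> I \<Longrightarrow> smooth_on S (f i)) \<Longrightarrow> smooth_on S (\<lambda>x. \<Prod>i\<in>I. f i x)"
  by (induction I rule: infinite_finite_induct) (auto intro: smooth_on_mult smooth_on_const)

lemma smooth_on_compose:
  fixes f :: "'x::real_normed_vector \<Rightarrow> 'y::euclidean_space" and g :: "'y \<Rightarrow> 'z::real_normed_vector"
  shows "open S \<Longrightarrow> open T \<Longrightarrow> smooth_on S f \<Longrightarrow> smooth_on T g \<Longrightarrow> (\<And>x. x \<in> S \<Longrightarrow> f x \<in> T)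
    \<Longrightarrow> smooth_on S (\<lambda>x. g (f x))"
  unfolding smooth_on_def using Ck_on_compose[of S T f] by blast

lemma smooth_on_Pair:
  assumes "open S" "smooth_on S f" "smooth_on S g"
  shows "smooth_on S (\<lambda>x. (f x, g x))"
proof -
  have "smooth_on S (\<lambda>x. (f x, 0) + (0, g x))"
    by (intro smooth_on_add assms
        smooth_on_linear_compose[OF assms(1) bounded_linear_Pair[OF bounded_linear_ident bounded_linear_zero]]
        smooth_on_linear_compose[OF assms(1) bounded_linear_Pair[OF bounded_linear_zero bounded_linear_ident]])
  then show ?thesis by simp
qed

lemma smooth_on_fst: "smooth_on S fst"
  by (rule smooth_on_linear) (rule bounded_linear_fst)

lemma smooth_on_snd: "smooth_on S snd"
  by (rule smooth_on_linear) (rule bounded_linear_snd)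

lemma smooth_on_nth: "open S \<Longrightarrow> smooth_on S f \<Longrightarrow> smooth_on S (\<lambda>x. f x $ i)"
  by (rule smooth_on_linear_compose[OF _ bounded_linear_vec_nth])

lemma smooth_on_vec:
  fixes f :: "'i::finite \<Rightarrow> 'x::real_normed_vector \<Rightarrow> 'y::real_normed_vector"
  assumes "open S" "\<And>i. smooth_on S (f i)"
  shows "smooth_on S (\<lambda>x. \<chi> i. f i x)"
proof -
  have bl: "bounded_linear (\<lambda>y::'y. axis i y)" for i :: 'i
  proof (rule bounded_linear_intro[where K=1])
    show "norm (axis i x) \<le> norm x * 1" for x :: 'y
    proof -
      have "norm (axis i x) \<le> (\<Sum>j\<in>UNIV. norm (axis i x $ j))"
        unfolding norm_vec_def by (rule L2_set_le_sum) auto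
      also have "\<dots> = norm x" by (simp add: axis_def if_distrib cong: if_cong)
      finally show ?thesis by simp
    qed
  qed (vector axis_def)+
  have "(\<chi> i. f i x) = (\<Sum>i\<in>UNIV. axis i (f i x))" for x
    by (simp add: vec_eq_iff axis_def if_distrib cong: if_cong)
  then show ?thesis
    using smooth_on_sum[OF assms(1), of UNIV "\<lambda>i x. axis i (f i x)"]
      smooth_on_linear_compose[OF assms(1) bl assms(2)] by simp
qed

text \<open>The induction closes because the derivative is a constant times a product of two copies
  of the function itself.\<close>

lemma smooth_on_inverse_ident: "smooth_on (- {0::real}) inverse"
  unfolding smooth_on_def
proof
  fix k
  show "Ck_on k (- {0::real}) inverse"
  proof (induction k)
    case 0
    then show ?case by (auto intro: continuous_on_inverse)
  next
    case (Suc k)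
    have d: "(inverse has_derivative (\<lambda>v. - (inverse x * v * inverse x))) (at x)" if "x \<noteq> 0" for x :: real
      by (rule has_derivative_inverse'[OF that])
    have op: "open (- {0::real})" by auto
    have "Ck_on k (- {0::real}) (\<lambda>x. (- v) * (inverse x * inverse x))" for v :: real
      by (intro Ck_on_bilinear[OF op bounded_bilinear_mult] Ck_on_const Suc)
    then have "Ck_on k (- {0::real}) (dd inverse v)" for v :: real
      by (rule Ck_on_cong[OF op, rotated]) (use dd_eqI[OF d] in auto)
    then show ?case using d by (auto simp: differentiable_def)
  qed
qed

lemma smooth_on_inverse:
  fixes f :: "'x::real_normed_vector \<Rightarrow> real"
  assumes "open S" "smooth_on S f" "\<And>x. x \<in> S \<Longrightarrow> f x \<noteq> 0"
  shows "smooth_on S (\<lambda>x. inverse (f x))"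
  by (rule smooth_on_compose[OF assms(1) _ assms(2) smooth_on_inverse_ident]) (use assms in auto)

lemma smooth_on_divide:
  fixes f g :: "'x::real_normed_vector \<Rightarrow> real"
  assumes "open S" "smooth_on S f" "smooth_on S g" "\<And>x. x \<in> S \<Longrightarrow> g x \<noteq> 0"
  shows "smooth_on S (\<lambda>x. f x / g x)"
  unfolding divide_inverse by (intro smooth_on_mult smooth_on_inverse assms)

lemma smooth_on_det:
  fixes f :: "'x::real_normed_vector \<Rightarrow> real^'n^'n"
  assumes "open S" "\<And>i j. smooth_on S (\<lambda>x. f x $ i $ j)"
  shows "smooth_on S (\<lambda>x. det (f x))"
  unfolding det_def by (intro smooth_on_sum smooth_on_mult smooth_on_const smooth_on_prod assms)

text \<open>Smoothness of the solution of a linear system is read off Cramer's rule.\<close>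
lemma smooth_on_linear_solve:
  fixes A :: "'x::real_normed_vector \<Rightarrow> real^'n^'n" and b :: "'x \<Rightarrow> real^'n"
  assumes "open S" "\<And>i j. smooth_on S (\<lambda>x. A x $ i $ j)" "\<And>i. smooth_on S (\<lambda>x. b x $ i)"
    and "\<And>x. x \<in> S \<Longrightarrow> det (A x) \<noteq> 0" "\<And>x. x \<in> S \<Longrightarrow> A x *v z x = b x"
  shows "smooth_on S z"
proof -
  have "smooth_on S (\<lambda>x. \<chi> k. det(\<chi> i j. if j=k then b x$i else A x$i$j) / det (A x))"
  proof (intro smooth_on_vec smooth_on_divide smooth_on_det assms)
    fix i j k
    show "smooth_on S (\<lambda>x. (\<chi> i j. if j=k then b x$i else A x$i$j) $ i $ j)"
      using assms(2,3) by (cases "j = k") auto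
  qed auto
  then show ?thesis
    by (rule smooth_on_cong[OF assms(1)]) (simp add: cramer[OF assms(4), THEN iffD1, OF _ assms(5)])
qed

section \<open>Symmetry of second derivatives\<close>

lemma second_difference_real:
  fixes f :: "'x::real_normed_vector \<Rightarrow> real"
  assumes f: "smooth_on S f" and h: "0 < h" and S: "\<And>s t. s \<in> {0..h} \<Longrightarrow> t \<in> {0..h} \<Longrightarrow> x + s *\<^sub>R u + t *\<^sub>R v \<in> S"
  shows "\<exists>s t. s \<in> {0..h} \<and> t \<in> {0..h} \<and>
    f (x + h *\<^sub>R u + h *\<^sub>R v) - f (x + h *\<^sub>R u) - f (x + h *\<^sub>R v) + f x = h * h * dd (dd f u) v (x + s *\<^sub>R u + t *\<^sub>R v)"
proof -
  \<comment> \<open>The mixed second difference is the increment of \<open>\<phi>\<close> over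
    \<open>{0..h}\<close>; the mean value theorem is applied once in direction \<open>u\<close> and
    once in direction \<open>v\<close>. The difference is symmetric in \<open>u\<close> and
    \<open>v\<close>, so exchanging them compares the other mixed derivative with the same
    quantity.\<close>
  define \<phi> where "\<phi> s = f (x + s *\<^sub>R u + h *\<^sub>R v) - f (x + s *\<^sub>R u)" for s
  have der: "((\<lambda>s. g (y + s *\<^sub>R w)) has_real_derivative dd g w (y + s *\<^sub>R w)) (at s)"
    if "g differentiable (at (y + s *\<^sub>R w))" for g :: "'x \<Rightarrow> real" and y w s
  proof -
    have "((\<lambda>s. y + s *\<^sub>R w) has_derivative (\<lambda>r. r *\<^sub>R w)) (at s)"
      by (auto intro!: derivative_eq_intros)
    from diff_chain_at[OF this has_derivative_dd[OF that]]
    show ?thesis using linear_dd[OF that]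
      by (simp add: o_def has_field_derivative_def linear_scale mult.commute[of _ "dd g w _"])
  qed
  have "(\<phi> has_real_derivative dd f u (x + s *\<^sub>R u + h *\<^sub>R v) - dd f u (x + s *\<^sub>R u)) (at s)"
    if s: "0 \<le> s" "s \<le> h" for s
    unfolding \<phi>_def
    using der[of f "x + h *\<^sub>R v" s u] der[of f x s u] S[of s h] S[of s 0] s h
    by (intro DERIV_diff) (auto simp: ac_simps intro: smooth_on_differentiable[OF f])
  from MVT2[OF h this] obtain s where s: "0 < s" "s < h"
    "\<phi> h - \<phi> 0 = (h - 0) * (dd f u (x + s *\<^sub>R u + h *\<^sub>R v) - dd f u (x + s *\<^sub>R u))" by blast
  have "((\<lambda>t. dd f u (x + s *\<^sub>R u + t *\<^sub>R v)) has_real_derivative dd (dd f u) v (x + s *\<^sub>R u + t *\<^sub>R v)) (at t)"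
    if "0 \<le> t" "t \<le> h" for t
    using that s S[of s t] by (intro der smooth_on_differentiable[OF smooth_on_dd[OF f]]) auto
  from MVT2[OF h this] obtain t where t: "0 < t" "t < h"
    "dd f u (x + s *\<^sub>R u + h *\<^sub>R v) - dd f u (x + s *\<^sub>R u + 0 *\<^sub>R v) = (h - 0) * dd (dd f u) v (x + s *\<^sub>R u + t *\<^sub>R v)" by blast
  then show ?thesis
    using s t by (intro exI[of _ s] exI[of _ t]) (auto simp: \<phi>_def algebra_simps)
qed

lemma dd_commute_real:
  fixes f :: "'x::real_normed_vector \<Rightarrow> real"
  assumes S: "open S" "x \<in> S" and f: "smooth_on S f"
  shows "dd (dd f u) v x = dd (dd f v) u x"
proof (rule ccontr)
  assume ne: "dd (dd f u) v x \<noteq> dd (dd f v) u x"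
  define e where "e = \<bar>dd (dd f u) v x - dd (dd f v) u x\<bar> / 2"
  have e: "e > 0" using ne by (simp add: e_def)
  have c: "isCont (dd (dd f u) v) x" "isCont (dd (dd f v) u) x"
    using smooth_on_continuous[OF smooth_on_dd[OF smooth_on_dd[OF f]]] S
    by (auto simp: continuous_on_eq_continuous_at)
  obtain r where r: "r > 0" "ball x r \<subseteq> S" using S openE by blast
  obtain r1 where r1: "r1 > 0" "\<And>y. dist y x < r1 \<Longrightarrow> dist (dd (dd f u) v y) (dd (dd f u) v x) < e"
    using c(1) e unfolding continuous_at_eps_delta by blast
  obtain r2 where r2: "r2 > 0" "\<And>y. dist y x < r2 \<Longrightarrow> dist (dd (dd f v) u y) (dd (dd f v) u x) < e"
    using c(2) e unfolding continuous_at_eps_delta by blast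
  define R where "R = min r (min r1 r2)"
  \<comment> \<open>Keeps the whole parallelogram spanned by \<open>h *\<^sub>R u\<close> and
    \<open>h *\<^sub>R v\<close> within distance \<open>R / 2\<close> of \<open>x\<close>; the
    summand 1 keeps the denominator positive when both directions vanish.\<close>
  define h where "h = R / (2 * (norm u + norm v + 1))"
  have R: "R > 0" using r r1 r2 by (simp add: R_def)
  have n: "norm u + norm v + 1 > 0" using norm_ge_zero[of u] norm_ge_zero[of v] by linarith
  have h: "h > 0" using R n by (simp add: h_def)
  have near: "dist (x + s *\<^sub>R u + t *\<^sub>R v) x < R" if "s \<in> {0..h}" "t \<in> {0..h}" for s t
  proof -
    have "norm (s *\<^sub>R u + t *\<^sub>R v) \<le> s * norm u + t * norm v"
      using norm_triangle_ineq[of "s *\<^sub>R u" "t *\<^sub>R v"] that by simp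
    also have "\<dots> \<le> h * norm u + h * norm v"
      using that by (intro add_mono mult_right_mono) auto
    also have "\<dots> \<le> h * (norm u + norm v + 1)" using h by (simp add: algebra_simps)
    also have "\<dots> = R / 2" using n unfolding h_def by (simp del: distrib_left_numeral)
    also have "\<dots> < R" using R by simp
    finally show ?thesis by (simp add: dist_norm algebra_simps)
  qed
  have inS: "x + s *\<^sub>R u + t *\<^sub>R v \<in> S" if "s \<in> {0..h}" "t \<in> {0..h}" for s t
    using near[OF that] r by (auto simp: R_def dist_commute mem_ball subset_iff)
  obtain s t where 1: "s \<in> {0..h}" "t \<in> {0..h}"
    "f (x + h *\<^sub>R u + h *\<^sub>R v) - f (x + h *\<^sub>R u) - f (x + h *\<^sub>R v) + f x = h * h * dd (dd f u) v (x + s *\<^sub>R u + t *\<^sub>R v)"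
    using second_difference_real[OF f h inS] by blast
  have inS': "x + s *\<^sub>R v + t *\<^sub>R u \<in> S" if "s \<in> {0..h}" "t \<in> {0..h}" for s t
    using inS[OF that(2,1)] by (simp add: ac_simps)
  obtain s' t' where 2: "s' \<in> {0..h}" "t' \<in> {0..h}"
    "f (x + h *\<^sub>R v + h *\<^sub>R u) - f (x + h *\<^sub>R v) - f (x + h *\<^sub>R u) + f x = h * h * dd (dd f v) u (x + s' *\<^sub>R v + t' *\<^sub>R u)"
    using second_difference_real[OF f h inS'] by blast
  have "h * h * dd (dd f u) v (x + s *\<^sub>R u + t *\<^sub>R v) = h * h * dd (dd f v) u (x + s' *\<^sub>R v + t' *\<^sub>R u)"
    using 1(3) 2(3) unfolding add.assoc add.commute[of "h *\<^sub>R v" "h *\<^sub>R u"] by linarith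
  then have eq: "dd (dd f u) v (x + s *\<^sub>R u + t *\<^sub>R v) = dd (dd f v) u (x + t' *\<^sub>R u + s' *\<^sub>R v)"
    using h by (simp add: add.assoc add.commute[of "t' *\<^sub>R u"])
  have "dist (dd (dd f u) v (x + s *\<^sub>R u + t *\<^sub>R v)) (dd (dd f u) v x) < e"
    "dist (dd (dd f v) u (x + t' *\<^sub>R u + s' *\<^sub>R v)) (dd (dd f v) u x) < e"
    using near[OF 1(1,2)] near[OF 2(2,1)] by (auto intro!: r1 r2 simp: R_def)
  then show False using eq unfolding dist_real_def e_def by (simp add: abs_if split: if_splits)
qed

lemma dd_linear_compose:
  assumes "bounded_linear L" "f differentiable (at x)"
  shows "dd (\<lambda>x. L (f x)) v x = L (dd f v x)"
  by (rule dd_eqI) (rule bounded_linear.has_derivative[OF assms(1) has_derivative_dd[OF assms(2)]])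

lemma dd_commute:
  fixes f :: "'x::real_normed_vector \<Rightarrow> 'y::euclidean_space"
  assumes S: "open S" "x \<in> S" and f: "smooth_on S f"
  shows "dd (dd f u) v x = dd (dd f v) u x"
proof (rule euclidean_eqI)
  fix b :: 'y assume "b \<in> Basis"
  have *: "dd (dd f u) v x \<bullet> b = dd (dd (\<lambda>x. f x \<bullet> b) u) v x" for u v
  proof -
    have "dd (dd f u) v x \<bullet> b = dd (\<lambda>x. dd f u x \<bullet> b) v x"
      by (rule dd_linear_compose[OF bounded_linear_inner_left, symmetric])
        (rule smooth_on_differentiable[OF smooth_on_dd[OF f] S(2)])
    also have "\<dots> = dd (dd (\<lambda>x. f x \<bullet> b) u) v x"
    proof (rule dd_cong_open[OF S])
      show "dd f u y \<bullet> b = dd (\<lambda>x. f x \<bullet> b) u y" if "y \<in> S" for y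
        by (rule dd_linear_compose[OF bounded_linear_inner_left, symmetric])
          (rule smooth_on_differentiable[OF f that])
      show "(\<lambda>x. dd f u x \<bullet> b) differentiable (at x)"
        by (rule smooth_on_differentiable[OF smooth_on_linear_compose[OF S(1) bounded_linear_inner_left smooth_on_dd[OF f]] S(2)])
    qed
    finally show ?thesis .
  qed
  show "dd (dd f u) v x \<bullet> b = dd (dd f v) u x \<bullet> b"
    unfolding * by (rule dd_commute_real[OF S]) (rule smooth_on_linear_compose[OF S(1) bounded_linear_inner_left f])
qed

section \<open>Bump functions\<close>

text \<open>The exponent \<open>n\<close> makes the family closed under differentiation up to linear
  combinations, which the induction for smoothness needs; the case 0 is the classical function that
  is flat at the origin.\<close>

definition flat_exp :: "nat \<Rightarrow> real \<Rightarrow> real" where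
  "flat_exp n x = (if x > 0 then inverse x ^ n * exp (- inverse x) else 0)"

lemma flat_exp_tendsto_0: "(flat_exp n \<longlongrightarrow> 0) (at 0)"
proof -
  have "((\<lambda>x::real. inverse x ^ n / exp (inverse x)) \<longlongrightarrow> 0) (at_right 0)"
    by (rule filterlim_compose[OF tendsto_power_div_exp_0 filterlim_inverse_at_top_right])
  moreover have "eventually (\<lambda>x. inverse x ^ n / exp (inverse x) = flat_exp n x) (at_right 0)"
    unfolding flat_exp_def by (auto simp: eventually_at_filter exp_minus divide_inverse)
  ultimately have r: "(flat_exp n \<longlongrightarrow> 0) (at_right 0)"
    using Lim_transform_eventually by blast
  have "eventually (\<lambda>x. 0 = flat_exp n x) (at_left 0)"
    unfolding flat_exp_def by (auto simp: eventually_at_filter)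
  then have "(flat_exp n \<longlongrightarrow> 0) (at_left 0)"
    using Lim_transform_eventually tendsto_const by blast
  with r show ?thesis by (simp add: filterlim_split_at)
qed

lemma flat_exp_has_derivative:
  "(flat_exp n has_real_derivative flat_exp (n + 2) x - n * flat_exp (n + 1) x) (at x)"
proof -
  consider "x > 0" | "x < 0" | "x = 0" by linarith
  then show ?thesis
  proof cases
    case 1
    have n: "real n * inverse x ^ (n - 1) * (inverse x * inverse x) = real n * inverse x ^ (n + 1)"
      by (cases n) (auto simp: power_add)
    have "((\<lambda>x. inverse x ^ n * exp (- inverse x)) has_real_derivative
       (inverse x ^ n * (exp (- inverse x) * (inverse x * inverse x)) +
         - (real n * inverse x ^ (n - 1) * (inverse x * inverse x)) * exp (- inverse x))) (at x)"
      using 1 by (auto intro!: derivative_eq_intros)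
    then have "((\<lambda>x. inverse x ^ n * exp (- inverse x)) has_real_derivative
       flat_exp (n + 2) x - n * flat_exp (n + 1) x) (at x)"
      unfolding n using 1 by (simp add: flat_exp_def power_add power2_eq_square algebra_simps)
    then show ?thesis
      by (rule has_field_derivative_transform_within_open[where S="{0<..}"]) (use 1 in \<open>auto simp: flat_exp_def\<close>)
  next
    case 2
    have "((\<lambda>x. 0) has_real_derivative flat_exp (n + 2) x - n * flat_exp (n + 1) x) (at x)"
      using 2 by (simp add: flat_exp_def)
    then show ?thesis
      by (rule has_field_derivative_transform_within_open[where S="{..<0}"]) (use 2 in \<open>auto simp: flat_exp_def\<close>)
  next
    case 3
    \<comment> \<open>At the origin the difference quotient of one member is exactly the next member
      of the family, whose limit there is 0.\<close>
    have "eventually (\<lambda>h. flat_exp (n + 1) h = (flat_exp n (0 + h) - flat_exp n 0) / h) (at 0)"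
      by (auto simp: eventually_at_filter flat_exp_def divide_inverse)
    then have "((\<lambda>h. (flat_exp n (0 + h) - flat_exp n 0) / h) \<longlongrightarrow> 0) (at 0)"
      by (rule Lim_transform_eventually[OF flat_exp_tendsto_0])
    then show ?thesis using 3 by (simp add: DERIV_def flat_exp_def)
  qed
qed

lemma smooth_on_flat_exp: "smooth_on S (flat_exp n)"
proof -
  have "Ck_on k UNIV (flat_exp n)" for k n
  proof (induction k arbitrary: n)
    case 0
    then show ?case
      using DERIV_isCont[OF flat_exp_has_derivative] by (auto intro!: continuous_at_imp_continuous_on)
  next
    case (Suc k)
    have d: "(flat_exp n has_derivative (\<lambda>v. v * (flat_exp (n + 2) x - n * flat_exp (n + 1) x))) (at x)" for x
      using flat_exp_has_derivative[of n x] unfolding has_field_derivative_def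
      by (rule has_derivative_eq_rhs) (simp add: fun_eq_iff)
    have "Ck_on k UNIV (\<lambda>x. v * (flat_exp (n + 2) x + (- real n) * flat_exp (n + 1) x))" for v
      by (intro Ck_on_bilinear[OF _ bounded_bilinear_mult] Ck_on_add Ck_on_const Suc) auto
    then have "Ck_on k UNIV (dd (flat_exp n) v)" for v
      by (rule Ck_on_cong[OF open_UNIV, rotated]) (use dd_eqI[OF d] in auto)
    then show ?case using d by (auto simp: differentiable_def)
  qed
  then have "smooth_on UNIV (flat_exp n)" by (simp add: smooth_on_def)
  then show ?thesis by (rule smooth_on_subset) auto
qed

text \<open>The squared distance enters, and not the distance, because it is smooth at the centre
  too.\<close>

lemma bump_function_exists:
  fixes a :: "'x::euclidean_space"
  assumes "r > 0"
  obtains f :: "'x \<Rightarrow> real" where "smooth_on UNIV f" "\<And>x. 0 \<le> f x" "f a > 0" "\<And>x. x \<notin> cball a r \<Longrightarrow> f x = 0"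
proof
  let ?f = "\<lambda>x. flat_exp 0 (r^2 - (x - a) \<bullet> (x - a))"
  show "smooth_on UNIV ?f"
    by (rule smooth_on_compose[OF _ open_UNIV _ smooth_on_flat_exp])
      (auto intro!: smooth_on_diff smooth_on_const smooth_on_inner smooth_on_id)
  show "?f x = 0" if "x \<notin> cball a r" for x
  proof -
    have "r < norm (x - a)" using that by (simp add: dist_norm norm_minus_commute)
    then have "r^2 \<le> (norm (x - a))^2" using assms by (intro power_mono) auto
    then show ?thesis by (simp add: flat_exp_def power2_norm_eq_inner)
  qed
qed (use assms in \<open>auto simp: flat_exp_def\<close>)


section \<open>Charts and tangent vectors\<close>

lemma open_chart_dom: "smooth_atlas A \<Longrightarrow> c \<in> A \<Longrightarrow> open (chart_dom c)"
  and open_chart_img: "smooth_atlas A \<Longrightarrow> c \<in> A \<Longrightarrow> open (chart_img c)"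
  by (simp_all add: smooth_atlas_def is_chart_def)

lemma chart_homeomorphism:
  "smooth_atlas A \<Longrightarrow> c \<in> A \<Longrightarrow> homeomorphism (chart_dom c) (chart_img c) (snd c) (chart_inv c)"
  by (simp add: smooth_atlas_def is_chart_def)

lemma chart_inv_chart: "smooth_atlas A \<Longrightarrow> c \<in> A \<Longrightarrow> p \<in> chart_dom c \<Longrightarrow> chart_inv c (snd c p) = p"
  using chart_homeomorphism homeomorphism_apply1 by metis

lemma chart_chart_inv: "x \<in> chart_img c \<Longrightarrow> snd c (chart_inv c x) = x"
  by (rule f_inv_into_f)

lemma chart_inv_in: "x \<in> chart_img c \<Longrightarrow> chart_inv c x \<in> chart_dom c"
  by (rule inv_into_into)

lemma chart_in: "p \<in> chart_dom c \<Longrightarrow> snd c p \<in> chart_img c"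
  by (rule imageI)

lemma continuous_on_chart: "smooth_atlas A \<Longrightarrow> c \<in> A \<Longrightarrow> continuous_on (chart_dom c) (snd c)"
  and continuous_on_chart_inv: "smooth_atlas A \<Longrightarrow> c \<in> A \<Longrightarrow> continuous_on (chart_img c) (chart_inv c)"
  using chart_homeomorphism homeomorphism_cont1 homeomorphism_cont2 by metis+

lemma atlas_cover: "smooth_atlas A \<Longrightarrow> \<exists>c\<in>A. p \<in> chart_dom c"
  by (auto simp: smooth_atlas_def)

lemma open_chart_preimage:
  assumes "smooth_atlas A" "c \<in> A" "open V"
  shows "open {x \<in> chart_img c. chart_inv c x \<in> V}"
proof -
  have "{x \<in> chart_img c. chart_inv c x \<in> V} = chart_img c \<inter> chart_inv c -` V" by auto
  then show ?thesis
    using continuous_open_preimage[OF continuous_on_chart_inv[OF assms(1,2)] open_chart_img[OF assms(1,2)] assms(3)]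
    by (simp only:)
qed

lemma chart_image_eq:
  assumes "smooth_atlas A" "c \<in> A"
  shows "snd c ` (chart_dom c \<inter> V) = {x \<in> chart_img c. chart_inv c x \<in> V}"
proof
  show "snd c ` (chart_dom c \<inter> V) \<subseteq> {x \<in> chart_img c. chart_inv c x \<in> V}"
    using chart_inv_chart[OF assms] by auto
  show "{x \<in> chart_img c. chart_inv c x \<in> V} \<subseteq> snd c ` (chart_dom c \<inter> V)"
  proof
    fix x assume "x \<in> {x \<in> chart_img c. chart_inv c x \<in> V}"
    then show "x \<in> snd c ` (chart_dom c \<inter> V)"
      using chart_chart_inv[of x c] chart_inv_in[of x c] by (intro image_eqI[of _ _ "chart_inv c x"]) auto
  qed
qed

lemma smooth_transition:
  assumes "smooth_atlas A" "c \<in> A" "c' \<in> A"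
  shows "smooth_on {x \<in> chart_img c. chart_inv c x \<in> chart_dom c'} (snd c' \<circ> chart_inv c)"
proof -
  have "smooth_transition c c'" using assms by (auto simp: smooth_atlas_def)
  then show ?thesis unfolding smooth_transition_def chart_image_eq[OF assms(1,2)] .
qed

lemma transition_differentiable:
  assumes "smooth_atlas A" "c \<in> A" "c' \<in> A" "p \<in> chart_dom c" "p \<in> chart_dom c'"
  shows "(snd c' \<circ> chart_inv c) differentiable (at (snd c p))"
  using smooth_on_differentiable[OF smooth_transition[OF assms(1-3)], of "snd c p"] assms
  by (simp add: chart_inv_chart)

lemma linear_transition_deriv:
  assumes "smooth_atlas A" "c \<in> A" "c' \<in> A" "p \<in> chart_dom c" "p \<in> chart_dom c'"
  shows "linear (transition_deriv c c' p)"
  unfolding transition_deriv_def by (rule linear_dd[OF transition_differentiable[OF assms]])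

text \<open>It is this cocycle identity, a case of the chain rule, that makes
  \<open>coord_vec\<close> satisfy the compatibility demanded by
  \<open>tangent_space\<close>.\<close>

lemma transition_deriv_trans:
  assumes A: "smooth_atlas A" "c \<in> A" "c' \<in> A" "c'' \<in> A"
    and p: "p \<in> chart_dom c" "p \<in> chart_dom c'" "p \<in> chart_dom c''"
  shows "transition_deriv c' c'' p (transition_deriv c c' p u) = transition_deriv c c'' p u"
proof -
  let ?S = "{x \<in> chart_img c. chart_inv c x \<in> chart_dom c'}"
  let ?g = "snd c'' \<circ> chart_inv c'" and ?f = "snd c' \<circ> chart_inv c"
  have df: "?f differentiable (at (snd c p))" by (rule transition_differentiable[OF A(1-3) p(1,2)])
  have fx: "?f (snd c p) = snd c' p" by (simp add: chart_inv_chart[OF A(1,2) p(1)])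
  have dg: "?g differentiable (at (?f (snd c p)))"
    unfolding fx by (rule transition_differentiable[OF A(1,3,4) p(2,3)])
  have "transition_deriv c' c'' p (transition_deriv c c' p u) = dd (\<lambda>x. ?g (?f x)) u (snd c p)"
    unfolding transition_deriv_def dd_chain[OF df dg] fx ..
  also have "\<dots> = dd (snd c'' \<circ> chart_inv c) u (snd c p)"
  proof (rule dd_cong_open)
    show "open ?S" using open_chart_preimage A open_chart_dom by blast
    show "snd c p \<in> ?S" using p chart_inv_chart[OF A(1,2) p(1)] by auto
    show "?g (?f y) = (snd c'' \<circ> chart_inv c) y" if "y \<in> ?S" for y
      using that chart_inv_chart[OF A(1,3)] by auto
    show "(\<lambda>x. ?g (?f x)) differentiable (at (snd c p))"
      using differentiable_chain_at[OF df dg] by (simp add: o_def)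
  qed
  finally show ?thesis by (simp add: transition_deriv_def)
qed

lemma transition_deriv_self:
  assumes A: "smooth_atlas A" "c \<in> A" and p: "p \<in> chart_dom c"
  shows "transition_deriv c c p u = u"
proof -
  have "dd (\<lambda>x. x) u (snd c p) = dd (snd c \<circ> chart_inv c) u (snd c p)"
  proof (rule dd_cong_open[OF open_chart_img[OF A] chart_in[OF p]])
    show "y = (snd c \<circ> chart_inv c) y" if "y \<in> chart_img c" for y
      using chart_chart_inv[OF that] by simp
  qed simp
  then show ?thesis by (simp add: transition_deriv_def)
qed

lemma coord_vec_apply:
  "c' \<in> A \<Longrightarrow> p \<in> chart_dom c' \<Longrightarrow> coord_vec A c p u c' = transition_deriv c c' p u"
  by (simp add: coord_vec_def)

lemma coord_vec_self:
  "smooth_atlas A \<Longrightarrow> c \<in> A \<Longrightarrow> p \<in> chart_dom c \<Longrightarrow> coord_vec A c p u c = u"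
  by (simp add: coord_vec_def transition_deriv_self)

lemma coord_vec_in_tangent_space:
  "smooth_atlas A \<Longrightarrow> c \<in> A \<Longrightarrow> p \<in> chart_dom c \<Longrightarrow> coord_vec A c p u \<in> tangent_space A p"
  by (auto simp: tangent_space_def coord_vec_def transition_deriv_trans)

lemma tangent_vec_transition:
  "v \<in> tangent_space A p \<Longrightarrow> c \<in> A \<Longrightarrow> c' \<in> A \<Longrightarrow> p \<in> chart_dom c \<Longrightarrow> p \<in> chart_dom c' \<Longrightarrow>
    v c' = transition_deriv c c' p (v c)"
  unfolding tangent_space_def by blast

lemma tangent_vec_outside:
  "v \<in> tangent_space A p \<Longrightarrow> \<not> (c \<in> A \<and> p \<in> chart_dom c) \<Longrightarrow> v c = 0"
  unfolding tangent_space_def by blast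

lemma coord_vec_components:
  assumes "c \<in> A" "p \<in> chart_dom c" "v \<in> tangent_space A p"
  shows "coord_vec A c p (v c) = v"
proof
  fix c'
  show "coord_vec A c p (v c) c' = v c'"
    unfolding coord_vec_def using tangent_vec_transition[OF assms(3,1) _ assms(2), of c']
      tangent_vec_outside[OF assms(3), of c'] by presburger
qed

lemma coord_vec_change:
  assumes "smooth_atlas A" "c \<in> A" "c' \<in> A" "p \<in> chart_dom c" "p \<in> chart_dom c'"
  shows "coord_vec A c p u = coord_vec A c' p (transition_deriv c c' p u)"
  using coord_vec_components[OF assms(3,5) coord_vec_in_tangent_space[OF assms(1,2,4)], of u]
  by (simp add: coord_vec_apply[OF assms(3,5)])

section \<open>Smooth functions and partitions of unity\<close>

text \<open>A vector-valued version of \<open>smooth_fun\<close>: the components of a field along a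
  map, taken in one chart of the target, form such a function on the source.\<close>

definition smooth_vfun :: "('a::topological_space, 'm::finite) chart set \<Rightarrow> ('a \<Rightarrow> 'v::real_normed_vector) \<Rightarrow> bool" where
  "smooth_vfun A f \<longleftrightarrow> (\<forall>c\<in>A. smooth_on (chart_img c) (\<lambda>x. f (chart_inv c x)))"

lemma smooth_fun_iff_vfun: "smooth_fun A f \<longleftrightarrow> smooth_vfun A f"
  by (simp add: smooth_fun_def smooth_vfun_def o_def)

lemma smooth_vfun_chart:
  "smooth_vfun A f \<Longrightarrow> c \<in> A \<Longrightarrow> smooth_on (chart_img c) (\<lambda>x. f (chart_inv c x))"
  by (simp add: smooth_vfun_def)

lemma smooth_vfun_continuous:
  fixes A :: "('a::t2_space, 'm::finite) chart set"
  assumes A: "smooth_atlas A" and f: "smooth_vfun A f"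
  shows "continuous_on UNIV f"
proof -
  have "isCont f p" for p
  proof -
    obtain c where c: "c \<in> A" "p \<in> chart_dom c" using atlas_cover[OF A] by blast
    have "continuous_on (chart_dom c) (\<lambda>q. (\<lambda>x. f (chart_inv c x)) (snd c q))"
      by (rule continuous_on_compose2[OF smooth_on_continuous[OF smooth_vfun_chart[OF f c(1)]]
            continuous_on_chart[OF A c(1)]]) auto
    then have "continuous_on (chart_dom c) f"
      by (rule continuous_on_eq) (simp add: chart_inv_chart[OF A c(1)])
    then show ?thesis using open_chart_dom[OF A c(1)] c by (simp add: continuous_on_eq_continuous_at)
  qed
  then show ?thesis by (simp add: continuous_at_imp_continuous_on)
qed

text \<open>\<open>V\<close> and the complement of \<open>K\<close> form an open cover: smoothness
  is assumed on the first, and the function vanishes on the second. This is how fields known in one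
  chart only become global after cutting off.\<close>

lemma smooth_vfun_extend_by_0:
  assumes A: "smooth_atlas A" and V: "open V" and K: "closed K" "K \<subseteq> V"
    and Z: "\<And>p. p \<notin> K \<Longrightarrow> Z p = 0"
    and s: "\<And>c. c \<in> A \<Longrightarrow> smooth_on {x \<in> chart_img c. chart_inv c x \<in> V} (\<lambda>x. Z (chart_inv c x))"
  shows "smooth_vfun A Z"
  unfolding smooth_vfun_def
proof
  fix c assume c: "c \<in> A"
  have o1: "open {x \<in> chart_img c. chart_inv c x \<in> V}" by (rule open_chart_preimage[OF A c V])
  have o2: "open {x \<in> chart_img c. chart_inv c x \<in> - K}"
    by (rule open_chart_preimage[OF A c]) (use K in \<open>simp add: open_Compl\<close>)
  have "smooth_on {x \<in> chart_img c. chart_inv c x \<in> - K} (\<lambda>x. Z (chart_inv c x))"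
    by (rule smooth_on_cong[OF o2 smooth_on_const[of _ 0]]) (simp add: Z)
  then have "smooth_on ({x \<in> chart_img c. chart_inv c x \<in> V} \<union> {x \<in> chart_img c. chart_inv c x \<in> - K})
      (\<lambda>x. Z (chart_inv c x))"
    by (rule smooth_on_Un[OF o1 o2 s[OF c]])
  moreover have "{x \<in> chart_img c. chart_inv c x \<in> V} \<union> {x \<in> chart_img c. chart_inv c x \<in> - K} = chart_img c"
    using K by auto
  ultimately show "smooth_on (chart_img c) (\<lambda>x. Z (chart_inv c x))" by metis
qed

lemma smooth_chart_change:
  assumes A: "smooth_atlas A" and c: "c \<in> A" "c' \<in> A" and V: "open V" "V \<subseteq> chart_dom c'"
    and s: "smooth_on {x \<in> chart_img c'. chart_inv c' x \<in> V} (\<lambda>x. Z (chart_inv c' x))"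
  shows "smooth_on {x \<in> chart_img c. chart_inv c x \<in> V} (\<lambda>x. Z (chart_inv c x))"
proof -
  have "smooth_on {x \<in> chart_img c. chart_inv c x \<in> V} (\<lambda>x. Z (chart_inv c' ((snd c' \<circ> chart_inv c) x)))"
  proof (rule smooth_on_compose[OF _ _ _ s])
    show "smooth_on {x \<in> chart_img c. chart_inv c x \<in> V} (snd c' \<circ> chart_inv c)"
      by (rule smooth_on_subset[OF smooth_transition[OF A c]]) (use V in auto)
    show "(snd c' \<circ> chart_inv c) x \<in> {x \<in> chart_img c'. chart_inv c' x \<in> V}"
      if "x \<in> {x \<in> chart_img c. chart_inv c x \<in> V}" for x
      using that V chart_inv_chart[OF A c(2)] by auto
  qed (use open_chart_preimage[OF A] V c in auto)
  then show ?thesis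
    by (rule smooth_on_cong[rotated]) (use V open_chart_preimage[OF A c(1)] chart_inv_chart[OF A c(2)] in auto)
qed

lemma smooth_vfun_extend_by_0_chart:
  assumes A: "smooth_atlas A" and c: "c \<in> A" and V: "open V" "V \<subseteq> chart_dom c" and K: "closed K" "K \<subseteq> V"
    and Z: "\<And>p. p \<notin> K \<Longrightarrow> Z p = 0"
    and s: "smooth_on {x \<in> chart_img c. chart_inv c x \<in> V} (\<lambda>x. Z (chart_inv c x))"
  shows "smooth_vfun A Z"
  by (rule smooth_vfun_extend_by_0[OF A V(1) K Z]) (auto intro: smooth_chart_change[OF A _ c V s])

text \<open>A bump on a closed coordinate ball is transported by the chart and extended by 0. The
  image of the ball is compact, hence closed because the manifold is Hausdorff, as the extension
  lemma asks.\<close>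

lemma manifold_bump_exists:
  fixes A :: "('a::t2_space, 'm::finite) chart set"
  assumes A: "smooth_atlas A" and U: "open U" "p \<in> U"
  shows "\<exists>f K. smooth_fun A f \<and> (\<forall>q. 0 \<le> f q) \<and> f p > 0 \<and> compact K \<and> K \<subseteq> U \<and> (\<forall>q. q \<notin> K \<longrightarrow> f q = 0)"
proof -
  obtain c where c: "c \<in> A" "p \<in> chart_dom c" using atlas_cover[OF A] by blast
  let ?S = "{x \<in> chart_img c. chart_inv c x \<in> U}"
  have "open ?S" "snd c p \<in> ?S"
    using open_chart_preimage[OF A c(1) U(1)] c U chart_inv_chart[OF A c] by auto
  from open_contains_cball[THEN iffD1, rule_format, OF this]
  obtain r where r: "r > 0" "cball (snd c p) r \<subseteq> ?S" by blast
  obtain b :: "real^'m \<Rightarrow> real" where b: "smooth_on UNIV b" "\<And>x. 0 \<le> b x" "b (snd c p) > 0"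
    "\<And>x. x \<notin> cball (snd c p) r \<Longrightarrow> b x = 0" using bump_function_exists[OF r(1)] by blast
  let ?K = "chart_inv c ` cball (snd c p) r"
  let ?f = "\<lambda>q. if q \<in> chart_dom c then b (snd c q) else 0"
  have K: "compact ?K"
    by (rule compact_continuous_image[OF continuous_on_subset[OF continuous_on_chart_inv[OF A c(1)]]])
      (use r in auto)
  have z: "?f q = 0" if "q \<notin> ?K" for q
    using that b(4)[of "snd c q"] chart_inv_chart[OF A c(1), of q] by force
  have "smooth_vfun A ?f"
  proof (rule smooth_vfun_extend_by_0_chart[OF A c(1), where V="chart_dom c" and K = ?K])
    show "?K \<subseteq> chart_dom c" using r chart_inv_in[of _ c] by auto
    show "smooth_on {x \<in> chart_img c. chart_inv c x \<in> chart_dom c} (\<lambda>x. ?f (chart_inv c x))"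
      by (rule smooth_on_cong[OF _ smooth_on_subset[OF b(1)]])
        (auto intro!: open_chart_preimage[OF A c(1)] open_chart_dom[OF A c(1)] simp: chart_chart_inv)
  qed (use open_chart_dom[OF A c(1)] compact_imp_closed[OF K] z in auto)
  moreover have "?K \<subseteq> U" using r by auto
  ultimately show ?thesis
    using b c K z by (intro exI[of _ ?f] exI[of _ ?K]) (auto simp: smooth_fun_iff_vfun)
qed

lemma smooth_fun_sum:
  "smooth_atlas A \<Longrightarrow> (\<And>i. i \<in> I \<Longrightarrow> smooth_fun A (f i)) \<Longrightarrow> smooth_fun A (\<lambda>p. \<Sum>i\<in>I. f i p)"
  by (auto simp: smooth_fun_def o_def intro!: smooth_on_sum open_chart_img)

lemma smooth_fun_divide:
  "smooth_atlas A \<Longrightarrow> smooth_fun A f \<Longrightarrow> smooth_fun A g \<Longrightarrow> (\<And>p. g p \<noteq> 0) \<Longrightarrow> smooth_fun A (\<lambda>p. f p / g p)"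
  by (auto simp: smooth_fun_def o_def intro!: smooth_on_divide open_chart_img)

text \<open>The indices are points: each point carries a bump whose support lies in one set of the
  cover, compactness retains finitely many, and dividing by their positive sum normalises them. The
  cover is left general because it will consist of chart domains, of preimages of target charts, and
  of intersections of both kinds.\<close>

lemma subordinate_partition_exists:
  fixes A :: "('a::t2_space, 'm::finite) chart set"
  assumes A: "smooth_atlas A" and cpt: "compact (UNIV :: 'a set)"
    and U: "\<And>U. U \<in> \<U> \<Longrightarrow> open U" "\<Union>\<U> = UNIV"
  shows "\<exists>(I :: 'a set) \<xi>. finite I \<and> (\<forall>i\<in>I. smooth_fun A (\<xi> i) \<and> (\<forall>p. 0 \<le> \<xi> i p) \<and>
      (\<exists>U\<in>\<U>. \<exists>K. compact K \<and> K \<subseteq> U \<and> (\<forall>p. p \<notin> K \<longrightarrow> \<xi> i p = 0))) \<and> (\<forall>p. (\<Sum>i\<in>I. \<xi> i p) = 1)"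
proof -
  have "\<exists>f K. smooth_fun A f \<and> (\<forall>q. 0 \<le> f q) \<and> f p > 0 \<and> compact K \<and> (\<exists>U\<in>\<U>. K \<subseteq> U) \<and> (\<forall>q. q \<notin> K \<longrightarrow> f q = 0)" for p
  proof -
    have "p \<in> \<Union>\<U>" using U(2) by simp
    then obtain V where V: "V \<in> \<U>" "p \<in> V" by (rule UnionE)
    obtain f K where "smooth_fun A f \<and> (\<forall>q. 0 \<le> f q) \<and> f p > 0 \<and> compact K \<and> K \<subseteq> V \<and> (\<forall>q. q \<notin> K \<longrightarrow> f q = 0)"
      using manifold_bump_exists[OF A U(1)[OF V(1)] V(2)] by (elim exE) (rule that)
    then show ?thesis using V(1) by (intro exI[of _ f] exI[of _ K]) auto
  qed
  then have "\<forall>p. \<exists>f K. smooth_fun A f \<and> (\<forall>q. 0 \<le> f q) \<and> f p > 0 \<and> compact K \<and> (\<exists>U\<in>\<U>. K \<subseteq> U) \<and> (\<forall>q. q \<notin> K \<longrightarrow> f q = 0)"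
    by (rule allI)
  from choice[OF this] obtain f where "\<forall>p. \<exists>K. smooth_fun A (f p) \<and> (\<forall>q. 0 \<le> f p q) \<and> f p p > 0 \<and> compact K \<and>
      (\<exists>U\<in>\<U>. K \<subseteq> U) \<and> (\<forall>q. q \<notin> K \<longrightarrow> f p q = 0)" by (elim exE) (rule that)
  from choice[OF this] obtain K where fK: "\<forall>p. smooth_fun A (f p) \<and> (\<forall>q. 0 \<le> f p q) \<and> f p p > 0 \<and> compact (K p) \<and>
      (\<exists>U\<in>\<U>. K p \<subseteq> U) \<and> (\<forall>q. q \<notin> K p \<longrightarrow> f p q = 0)" by (elim exE) (rule that)
  then have f: "\<And>p. smooth_fun A (f p)" "\<And>p q. 0 \<le> f p q" "\<And>p. f p p > 0"
    "\<And>p. compact (K p)" "\<And>p. \<exists>U\<in>\<U>. K p \<subseteq> U" "\<And>p q. q \<notin> K p \<Longrightarrow> f p q = (0::real)"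
    by simp_all
  have cont: "continuous_on UNIV (f p)" for p
    by (rule smooth_vfun_continuous[OF A]) (use f in \<open>simp add: smooth_fun_iff_vfun\<close>)
  have op: "open {q. 0 < f p q}" for p
    using open_Collect_less[OF continuous_on_const cont] by simp
  have "UNIV \<subseteq> (\<Union>p\<in>UNIV. {q. 0 < f p q})" using f(3) by auto
  then obtain I where I: "finite I" "UNIV \<subseteq> (\<Union>p\<in>I. {q. 0 < f p q})"
    by (rule compactE_image[OF cpt op]) (rule that)
  define F where "F q = (\<Sum>p\<in>I. f p q)" for q
  have F: "F q > 0" for q
  proof -
    obtain p where "p \<in> I" "0 < f p q" using I by blast
    then show ?thesis unfolding F_def using I(1) f(2) by (intro sum_pos2[of I p]) auto
  qed
  have sF: "smooth_fun A F" unfolding F_def by (intro smooth_fun_sum A f)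
  show ?thesis
  proof (intro exI conjI ballI allI)
    show "smooth_fun A (\<lambda>p. f i p / F p)" for i
      by (rule smooth_fun_divide[OF A f(1) sF]) (use F in \<open>simp add: less_imp_neq[THEN not_sym]\<close>)
    show "0 \<le> f i p / F p" for i p using f(2)[of i p] F[of p] by simp
    show "\<exists>U\<in>\<U>. \<exists>K. compact K \<and> K \<subseteq> U \<and> (\<forall>p. p \<notin> K \<longrightarrow> f i p / F p = 0)" for i
    proof -
      from f(5)[of i] obtain U where "U \<in> \<U>" "K i \<subseteq> U" by (rule bexE)
      then show ?thesis using f(4)[of i] f(6)[of _ i] by (intro bexI[of _ U] exI[of _ "K i"]) auto
    qed
    show "(\<Sum>i\<in>I. f i p / F p) = 1" for p
      using F[of p] by (simp add: F_def sum_divide_distrib[symmetric])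
  qed (rule I)
qed

text \<open>Guarantees that the choice inside \<open>volume_integral\<close> selects a genuine
  partition.\<close>

lemma partition_of_unity_exists:
  fixes A :: "('a::t2_space, 'm::finite) chart set"
  assumes A: "smooth_atlas A" and cpt: "compact (UNIV :: 'a set)"
  shows "\<exists>F \<rho>. partition_of_unity A F \<rho>"
proof -
  have "\<exists>(I :: 'a set) \<xi>. finite I \<and> (\<forall>i\<in>I. smooth_fun A (\<xi> i) \<and> (\<forall>p. 0 \<le> \<xi> i p) \<and>
      (\<exists>U\<in>chart_dom ` A. \<exists>K. compact K \<and> K \<subseteq> U \<and> (\<forall>p. p \<notin> K \<longrightarrow> \<xi> i p = 0))) \<and> (\<forall>p. (\<Sum>i\<in>I. \<xi> i p) = 1)"
    by (rule subordinate_partition_exists[OF A cpt])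
      (use open_chart_dom[OF A] atlas_cover[OF A] in auto)
  then obtain I :: "'a set" and \<xi> where I0: "finite I" "\<forall>i\<in>I. smooth_fun A (\<xi> i) \<and> (\<forall>p. 0 \<le> \<xi> i p) \<and>
      (\<exists>U\<in>chart_dom ` A. \<exists>K. compact K \<and> K \<subseteq> U \<and> (\<forall>p. p \<notin> K \<longrightarrow> \<xi> i p = 0))" "\<forall>p. (\<Sum>i\<in>I. \<xi> i p) = 1"
    by (elim exE conjE) (rule that)
  have I: "finite I" "\<And>i. i \<in> I \<Longrightarrow> smooth_fun A (\<xi> i)" "\<And>i p. i \<in> I \<Longrightarrow> 0 \<le> \<xi> i p" "\<And>p. (\<Sum>i\<in>I. \<xi> i p) = 1"
    using I0 by simp_all
  have K: "\<forall>i\<in>I. \<exists>c\<in>A. \<exists>K. compact K \<and> K \<subseteq> chart_dom c \<and> (\<forall>p. p \<notin> K \<longrightarrow> \<xi> i p = 0)"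
    using I0(2) by simp
  from bchoice[OF K[unfolded Bex_def]] obtain c where "\<forall>i\<in>I. c i \<in> A \<and> (\<exists>K. compact K \<and> K \<subseteq> chart_dom (c i) \<and> (\<forall>p. p \<notin> K \<longrightarrow> \<xi> i p = 0))"
    by (elim exE) (rule that)
  then have c: "\<And>i. i \<in> I \<Longrightarrow> c i \<in> A" and "\<forall>i\<in>I. \<exists>K. compact K \<and> K \<subseteq> chart_dom (c i) \<and> (\<forall>p. p \<notin> K \<longrightarrow> \<xi> i p = 0)"
    by simp_all
  from bchoice[OF this(2)] obtain K where "\<forall>i\<in>I. compact (K i) \<and> K i \<subseteq> chart_dom (c i) \<and> (\<forall>p. p \<notin> K i \<longrightarrow> \<xi> i p = 0)"
    by (elim exE) (rule that)
  then have K: "\<And>i. i \<in> I \<Longrightarrow> c i \<in> A" "\<And>i. i \<in> I \<Longrightarrow> compact (K i)"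
    "\<And>i. i \<in> I \<Longrightarrow> K i \<subseteq> chart_dom (c i)" "\<And>i p. i \<in> I \<Longrightarrow> p \<notin> K i \<Longrightarrow> \<xi> i p = 0"
    using c by simp_all
  \<comment> \<open>The definition of a partition indexes it by charts, so all functions assigned to
    the same chart are added up.\<close>
  define \<rho> where "\<rho> d p = (\<Sum>i\<in>{i\<in>I. c i = d}. \<xi> i p)" for d p
  have "partition_of_unity A (c ` I) \<rho>"
    unfolding partition_of_unity_def
  proof (intro conjI ballI allI)
    show "smooth_fun A (\<rho> d)" for d unfolding \<rho>_def by (intro smooth_fun_sum A) (use I in auto)
    show "0 \<le> \<rho> d p" for d p unfolding \<rho>_def by (intro sum_nonneg) (use I in auto)
    show "closure {p. \<rho> d p \<noteq> 0} \<subseteq> chart_dom d" if "d \<in> c ` I" for d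
    proof -
      let ?L = "\<Union>i\<in>{i\<in>I. c i = d}. K i"
      have "closed ?L" using I K by (intro closed_UN) (auto intro: compact_imp_closed)
      moreover have "{p. \<rho> d p \<noteq> 0} \<subseteq> ?L"
      proof
        fix p assume "p \<in> {p. \<rho> d p \<noteq> 0}"
        then obtain i where "i \<in> {i\<in>I. c i = d}" "\<xi> i p \<noteq> 0"
          unfolding \<rho>_def using sum.not_neutral_contains_not_neutral by blast
        then show "p \<in> ?L" using K(4)[of i p] by auto
      qed
      ultimately have "closure {p. \<rho> d p \<noteq> 0} \<subseteq> ?L" by (rule closure_minimal[rotated])
      also have "\<dots> \<subseteq> chart_dom d" using K by auto
      finally show ?thesis .
    qed
    show "(\<Sum>d\<in>c ` I. \<rho> d p) = 1" for p
      unfolding \<rho>_def using sum.image_gen[OF I(1), of "\<lambda>i. \<xi> i p" c] I(4) by simp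
  qed (use I K in auto)
  then show ?thesis by blast
qed

section \<open>Fields of bilinear forms\<close>

lemma bilinear_expand:
  fixes f :: "real^'n \<Rightarrow> real^'n \<Rightarrow> real"
  assumes "bilinear f"
  shows "f u v = (\<Sum>i\<in>UNIV. \<Sum>j\<in>UNIV. u$i * v$j * f (axis i 1) (axis j 1))"
proof -
  have l: "linear (\<lambda>u. f u v)" for v
    using assms by (auto simp: bilinear_def)
  have r: "linear (f u)" for u
    using assms by (auto simp: bilinear_def)
  have "f u v = f (\<Sum>i\<in>UNIV. u$i *\<^sub>R axis i 1) (\<Sum>j\<in>UNIV. v$j *\<^sub>R axis j 1)"
    using basis_expansion[of u] basis_expansion[of v] by (simp add: scalar_mult_eq_scaleR)
  also have "\<dots> = (\<Sum>i\<in>UNIV. \<Sum>j\<in>UNIV. u$i * v$j * f (axis i 1) (axis j 1))"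
    by (simp add: linear_sum[OF l] linear_sum[OF r] linear_scale[OF l] linear_scale[OF r]
        sum_distrib_left mult.assoc mult.left_commute) (rule sum.swap)
  finally show ?thesis .
qed

text \<open>A product rule with three factors, since the base point and both arguments move. In the
  standard basis the form is a sum of products of scalar functions; the sums are folded back
  afterwards.\<close>

lemma bilinear_field_has_derivative:
  fixes b :: "real^'n \<Rightarrow> real^'n \<Rightarrow> real^'n \<Rightarrow> real" and F U V :: "'z::real_normed_vector \<Rightarrow> real^'n"
  assumes S: "open S" and bil: "\<And>y. y \<in> S \<Longrightarrow> bilinear (b y)"
    and sm: "\<And>u v. smooth_on S (\<lambda>y. b y u v)"
    and F: "(F has_derivative F') (at z)" "F z \<in> S"
    and U: "(U has_derivative U') (at z)" and V: "(V has_derivative V') (at z)"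
  shows "((\<lambda>z. b (F z) (U z) (V z)) has_derivative
    (\<lambda>w. dd (\<lambda>y. b y (U z) (V z)) (F' w) (F z) + b (F z) (U' w) (V z) + b (F z) (U z) (V' w))) (at z)"
proof -
  define \<beta> where "\<beta> i j y = b y (axis i 1) (axis j 1)" for i j y
  have \<beta>: "(\<beta> i j has_derivative (\<lambda>w. dd (\<beta> i j) w y)) (at y)" if "y \<in> S" for i j y
    unfolding \<beta>_def by (rule smooth_on_has_derivative[OF sm that])
  have e: "b y u v = (\<Sum>i\<in>UNIV. \<Sum>j\<in>UNIV. u$i * v$j * \<beta> i j y)" if "y \<in> S" for y u v
    unfolding \<beta>_def by (rule bilinear_expand[OF bil[OF that]])
  have d: "dd (\<lambda>y. b y u v) w y = (\<Sum>i\<in>UNIV. \<Sum>j\<in>UNIV. u$i * v$j * dd (\<beta> i j) w y)" if y: "y \<in> S" for y u v w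
  proof -
    have "((\<lambda>y. \<Sum>i\<in>UNIV. \<Sum>j\<in>UNIV. u$i * v$j * \<beta> i j y) has_derivative
        (\<lambda>w. \<Sum>i\<in>UNIV. \<Sum>j\<in>UNIV. u$i * v$j * dd (\<beta> i j) w y)) (at y)"
      by (intro has_derivative_sum has_derivative_mult_right \<beta> y)
    then have "((\<lambda>y. b y u v) has_derivative (\<lambda>w. \<Sum>i\<in>UNIV. \<Sum>j\<in>UNIV. u$i * v$j * dd (\<beta> i j) w y)) (at y)"
      by (rule has_derivative_transform_within_open[OF _ S y]) (simp add: e)
    then show ?thesis by (rule dd_eqI)
  qed
  have \<beta>F: "((\<lambda>z. \<beta> i j (F z)) has_derivative (\<lambda>w. dd (\<beta> i j) (F' w) (F z))) (at z)" for i j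
    using diff_chain_at[OF F(1) \<beta>[OF F(2)]] by (simp add: o_def)
  have n: "((\<lambda>z. U z $ i) has_derivative (\<lambda>w. U' w $ i)) (at z)" "((\<lambda>z. V z $ i) has_derivative (\<lambda>w. V' w $ i)) (at z)" for i
    using U V by (auto intro: bounded_linear.has_derivative[OF bounded_linear_vec_nth])
  have "((\<lambda>z. \<Sum>i\<in>UNIV. \<Sum>j\<in>UNIV. U z $ i * V z $ j * \<beta> i j (F z)) has_derivative
      (\<lambda>w. \<Sum>i\<in>UNIV. \<Sum>j\<in>UNIV. (U z $ i * V z $ j * dd (\<beta> i j) (F' w) (F z)
         + (U z $ i * V' w $ j + U' w $ i * V z $ j) * \<beta> i j (F z)))) (at z)"
    by (intro has_derivative_sum has_derivative_mult n \<beta>F)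
  also have "(\<lambda>w. \<Sum>i\<in>UNIV. \<Sum>j\<in>UNIV. (U z $ i * V z $ j * dd (\<beta> i j) (F' w) (F z)
         + (U z $ i * V' w $ j + U' w $ i * V z $ j) * \<beta> i j (F z)))
     = (\<lambda>w. dd (\<lambda>y. b y (U z) (V z)) (F' w) (F z) + b (F z) (U' w) (V z) + b (F z) (U z) (V' w))"
    unfolding e[OF F(2)] d[OF F(2)] sum.distrib[symmetric] by (simp add: algebra_simps)
  finally have *: "((\<lambda>z. \<Sum>i\<in>UNIV. \<Sum>j\<in>UNIV. U z $ i * V z $ j * \<beta> i j (F z)) has_derivative
     (\<lambda>w. dd (\<lambda>y. b y (U z) (V z)) (F' w) (F z) + b (F z) (U' w) (V z) + b (F z) (U z) (V' w))) (at z)" .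
  have "isCont F z" by (rule has_derivative_continuous[OF F(1)])
  then have "\<forall>\<^sub>F z in at z. F z \<in> S"
    using S F(2) by (simp add: isCont_def topological_tendstoD)
  then have ev: "\<forall>\<^sub>F z in at z. (\<Sum>i\<in>UNIV. \<Sum>j\<in>UNIV. U z $ i * V z $ j * \<beta> i j (F z)) = b (F z) (U z) (V z)"
    by (rule eventually_mono) (simp add: e)
  show ?thesis
    by (rule has_derivative_transform_eventually[OF * ev]) (simp_all add: e[OF F(2)])
qed

lemma smooth_on_bilinear_field:
  fixes b :: "real^'n \<Rightarrow> real^'n \<Rightarrow> real^'n \<Rightarrow> real" and F U V :: "'z::euclidean_space \<Rightarrow> real^'n"
  assumes S: "open S" and bil: "\<And>y. y \<in> S \<Longrightarrow> bilinear (b y)"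
    and sm: "\<And>u v. smooth_on S (\<lambda>y. b y u v)"
    and T: "open T" "\<And>z. z \<in> T \<Longrightarrow> F z \<in> S" and F: "smooth_on T F" and U: "smooth_on T U" and V: "smooth_on T V"
  shows "smooth_on T (\<lambda>z. b (F z) (U z) (V z))"
proof -
  have "smooth_on T (\<lambda>z. \<Sum>i\<in>UNIV. \<Sum>j\<in>UNIV. U z $ i * V z $ j * b (F z) (axis i 1) (axis j 1))"
    by (intro smooth_on_sum smooth_on_mult smooth_on_nth T(1) U V smooth_on_compose[OF T(1) S F sm T(2)])
  then show ?thesis
    by (rule smooth_on_cong[OF T(1)]) (simp add: bilinear_expand[OF bil[OF T(2)], symmetric])
qed


section \<open>Pull-back of a closed 2-form along a family of maps\<close>

definition loc :: "('a, 'm::finite) chart \<Rightarrow> ('b, 'n::finite) chart \<Rightarrow> ('t \<Rightarrow> 'a \<Rightarrow> 'b) \<Rightarrow> 't \<times> (real^'m) \<Rightarrow> real^'n" where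
  "loc c d \<Phi> = (\<lambda>(t, x). snd d (\<Phi> t (chart_inv c x)))"

definition loc_dom :: "('a, 'm::finite) chart \<Rightarrow> ('b, 'n::finite) chart \<Rightarrow> 't set \<Rightarrow> ('t \<Rightarrow> 'a \<Rightarrow> 'b) \<Rightarrow> ('t \<times> (real^'m)) set" where
  "loc_dom c d T \<Phi> = {(t, x). t \<in> T \<and> x \<in> chart_img c \<and> \<Phi> t (chart_inv c x) \<in> chart_dom d}"

text \<open>The local coefficients of the pull-back of \<open>\<omega>\<close> to the product of the parameter space and
  the source manifold.\<close>
definition pb :: "('b, 'n::finite) chart set \<Rightarrow> ('b, 'n) two_tensor \<Rightarrow> ('a, 'm::finite) chart \<Rightarrow>
    ('t::real_normed_vector \<Rightarrow> 'a \<Rightarrow> 'b) \<Rightarrow> 't \<times> (real^'m) \<Rightarrow> 't \<times> (real^'m) \<Rightarrow> 't \<times> (real^'m) \<Rightarrow> real" where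
  "pb B \<omega> c \<Phi> u v z =
    (let d = (SOME d. d \<in> B \<and> \<Phi> (fst z) (chart_inv c (snd z)) \<in> chart_dom d)
     in local_rep B \<omega> d (loc c d \<Phi> z) (dd (loc c d \<Phi>) u z) (dd (loc c d \<Phi>) v z))"

lemma local_rep_change:
  assumes "smooth_atlas A" "c \<in> A" "c' \<in> A" "p \<in> chart_dom c" "p \<in> chart_dom c'"
  shows "local_rep A \<alpha> c (snd c p) u v
    = local_rep A \<alpha> c' (snd c' p) (transition_deriv c c' p u) (transition_deriv c c' p v)"
  unfolding local_rep_def Let_def chart_inv_chart[OF assms(1,2,4)] chart_inv_chart[OF assms(1,3,5)]
    coord_vec_change[OF assms] ..

text \<open>Collects what the variation formulas need from the Kaehler form. Nondegeneracy is kept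
  apart, as the hypothesis \<open>nd\<close> of the lemmas about critical immersions.\<close>

locale closed_form =
  fixes B :: "('b::t2_space, 'n::finite) chart set" and \<omega> :: "('b, 'n) two_tensor"
  assumes atlas: "smooth_atlas B"
    and bilinear: "\<And>d y. d \<in> B \<Longrightarrow> y \<in> chart_img d \<Longrightarrow> bilinear (local_rep B \<omega> d y)"
    and smooth: "\<And>d u v. d \<in> B \<Longrightarrow> smooth_on (chart_img d) (\<lambda>y. local_rep B \<omega> d y u v)"
    and antisym: "\<And>d y u v. d \<in> B \<Longrightarrow> y \<in> chart_img d \<Longrightarrow> local_rep B \<omega> d y u v = - local_rep B \<omega> d y v u"
    and closed: "closed_two_form B \<omega>"

text \<open>The parameter space is any Euclidean space, so that ordinary variations, two-parameter
  variations and constant families share one set of lemmas.\<close>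

locale form_family = closed_form B \<omega>
  for B :: "('b::t2_space, 'n::finite) chart set" and \<omega> :: "('b, 'n) two_tensor" +
  fixes A :: "('a::t2_space, 'm::finite) chart set"
    and T :: "'t::euclidean_space set" and \<Phi> :: "'t \<Rightarrow> 'a \<Rightarrow> 'b"
  assumes atlasA: "smooth_atlas A" and open_T: "open T" and family: "smooth_family A B T \<Phi>"
begin

abbreviation "pt c z \<equiv> \<Phi> (fst z) (chart_inv c (snd z))"

lemma loc_domI: "z \<in> T \<times> chart_img c \<Longrightarrow> pt c z \<in> chart_dom d \<Longrightarrow> z \<in> loc_dom c d T \<Phi>"
  by (auto simp: loc_dom_def)

lemma loc_domD:
  assumes "z \<in> loc_dom c d T \<Phi>"
  shows "z \<in> T \<times> chart_img c" "pt c z \<in> chart_dom d" "loc c d \<Phi> z = snd d (pt c z)"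
  using assms by (auto simp: loc_dom_def loc_def)

lemma loc_dom_chart:
  assumes "c \<in> A" "p \<in> chart_dom c" "t \<in> T" "\<Phi> t p \<in> chart_dom d"
  shows "(t, snd c p) \<in> loc_dom c d T \<Phi>"
  unfolding loc_dom_def using assms chart_inv_chart[OF atlasA assms(1,2)] by simp

lemma loc_smooth: "c \<in> A \<Longrightarrow> d \<in> B \<Longrightarrow> smooth_on (loc_dom c d T \<Phi>) (loc c d \<Phi>)"
  using family by (simp add: smooth_family_def loc_def loc_dom_def)

lemma open_img: "c \<in> A \<Longrightarrow> open (T \<times> chart_img c)"
  by (intro open_Times open_T open_chart_img[OF atlasA])

lemma open_loc_dom:
  assumes c: "c \<in> A" and d: "d \<in> B"
  shows "open (loc_dom c d T \<Phi>)"
proof -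
  have "continuous_on (T \<times> UNIV) (\<lambda>(t, p). \<Phi> t p)" using family by (simp add: smooth_family_def)
  moreover have "continuous_on (T \<times> chart_img c) (\<lambda>z. (fst z, chart_inv c (snd z)))"
    by (intro continuous_on_Pair continuous_on_fst continuous_on_id
        continuous_on_compose2[OF continuous_on_chart_inv[OF atlasA c]] continuous_on_snd) auto
  ultimately have "continuous_on (T \<times> chart_img c) (\<lambda>z. (\<lambda>(t, p). \<Phi> t p) (fst z, chart_inv c (snd z)))"
    by (rule continuous_on_compose2) auto
  then have "continuous_on (T \<times> chart_img c) (pt c)" by simp
  from continuous_open_preimage[OF this open_img[OF c] open_chart_dom[OF atlas d]]
  show ?thesis unfolding loc_dom_def by (rule back_subst[where P="open"]) auto
qed

lemma loc_differentiable: "c \<in> A \<Longrightarrow> d \<in> B \<Longrightarrow> z \<in> loc_dom c d T \<Phi> \<Longrightarrow> loc c d \<Phi> differentiable (at z)"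
  by (rule smooth_on_differentiable[OF loc_smooth])

lemma target_chart_exists:
  assumes "c \<in> A" "z \<in> T \<times> chart_img c"
  obtains d where "d \<in> B" "z \<in> loc_dom c d T \<Phi>"
  using atlas_cover[OF atlas, of "pt c z"] loc_domI[OF assms(2)] by auto

lemma dd_loc_change:
  assumes c: "c \<in> A" and d: "d \<in> B" "d' \<in> B" and z: "z \<in> loc_dom c d T \<Phi>" "z \<in> loc_dom c d' T \<Phi>"
  shows "dd (loc c d' \<Phi>) u z = transition_deriv d d' (pt c z) (dd (loc c d \<Phi>) u z)"
proof -
  have p: "pt c z \<in> chart_dom d" "pt c z \<in> chart_dom d'" using loc_domD[OF z(1)] loc_domD[OF z(2)] by auto
  have lz: "loc c d \<Phi> z = snd d (pt c z)" using loc_domD[OF z(1)] by auto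
  have g: "(snd d' \<circ> chart_inv d) differentiable (at (loc c d \<Phi> z))"
    unfolding lz by (rule transition_differentiable[OF atlas d p])
  have l: "loc c d \<Phi> differentiable (at z)" by (rule loc_differentiable[OF c d(1) z(1)])
  have "dd (loc c d' \<Phi>) u z = dd (\<lambda>z. (snd d' \<circ> chart_inv d) (loc c d \<Phi> z)) u z"
  proof (rule dd_cong_open[OF open_Int[OF open_loc_dom[OF c d(1)] open_loc_dom[OF c d(2)]]])
    show "z \<in> loc_dom c d T \<Phi> \<inter> loc_dom c d' T \<Phi>" using z by simp
    show "loc c d' \<Phi> y = (snd d' \<circ> chart_inv d) (loc c d \<Phi> y)" if "y \<in> loc_dom c d T \<Phi> \<inter> loc_dom c d' T \<Phi>" for y
      using loc_domD[of y c d] loc_domD[of y c d'] that by (simp add: chart_inv_chart[OF atlas d(1)])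
  qed (rule loc_differentiable[OF c d(2) z(2)])
  also have "\<dots> = transition_deriv d d' (pt c z) (dd (loc c d \<Phi>) u z)"
    unfolding dd_chain[OF l g] transition_deriv_def lz ..
  finally show ?thesis .
qed

text \<open>Removes the choice in \<open>pb\<close>: derivatives of the family transform by the
  Jacobian between target charts (\<open>dd_loc_change\<close>), and \<open>local_rep\<close>
  absorbs the same Jacobian.\<close>

lemma pb_eq:
  assumes c: "c \<in> A" and d: "d \<in> B" and z: "z \<in> loc_dom c d T \<Phi>"
  shows "pb B \<omega> c \<Phi> u v z = local_rep B \<omega> d (loc c d \<Phi> z) (dd (loc c d \<Phi>) u z) (dd (loc c d \<Phi>) v z)"
proof -
  let ?P = "\<lambda>d. d \<in> B \<and> pt c z \<in> chart_dom d"
  define d' where "d' = (SOME d. ?P d)"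
  have "?P d" using d loc_domD[OF z] by auto
  then have "?P d'" unfolding d'_def by (rule someI)
  then have d': "d' \<in> B" "z \<in> loc_dom c d' T \<Phi>" using loc_domI[OF loc_domD(1)[OF z], of d'] by simp_all
  have "pb B \<omega> c \<Phi> u v z = local_rep B \<omega> d' (loc c d' \<Phi> z) (dd (loc c d' \<Phi>) u z) (dd (loc c d' \<Phi>) v z)"
    unfolding pb_def Let_def d'_def ..
  also have "\<dots> = local_rep B \<omega> d (loc c d \<Phi> z) (dd (loc c d \<Phi>) u z) (dd (loc c d \<Phi>) v z)"
    unfolding dd_loc_change[OF c d d'(1) z d'(2)] loc_domD(3)[OF z] loc_domD(3)[OF d'(2)]
    by (rule local_rep_change[OF atlas d d'(1) loc_domD(2)[OF z] loc_domD(2)[OF d'(2)], symmetric])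
  finally show ?thesis .
qed

lemma loc_in_img: "z \<in> loc_dom c d T \<Phi> \<Longrightarrow> loc c d \<Phi> z \<in> chart_img d"
  using loc_domD(2,3)[of z c d] by simp

lemma pb_smooth:
  assumes c: "c \<in> A"
  shows "smooth_on (T \<times> chart_img c) (pb B \<omega> c \<Phi> u v)"
proof (rule smooth_on_local)
  fix z assume "z \<in> T \<times> chart_img c"
  then obtain d where d: "d \<in> B" "z \<in> loc_dom c d T \<Phi>" by (rule target_chart_exists[OF c])
  have "smooth_on (loc_dom c d T \<Phi>) (\<lambda>z. local_rep B \<omega> d (loc c d \<Phi> z) (dd (loc c d \<Phi>) u z) (dd (loc c d \<Phi>) v z))"
    by (rule smooth_on_bilinear_field[OF open_chart_img[OF atlas d(1)] bilinear[OF d(1)] smooth[OF d(1)]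
          open_loc_dom[OF c d(1)] loc_in_img loc_smooth[OF c d(1)]
          smooth_on_dd[OF loc_smooth[OF c d(1)]] smooth_on_dd[OF loc_smooth[OF c d(1)]]])
  then have "smooth_on (loc_dom c d T \<Phi>) (pb B \<omega> c \<Phi> u v)"
    by (rule smooth_on_cong[OF open_loc_dom[OF c d(1)]]) (simp add: pb_eq[OF c d(1)])
  then show "\<exists>S. open S \<and> z \<in> S \<and> smooth_on S (pb B \<omega> c \<Phi> u v)"
    using open_loc_dom[OF c d(1)] d(2) by blast
qed

lemma pb_antisym:
  assumes c: "c \<in> A" and z: "z \<in> T \<times> chart_img c"
  shows "pb B \<omega> c \<Phi> u v z = - pb B \<omega> c \<Phi> v u z"
proof -
  obtain d where d: "d \<in> B" "z \<in> loc_dom c d T \<Phi>" by (rule target_chart_exists[OF c z])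
  show ?thesis unfolding pb_eq[OF c d] by (rule antisym[OF d(1) loc_in_img[OF d(2)]])
qed

lemma linear_pb:
  assumes c: "c \<in> A" and z: "z \<in> T \<times> chart_img c"
  shows "linear (\<lambda>u. pb B \<omega> c \<Phi> u v z)"
proof -
  obtain d where d: "d \<in> B" "z \<in> loc_dom c d T \<Phi>" by (rule target_chart_exists[OF c z])
  have "linear (\<lambda>u. local_rep B \<omega> d (loc c d \<Phi> z) u w)" for w
    using bilinear[OF d(1) loc_in_img[OF d(2)]] by (simp add: bilinear_def)
  from linear_compose[OF linear_dd[OF loc_differentiable[OF c d]] this]
  show ?thesis unfolding pb_eq[OF c d] by (simp add: o_def)
qed

text \<open>Pull-back commutes with \<open>d\<close>. By the product rule each summand splits into a
  derivative of the coefficients of \<open>\<omega>\<close>, and these add up to zero by closedness,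
  and two terms with second derivatives of the family, which cancel in pairs by
  \<open>dd_commute\<close> and antisymmetry.\<close>

lemma pb_closed:
  assumes c: "c \<in> A" and z: "z \<in> T \<times> chart_img c"
  shows "dd (pb B \<omega> c \<Phi> v w) u z + dd (pb B \<omega> c \<Phi> w u) v z + dd (pb B \<omega> c \<Phi> u v) w z = 0"
proof -
  obtain d where d: "d \<in> B" "z \<in> loc_dom c d T \<Phi>" by (rule target_chart_exists[OF c z])
  let ?F = "loc c d \<Phi>" and ?\<Omega> = "local_rep B \<omega> d"
  note op = open_loc_dom[OF c d(1)]
  note sF = loc_smooth[OF c d(1)]
  have *: "dd (pb B \<omega> c \<Phi> v w) u z = dd (\<lambda>y. ?\<Omega> y (dd ?F v z) (dd ?F w z)) (dd ?F u z) (?F z)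
      + ?\<Omega> (?F z) (dd (dd ?F v) u z) (dd ?F w z) + ?\<Omega> (?F z) (dd ?F v z) (dd (dd ?F w) u z)" for u v w
  proof -
    have "((\<lambda>z. ?\<Omega> (?F z) (dd ?F v z) (dd ?F w z)) has_derivative
       (\<lambda>u. dd (\<lambda>y. ?\<Omega> y (dd ?F v z) (dd ?F w z)) (dd ?F u z) (?F z)
      + ?\<Omega> (?F z) (dd (dd ?F v) u z) (dd ?F w z) + ?\<Omega> (?F z) (dd ?F v z) (dd (dd ?F w) u z))) (at z)"
      by (rule bilinear_field_has_derivative[OF open_chart_img[OF atlas d(1)] bilinear[OF d(1)] smooth[OF d(1)]
          smooth_on_has_derivative[OF sF d(2)] loc_in_img[OF d(2)]
          smooth_on_has_derivative[OF smooth_on_dd[OF sF] d(2)] smooth_on_has_derivative[OF smooth_on_dd[OF sF] d(2)]])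
    then have "(pb B \<omega> c \<Phi> v w has_derivative
       (\<lambda>u. dd (\<lambda>y. ?\<Omega> y (dd ?F v z) (dd ?F w z)) (dd ?F u z) (?F z)
      + ?\<Omega> (?F z) (dd (dd ?F v) u z) (dd ?F w z) + ?\<Omega> (?F z) (dd ?F v z) (dd (dd ?F w) u z))) (at z)"
      by (rule has_derivative_transform_within_open[OF _ op d(2)]) (simp add: pb_eq[OF c d(1)])
    then show ?thesis by (rule dd_eqI)
  qed
  have sy: "dd (dd ?F u) v z = dd (dd ?F v) u z" for u v by (rule dd_commute[OF op d(2) sF])
  have an: "?\<Omega> (?F z) u v = - ?\<Omega> (?F z) v u" for u v by (rule antisym[OF d(1) loc_in_img[OF d(2)]])
  have cl: "dd (\<lambda>y. ?\<Omega> y v w) u (?F z) + dd (\<lambda>y. ?\<Omega> y w u) v (?F z) + dd (\<lambda>y. ?\<Omega> y u v) w (?F z) = 0" for u v w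
    using closed d(1) loc_in_img[OF d(2)] unfolding closed_two_form_def by (elim ballE allE) auto
  show ?thesis
    unfolding * using cl[of "dd ?F v z" "dd ?F w z" "dd ?F u z"]
      an[of "dd (dd ?F u) v z" "dd ?F w z"] an[of "dd (dd ?F v) w z" "dd ?F u z"] an[of "dd (dd ?F w) u z" "dd ?F v z"]
    unfolding sy[of v u] sy[of w v] sy[of u w] by linarith
qed

text \<open>Source charts do not depend on the parameter, so the induced change of coordinates on
  the product fixes the parameter component \<open>a\<close> and transforms only
  \<open>u\<close>.\<close>

lemma dd_loc_chart_change:
  assumes c: "c \<in> A" "c' \<in> A" and d: "d \<in> B" and p: "p \<in> chart_dom c" "p \<in> chart_dom c'"
    and t: "t \<in> T" "\<Phi> t p \<in> chart_dom d"
  shows "dd (loc c d \<Phi>) (a, u) (t, snd c p) = dd (loc c' d \<Phi>) (a, transition_deriv c c' p u) (t, snd c' p)"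
proof -
  let ?\<tau> = "snd c' \<circ> chart_inv c"
  let ?g = "\<lambda>z. (fst z, ?\<tau> (snd z))"
  have z: "(t, snd c p) \<in> loc_dom c d T \<Phi>" "(t, snd c' p) \<in> loc_dom c' d T \<Phi>"
    using t by (auto intro: loc_dom_chart c p)
  have gz: "?g (t, snd c p) = (t, snd c' p)" by (simp add: chart_inv_chart[OF atlasA c(1) p(1)])
  have \<tau>: "(?\<tau> has_derivative transition_deriv c c' p) (at (snd c p))"
    unfolding transition_deriv_def by (rule has_derivative_dd[OF transition_differentiable[OF atlasA c p]])
  have "((\<lambda>z. ?\<tau> (snd z)) has_derivative (\<lambda>w. transition_deriv c c' p (snd w))) (at (t, snd c p))"
    using diff_chain_at[OF has_derivative_snd[OF has_derivative_ident], of ?\<tau> _ "(t, snd c p)"] \<tau>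
    by (simp add: o_def)
  then have g: "(?g has_derivative (\<lambda>w. (fst w, transition_deriv c c' p (snd w)))) (at (t, snd c p))"
    by (intro has_derivative_Pair has_derivative_fst has_derivative_ident)
  have l: "loc c' d \<Phi> differentiable (at (?g (t, snd c p)))"
    unfolding gz by (rule loc_differentiable[OF c(2) d z(2)])
  define W where "W = loc_dom c d T \<Phi> \<inter> (UNIV \<times> {x \<in> chart_img c. chart_inv c x \<in> chart_dom c'})"
  have "dd (loc c d \<Phi>) (a, u) (t, snd c p) = dd (\<lambda>z. loc c' d \<Phi> (?g z)) (a, u) (t, snd c p)"
  proof (rule dd_cong_open)
    show "open W" unfolding W_def
      by (intro open_Int open_Times open_UNIV open_loc_dom[OF c(1) d] open_chart_preimage[OF atlasA c(1)]
          open_chart_dom[OF atlasA c(2)])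
    show "(t, snd c p) \<in> W" unfolding W_def using z(1) p chart_inv_chart[OF atlasA c(1) p(1)] by auto
    show "loc c d \<Phi> y = loc c' d \<Phi> (?g y)" if "y \<in> W" for y
      using that unfolding W_def loc_def by (auto simp: chart_inv_chart[OF atlasA c(2)] split_def)
  qed (rule loc_differentiable[OF c(1) d z(1)])
  also have "\<dots> = dd (loc c' d \<Phi>) (dd ?g (a, u) (t, snd c p)) (?g (t, snd c p))"
    by (rule dd_chain[where f = ?g and g = "loc c' d \<Phi>", OF differentiableI[OF g] l])
  also have "dd ?g (a, u) (t, snd c p) = (a, transition_deriv c c' p u)"
    using dd_eqI[OF g, of "(a, u)"] by simp
  finally show ?thesis unfolding gz .
qed

lemma pb_chart_change:
  assumes c: "c \<in> A" "c' \<in> A" and p: "p \<in> chart_dom c" "p \<in> chart_dom c'" and t: "t \<in> T"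
  shows "pb B \<omega> c \<Phi> (a, u) (b, v) (t, snd c p)
    = pb B \<omega> c' \<Phi> (a, transition_deriv c c' p u) (b, transition_deriv c c' p v) (t, snd c' p)"
proof -
  obtain d where d: "d \<in> B" "\<Phi> t p \<in> chart_dom d" using atlas_cover[OF atlas] by blast
  have z: "(t, snd c p) \<in> loc_dom c d T \<Phi>" "(t, snd c' p) \<in> loc_dom c' d T \<Phi>"
    using t d(2) by (auto intro: loc_dom_chart c p)
  have l: "loc c d \<Phi> (t, snd c p) = loc c' d \<Phi> (t, snd c' p)"
    by (simp add: loc_def chart_inv_chart[OF atlasA c(1) p(1)] chart_inv_chart[OF atlasA c(2) p(2)])
  show ?thesis
    unfolding pb_eq[OF c(1) d(1) z(1)] pb_eq[OF c(2) d(1) z(2)] l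
      dd_loc_chart_change[OF c d(1) p t d(2)] ..
qed

lemma dd_loc_space:
  assumes c: "c \<in> A" and d: "d \<in> B" and z: "(t, x) \<in> loc_dom c d T \<Phi>"
  shows "((\<lambda>x. snd d (\<Phi> t (chart_inv c x))) has_derivative (\<lambda>u. dd (loc c d \<Phi>) (0, u) (t, x))) (at x)"
proof -
  have "((\<lambda>x. (t, x)) has_derivative (\<lambda>u. (0, u))) (at x)"
    by (intro has_derivative_Pair has_derivative_const has_derivative_ident)
  from diff_chain_at[OF this has_derivative_dd[OF loc_differentiable[OF c d z]]]
  show ?thesis by (simp add: o_def loc_def)
qed

text \<open>Shows that the chart chosen inside \<open>differential\<close> does not matter, and
  identifies the differential with the spatial part of the derivative of the family.\<close>

lemma differential_coord_vec:
  assumes c: "c \<in> A" and d: "d \<in> B" and p: "p \<in> chart_dom c" and t: "t \<in> T" "\<Phi> t p \<in> chart_dom d"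
  shows "differential A B (\<Phi> t) p (coord_vec A c p u) = coord_vec B d (\<Phi> t p) (dd (loc c d \<Phi>) (0, u) (t, snd c p))"
proof
  fix d'
  let ?c = "SOME c. c \<in> A \<and> p \<in> chart_dom c"
  have c': "?c \<in> A \<and> p \<in> chart_dom ?c" by (rule someI[of _ c]) (use c p in simp)
  define c' where "c' = ?c"
  have c': "c' \<in> A" "p \<in> chart_dom c'" using c' by (simp_all add: c'_def)
  have z: "(t, snd c'' p) \<in> loc_dom c'' d T \<Phi>" if "c'' \<in> A" "p \<in> chart_dom c''" "\<Phi> t p \<in> chart_dom d" for c'' d
    by (rule loc_dom_chart[OF that(1,2) t(1) that(3)])
  show "differential A B (\<Phi> t) p (coord_vec A c p u) d' = coord_vec B d (\<Phi> t p) (dd (loc c d \<Phi>) (0, u) (t, snd c p)) d'"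
  proof (cases "d' \<in> B \<and> \<Phi> t p \<in> chart_dom d'")
    case True
    have "differential A B (\<Phi> t) p (coord_vec A c p u) d'
      = dd (snd d' \<circ> \<Phi> t \<circ> chart_inv c') (coord_vec A c p u c') (snd c' p)"
      unfolding differential_def Let_def c'_def[symmetric] using True by simp
    also have "coord_vec A c p u c' = transition_deriv c c' p u"
      by (rule coord_vec_apply[OF c'])
    also have "dd (snd d' \<circ> \<Phi> t \<circ> chart_inv c') (transition_deriv c c' p u) (snd c' p)
       = dd (loc c' d' \<Phi>) (0, transition_deriv c c' p u) (t, snd c' p)"
      by (rule dd_eqI) (use dd_loc_space[OF c'(1) _ z[OF c'], of d'] True in \<open>simp add: o_def\<close>)
    also have "\<dots> = dd (loc c d' \<Phi>) (0, u) (t, snd c p)"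
      by (rule dd_loc_chart_change[symmetric]) (use c c' p t True in auto)
    also have "\<dots> = transition_deriv d d' (\<Phi> t p) (dd (loc c d \<Phi>) (0, u) (t, snd c p))"
      using dd_loc_change[OF c d _ z[OF c p t(2)] z[OF c p], of d' "(0, u)"] True
      by (simp add: chart_inv_chart[OF atlasA c p])
    also have "\<dots> = coord_vec B d (\<Phi> t p) (dd (loc c d \<Phi>) (0, u) (t, snd c p)) d'"
      using True by (simp add: coord_vec_def)
    finally show ?thesis .
  next
    case False
    then show ?thesis by (auto simp: differential_def coord_vec_def Let_def)
  qed
qed

text \<open>Justifies working on the product: its purely spatial components are what the energy of
  the map at parameter \<open>t\<close> sees.\<close>

lemma pullback_local_rep:
  assumes c: "c \<in> A" and t: "t \<in> T" and x: "x \<in> chart_img c"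
  shows "local_rep A (pullback_form A B (\<Phi> t) \<omega>) c x u v = pb B \<omega> c \<Phi> (0, u) (0, v) (t, x)"
proof -
  define p where "p = chart_inv c x"
  have p: "p \<in> chart_dom c" "snd c p = x" unfolding p_def using chart_inv_in[OF x] chart_chart_inv[OF x] by auto
  obtain d where d: "d \<in> B" "\<Phi> t p \<in> chart_dom d" using atlas_cover[OF atlas] by blast
  have z: "(t, x) \<in> loc_dom c d T \<Phi>" using t x d(2) unfolding p_def loc_dom_def by simp
  have l: "loc c d \<Phi> (t, x) = snd d (\<Phi> t p)" by (simp add: loc_def p_def)
  show ?thesis
    unfolding pb_eq[OF c d(1) z] l unfolding local_rep_def Let_def pullback_form_def p_def[symmetric]
      chart_inv_chart[OF atlas d] differential_coord_vec[OF c d(1) p(1) t d(2)] p(2) ..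
qed

end

section \<open>The induced inner product on 2-forms\<close>

definition tmat :: "('a, 'm::finite) chart set \<Rightarrow> ('a, 'm) two_tensor \<Rightarrow> ('a, 'm) chart \<Rightarrow> real^'m \<Rightarrow> real^'m^'m" where
  "tmat A \<alpha> c x = (\<chi> i j. local_rep A \<alpha> c x (axis i 1) (axis j 1))"

text \<open>With \<open>H\<close> the inverse of the metric matrix this is half the full contraction
  of \<open>a\<close> with \<open>b\<close>, first indices with first and second with second: the
  coordinate form of the inner product of 2-forms.\<close>

definition form_inner :: "real^'m^'m \<Rightarrow> real^'m^'m \<Rightarrow> real^'m^'m \<Rightarrow> real" where
  "form_inner H a b = 1 / 2 * trace (a ** H ** transpose b ** H)"

lemma matrix_inv_works:
  fixes M :: "real^'m^'m"
  assumes "invertible M"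
  shows "M ** matrix_inv M = mat 1" "matrix_inv M ** M = mat 1"
proof -
  have "\<exists>M'. M ** M' = mat 1 \<and> M' ** M = mat 1" using assms by (simp add: invertible_def)
  then have "M ** matrix_inv M = mat 1 \<and> matrix_inv M ** M = mat 1"
    unfolding matrix_inv_def by (rule someI_ex)
  then show "M ** matrix_inv M = mat 1" "matrix_inv M ** M = mat 1" by simp_all
qed

lemma matrix_inv_eqI:
  fixes M :: "real^'m^'m"
  assumes "N ** M = mat 1"
  shows "invertible M" "matrix_inv M = N"
proof -
  have MN: "M ** N = mat 1" using assms matrix_left_right_inverse by blast
  show inv: "invertible M" unfolding invertible_def using assms MN by blast
  have "matrix_inv M = (N ** M) ** matrix_inv M" by (simp add: assms)
  also have "\<dots> = N" unfolding matrix_mul_assoc[symmetric] matrix_inv_works(1)[OF inv] by simp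
  finally show "matrix_inv M = N" .
qed

lemma bilinear_matrix:
  fixes f :: "real^'n \<Rightarrow> real^'n \<Rightarrow> real"
  assumes "bilinear f"
  shows "f u v = u \<bullet> ((\<chi> i j. f (axis i 1) (axis j 1)) *v v)"
  unfolding bilinear_expand[OF assms, of u v]
  by (simp add: inner_vec_def matrix_vector_mult_def sum_distrib_left mult_ac)

lemma congruent_matrix_entry:
  fixes M P :: "real^'m^'m"
  shows "(transpose P ** M ** P) $ i $ j = column i P \<bullet> (M *v column j P)"
proof -
  have "(transpose P ** M ** P) $ i $ j = (\<Sum>l\<in>UNIV. \<Sum>k\<in>UNIV. P$k$i * (M$k$l * P$l$j))"
    by (simp add: matrix_matrix_mult_def transpose_def sum_distrib_right mult.assoc)
  also have "\<dots> = (\<Sum>k\<in>UNIV. \<Sum>l\<in>UNIV. P$k$i * (M$k$l * P$l$j))" by (rule sum.swap)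
  finally show ?thesis
    by (simp add: inner_vec_def matrix_vector_mult_def column_def sum_distrib_left)
qed

lemma trace_mult_transpose: "trace (M ** transpose N) = (\<Sum>i\<in>UNIV. \<Sum>j\<in>UNIV. M$i$j * N$i$j)"
  by (simp add: trace_def matrix_matrix_mult_def transpose_def)

text \<open>If the columns of \<open>P\<close> form an orthonormal frame, then
  \<open>P ** transpose P\<close> is the inverse metric and the right-hand side is the frame formula
  of \<open>two_form_inner\<close>. Symmetry and nonnegativity are read off from it.\<close>

lemma form_inner_factor:
  "form_inner (P ** transpose P) a b
    = 1 / 2 * (\<Sum>i\<in>UNIV. \<Sum>j\<in>UNIV. (transpose P ** a ** P) $ i $ j * (transpose P ** b ** P) $ i $ j)"
proof -
  have "trace (a ** (P ** transpose P) ** transpose b ** (P ** transpose P))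
      = trace ((a ** P ** transpose P ** transpose b ** P) ** transpose P)"
    by (simp add: matrix_mul_assoc)
  also have "\<dots> = trace (transpose P ** (a ** P ** transpose P ** transpose b ** P))"
    by (rule trace_mul_sym)
  also have "\<dots> = trace ((transpose P ** a ** P) ** transpose (transpose P ** b ** P))"
    by (simp add: matrix_mul_assoc matrix_transpose_mul)
  finally show ?thesis unfolding form_inner_def trace_mult_transpose[symmetric] by simp
qed

lemma bilinear_form_inner: "bilinear (form_inner H)"
  unfolding bilinear_def
proof (intro conjI allI linearI)
  show "form_inner H a (b + b') = form_inner H a b + form_inner H a b'" for a b b'
    unfolding form_inner_def trace_def matrix_matrix_mult_def transpose_def
    by (simp add: algebra_simps sum.distrib)
  show "form_inner H (a + a') b = form_inner H a b + form_inner H a' b" for a a' b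
    unfolding form_inner_def trace_def matrix_matrix_mult_def transpose_def
    by (simp add: algebra_simps sum.distrib)
  show "form_inner H a (r *\<^sub>R b) = r *\<^sub>R form_inner H a b" for a r b
    unfolding form_inner_def trace_def matrix_matrix_mult_def transpose_def
    by (simp add: sum_distrib_left sum_distrib_right mult.left_commute mult.assoc)
  show "form_inner H (r *\<^sub>R a) b = r *\<^sub>R form_inner H a b" for a r b
    unfolding form_inner_def trace_def matrix_matrix_mult_def transpose_def
    by (simp add: sum_distrib_left sum_distrib_right mult.left_commute mult.assoc)
qed

lemma continuous_on_form_inner:
  fixes H a b :: "'x::topological_space \<Rightarrow> real^'m^'m"
  assumes "\<And>i j. continuous_on S (\<lambda>x. H x $ i $ j)" "\<And>i j. continuous_on S (\<lambda>x. a x $ i $ j)"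
    "\<And>i j. continuous_on S (\<lambda>x. b x $ i $ j)"
  shows "continuous_on S (\<lambda>x. form_inner (H x) (a x) (b x))"
  unfolding form_inner_def trace_def matrix_matrix_mult_def transpose_def
  by (simp only: vec_lambda_beta) (intro continuous_on_mult continuous_on_sum continuous_on_const assms)

text \<open>Gram-Schmidt, one index at a time. There is room for a further vector because fewer than
  \<open>CARD('m)\<close> vectors span a proper subspace.\<close>

lemma orthonormal_basis_exists:
  fixes f :: "real^'m \<Rightarrow> real^'m \<Rightarrow> real"
  assumes bil: "bilinear f" and sym: "\<And>u v. f u v = f v u" and pos: "\<And>u. u \<noteq> 0 \<Longrightarrow> f u u > 0"
  shows "\<exists>e::'m \<Rightarrow> real^'m. \<forall>i j. f (e i) (e j) = (if i = j then 1 else 0)"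
proof -
  have l: "linear (\<lambda>u. f u v)" for v using bil by (auto simp: bilinear_def)
  have r: "linear (f u)" for u using bil by (auto simp: bilinear_def)
  have "finite S \<Longrightarrow> \<exists>e::'m \<Rightarrow> real^'m. \<forall>i\<in>S. \<forall>j\<in>S. f (e i) (e j) = (if i = j then 1 else 0)" for S :: "'m set"
  proof (induction S rule: finite_induct)
    case empty
    then show ?case by simp
  next
    case (insert a S)
    then obtain e :: "'m \<Rightarrow> real^'m" where e: "\<And>i j. i \<in> S \<Longrightarrow> j \<in> S \<Longrightarrow> f (e i) (e j) = (if i = j then 1 else 0)"
      by auto
    have "S \<noteq> UNIV" using insert.hyps by auto
    then have "card S < CARD('m)" by (intro psubset_card_mono) auto
    moreover have "dim (span (e ` S)) \<le> card (e ` S)"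
      unfolding dim_span by (rule dim_le_card') (use insert.hyps in simp)
    moreover have "card (e ` S) \<le> card S" by (rule card_image_le) (rule insert.hyps)
    ultimately have lt: "dim (span (e ` S)) < DIM(real^'m)" by simp
    have "span (e ` S) \<noteq> UNIV"
    proof
      assume "span (e ` S) = UNIV"
      then have "dim (span (e ` S)) = dim (UNIV :: (real^'m) set)" by (rule arg_cong)
      then show False using lt by (simp only: dim_UNIV less_irrefl)
    qed
    then obtain w where w: "w \<notin> span (e ` S)" by auto
    define w' where "w' = w - (\<Sum>i\<in>S. f w (e i) *\<^sub>R e i)"
    have "w' \<noteq> 0"
    proof
      assume "w' = 0"
      then have "w = (\<Sum>i\<in>S. f w (e i) *\<^sub>R e i)" by (simp add: w'_def)
      also have "\<dots> \<in> span (e ` S)" by (intro span_sum span_scale span_base) auto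
      finally show False using w by simp
    qed
    then have p: "f w' w' > 0" by (rule pos)
    have o: "f w' (e j) = 0" if j: "j \<in> S" for j
    proof -
      have "f w' (e j) = f w (e j) - (\<Sum>i\<in>S. f w (e i) * f (e i) (e j))"
        unfolding w'_def by (simp add: linear_diff[OF l] linear_sum[OF l] linear_scale[OF l])
      also have "(\<Sum>i\<in>S. f w (e i) * f (e i) (e j)) = (\<Sum>i\<in>S. if i = j then f w (e j) else 0)"
        by (rule sum.cong) (use e j in auto)
      also have "\<dots> = f w (e j)" using insert.hyps j by simp
      finally show ?thesis by simp
    qed
    define e' where "e' = e(a := (1 / sqrt (f w' w')) *\<^sub>R w')"
    have ea: "e' a = (1 / sqrt (f w' w')) *\<^sub>R w'" and es: "i \<in> S \<Longrightarrow> e' i = e i" for i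
      using insert.hyps by (auto simp: e'_def)
    have "f (e' i) (e' j) = (if i = j then 1 else 0)" if i: "i \<in> insert a S" and j: "j \<in> insert a S" for i j
    proof -
      have 1: "f (e' a) (e' a) = 1"
        unfolding ea using p by (simp add: linear_scale[OF l] linear_scale[OF r])
      have 2: "f (e' a) (e' j) = 0" "f (e' j) (e' a) = 0" if "j \<in> S" for j
        using o[OF that] unfolding ea es[OF that] sym[of "e j"] by (simp_all add: linear_scale[OF l])
      show ?thesis using i j 1 2 e es insert.hyps(2) by (cases "i = a"; cases "j = a") auto
    qed
    then show ?case by blast
  qed
  from this[of UNIV] show ?thesis by simp
qed


section \<open>Integration of compactly supported functions\<close>

lemma continuous_on_extend_0:
  fixes f :: "'t::topological_space \<times> 'x::t2_space \<Rightarrow> real"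
  assumes T: "open T" and U: "open U" and K: "compact K" "K \<subseteq> U"
    and f: "continuous_on (T \<times> U) f" and z: "\<And>t x. t \<in> T \<Longrightarrow> x \<in> U - K \<Longrightarrow> f (t, x) = 0"
  shows "continuous_on (T \<times> UNIV) (\<lambda>(t, x). if x \<in> U then f (t, x) else 0)"
proof -
  let ?f = "\<lambda>(t, x). if x \<in> U then f (t, x) else 0"
  have "continuous_on (T \<times> U \<union> T \<times> (- K)) ?f"
  proof (rule continuous_on_open_Un)
    show "open (T \<times> U)" "open (T \<times> (- K))"
      using T U compact_imp_closed[OF K(1)] by (auto intro!: open_Times)
    show "continuous_on (T \<times> U) ?f"
      by (rule continuous_on_eq[OF f]) auto
    show "continuous_on (T \<times> (- K)) ?f"
      by (rule continuous_on_eq[OF continuous_on_const[of _ 0]]) (use z in auto)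
  qed
  moreover have "T \<times> U \<union> T \<times> (- K) = T \<times> UNIV" using K by auto
  ultimately show ?thesis by simp
qed

text \<open>Extended by zero the integrand is continuous on the whole space, so the integral over
  the open set becomes one over a box, where continuity suffices for integrability.\<close>

lemma supported_integral:
  fixes f :: "'x::euclidean_space \<Rightarrow> real"
  assumes U: "open U" and K: "compact K" "K \<subseteq> U"
    and f: "continuous_on U f" and z: "\<And>x. x \<in> U - K \<Longrightarrow> f x = 0" and ab: "K \<subseteq> cbox a b"
  shows "f integrable_on U" "integral U f = integral (cbox a b) (\<lambda>x. if x \<in> U then f x else 0)"
proof -
  let ?f = "\<lambda>x. if x \<in> U then f x else 0"
  have "continuous_on (U \<union> (- K)) ?f"
  proof (rule continuous_on_open_Un[OF U])
    show "open (- K)" using compact_imp_closed[OF K(1)] by auto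
    show "continuous_on U ?f" by (rule continuous_on_eq[OF f]) auto
    show "continuous_on (- K) ?f"
      by (rule continuous_on_eq[OF continuous_on_const[of _ 0]]) (use z in auto)
  qed
  moreover have "U \<union> (- K) = UNIV" using K by auto
  ultimately have "continuous_on UNIV ?f" by simp
  then have "continuous_on (cbox a b) ?f" by (rule continuous_on_subset) auto
  then have i: "?f integrable_on cbox a b" by (rule integrable_continuous)
  have o: "?f x = 0" if "x \<notin> cbox a b" for x using that ab z[of x] by auto
  have "?f integrable_on UNIV"
    by (rule integrable_on_superset[OF i o]) auto
  then show "f integrable_on U"
    by (simp add: Henstock_Kurzweil_Integration.integrable_restrict_UNIV)
  have "integral U f = integral UNIV ?f"
    by (simp add: Henstock_Kurzweil_Integration.integral_restrict_UNIV)
  also have "\<dots> = integral UNIV (\<lambda>x. if x \<in> cbox a b then ?f x else 0)"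
    by (rule Henstock_Kurzweil_Integration.integral_cong) (use o in auto)
  also have "\<dots> = integral (cbox a b) ?f"
    by (rule Henstock_Kurzweil_Integration.integral_restrict_UNIV)
  finally show "integral U f = integral (cbox a b) ?f" .
qed

text \<open>The support \<open>K\<close> is the same for all parameters: it provides a single box on
  which the Leibniz rule is applied.\<close>

lemma leibniz_supported:
  fixes f f' :: "real \<Rightarrow> 'x::euclidean_space \<Rightarrow> real"
  assumes T: "open T" "convex T" "t0 \<in> T" and U: "open U" and K: "compact K" "K \<subseteq> U"
    and z: "\<And>t x. t \<in> T \<Longrightarrow> x \<in> U - K \<Longrightarrow> f t x = 0" "\<And>t x. t \<in> T \<Longrightarrow> x \<in> U - K \<Longrightarrow> f' t x = 0"
    and d: "\<And>t x. t \<in> T \<Longrightarrow> x \<in> U \<Longrightarrow> ((\<lambda>t. f t x) has_real_derivative f' t x) (at t)"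
    and c: "\<And>t. t \<in> T \<Longrightarrow> continuous_on U (f t)" and c': "continuous_on (T \<times> U) (\<lambda>(t, x). f' t x)"
  shows "((\<lambda>t. integral U (f t)) has_real_derivative integral U (f' t0)) (at t0)"
proof -
  obtain a where ab: "K \<subseteq> cbox (- a) a"
    using bounded_subset_cbox_symmetric compact_imp_bounded K(1) by blast
  let ?f = "\<lambda>t x. if x \<in> U then f t x else 0" and ?f' = "\<lambda>t x. if x \<in> U then f' t x else 0"
  have c'': "continuous_on U (f' t)" if "t \<in> T" for t
  proof -
    have "continuous_on U (\<lambda>x. (\<lambda>(t, x). f' t x) (t, x))"
      by (rule continuous_on_compose2[OF c' continuous_on_Pair[OF continuous_on_const continuous_on_id]])
        (use that in auto)
    then show ?thesis by simp
  qed
  have e: "continuous_on (T \<times> UNIV) (\<lambda>(t, x). if x \<in> U then (\<lambda>(t, x). f' t x) (t, x) else 0)"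
    by (rule continuous_on_extend_0[OF T(1) U K c']) (use z in auto)
  have L: "((\<lambda>t. integral (cbox (- a) a) (?f t)) has_field_derivative integral (cbox (- a) a) (?f' t0)) (at t0 within T)"
  proof (rule leibniz_rule_field_derivative[OF _ _ _ T(3,2)])
    show "((\<lambda>t. ?f t x) has_field_derivative ?f' t x) (at t within T)" if "t \<in> T" "x \<in> cbox (- a) a" for t x
      using d[OF that(1), of x] by (cases "x \<in> U") (auto intro: DERIV_subset)
    have *: "continuous_on (T \<times> cbox (- a) a) (\<lambda>(t, x). if x \<in> U then (\<lambda>(t, x). f' t x) (t, x) else 0)"
      by (rule continuous_on_subset[OF e]) auto
    then show "continuous_on (T \<times> cbox (- a) a) (\<lambda>(t, x). ?f' t x)" unfolding split_def by (simp cong: if_cong)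
    show "?f t integrable_on cbox (- a) a" if t: "t \<in> T" for t
    proof -
      have "f t integrable_on U" by (rule supported_integral(1)[OF U K c[OF t] z(1)[OF t] ab])
      then have "?f t integrable_on UNIV"
        by (simp add: Henstock_Kurzweil_Integration.integrable_restrict_UNIV)
      then show ?thesis by (rule integrable_on_subcbox) simp
    qed
  qed
  have eq: "integral (cbox (- a) a) (?f t) = integral U (f t)" if "t \<in> T" for t
    by (rule supported_integral(2)[OF U K c[OF that] z(1)[OF that] ab, symmetric])
  have eq': "integral (cbox (- a) a) (?f' t0) = integral U (f' t0)"
    by (rule supported_integral(2)[OF U K c''[OF T(3)] z(2)[OF T(3)] ab, symmetric])
  show ?thesis
    by (rule has_field_derivative_transform_within_open[OF L[unfolded at_within_open[OF T(3,1)] eq'] T(1,3)])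
      (rule eq)
qed


section \<open>The energy as a quadratic functional\<close>

text \<open>\<open>F\<close> and \<open>\<rho>\<close> name the partition picked by the choice
  operator in \<open>volume_integral\<close>; \<open>partition_choice\<close> pins them to it, so
  that the energy unfolds to a concrete sum over \<open>F\<close>.\<close>

locale riemannian =
  fixes A :: "('a::t2_space, 'm::finite) chart set" and g :: "('a, 'm) two_tensor"
    and F :: "('a, 'm) chart set" and \<rho> :: "('a, 'm) chart \<Rightarrow> 'a \<Rightarrow> real"
  assumes atlasA: "smooth_atlas A" and cpt: "compact (UNIV :: 'a set)"
    and metric: "riemannian_metric A g"
    and partition: "partition_of_unity A F \<rho>"
    and partition_choice: "(SOME (F, \<rho>). partition_of_unity A F \<rho>) = (F, \<rho>)"
begin

lemma finite_F: "finite F" and F_A: "c \<in> F \<Longrightarrow> c \<in> A"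
  using partition by (auto simp: partition_of_unity_def)

lemma metric_bilinear: "c \<in> A \<Longrightarrow> x \<in> chart_img c \<Longrightarrow> bilinear (local_rep A g c x)"
  and metric_smooth: "c \<in> A \<Longrightarrow> smooth_on (chart_img c) (\<lambda>x. local_rep A g c x u v)"
  using metric by (auto simp: riemannian_metric_def)

lemma metric_sym:
  assumes "c \<in> A" "x \<in> chart_img c"
  shows "local_rep A g c x u v = local_rep A g c x v u"
  using metric coord_vec_in_tangent_space[OF atlasA assms(1) chart_inv_in[OF assms(2)]]
  unfolding riemannian_metric_def local_rep_def Let_def by blast

lemma metric_pos:
  assumes c: "c \<in> A" "x \<in> chart_img c" and u: "u \<noteq> 0"
  shows "local_rep A g c x u u > 0"
proof -
  let ?v = "coord_vec A c (chart_inv c x) u"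
  have "?v c = u" by (rule coord_vec_self[OF atlasA c(1) chart_inv_in[OF c(2)]])
  then have "?v \<noteq> (\<lambda>_. 0)" using u by auto
  moreover have "?v \<in> tangent_space A (chart_inv c x)"
    by (rule coord_vec_in_tangent_space[OF atlasA c(1) chart_inv_in[OF c(2)]])
  moreover have "\<forall>p. \<forall>v\<in>tangent_space A p. v \<noteq> (\<lambda>_. 0) \<longrightarrow> g p v v > 0"
    using metric unfolding riemannian_metric_def by simp
  ultimately show ?thesis unfolding local_rep_def Let_def by simp
qed

abbreviation "gm c x \<equiv> tmat A g c x"
abbreviation "gi c x \<equiv> matrix_inv (gm c x)"

text \<open>Orthonormality of the columns is a matrix equation; moving \<open>P\<close> to the other
  side of it exhibits \<open>P ** transpose P\<close> as a left inverse of the metric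
  matrix.\<close>

lemma frame_matrix:
  fixes E :: "'m \<Rightarrow> real^'m"
  assumes c: "c \<in> A" "x \<in> chart_img c" and e: "\<And>i j. local_rep A g c x (E i) (E j) = (if i = j then 1 else 0)"
  defines "P \<equiv> (\<chi> k i. E i $ k)"
  shows "transpose P ** gm c x ** P = mat 1" "invertible (gm c x)" "gi c x = P ** transpose P"
proof -
  have col: "column i P = E i" for i by (simp add: P_def column_def vec_eq_iff)
  have "(transpose P ** gm c x ** P) $ i $ j = (mat 1 :: real^'m^'m) $ i $ j" for i j
    unfolding congruent_matrix_entry col tmat_def bilinear_matrix[OF metric_bilinear[OF c], symmetric] e
    by (simp add: mat_def)
  then show 1: "transpose P ** gm c x ** P = mat 1" by (simp add: vec_eq_iff)
  then have "P ** (transpose P ** gm c x) = mat 1" using matrix_left_right_inverse by blast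
  then have "(P ** transpose P) ** gm c x = mat 1" by (simp add: matrix_mul_assoc)
  then show "invertible (gm c x)" "gi c x = P ** transpose P" by (rule matrix_inv_eqI)+
qed

lemma frame_coords_exist:
  assumes c: "c \<in> A" "x \<in> chart_img c"
  shows "\<exists>E::'m \<Rightarrow> real^'m. \<forall>i j. local_rep A g c x (E i) (E j) = (if i = j then 1 else 0)"
  by (rule orthonormal_basis_exists[OF metric_bilinear[OF c] metric_sym[OF c] metric_pos[OF c]])

lemma metric_invertible:
  assumes c: "c \<in> A" "x \<in> chart_img c"
  shows "invertible (gm c x)"
proof -
  obtain E :: "'m \<Rightarrow> real^'m" where "\<forall>i j. local_rep A g c x (E i) (E j) = (if i = j then 1 else 0)"
    using frame_coords_exist[OF c] by (elim exE) (rule that)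
  from frame_matrix(2)[OF c this[rule_format]] show ?thesis .
qed

lemma inverse_metric_factor:
  assumes c: "c \<in> A" "x \<in> chart_img c"
  obtains P :: "real^'m^'m" where "gi c x = P ** transpose P" "transpose P ** gm c x ** P = mat 1"
proof -
  obtain E :: "'m \<Rightarrow> real^'m" where "\<forall>i j. local_rep A g c x (E i) (E j) = (if i = j then 1 else 0)"
    using frame_coords_exist[OF c] by (elim exE) (rule that)
  from frame_matrix(3,1)[OF c this[rule_format]] show thesis by (rule that)
qed

lemma metric_det_pos:
  assumes c: "c \<in> A" "x \<in> chart_img c"
  shows "det (gm c x) > 0"
proof -
  obtain P :: "real^'m^'m" where "transpose P ** gm c x ** P = mat 1" by (rule inverse_metric_factor[OF c])
  then have "det (transpose P ** gm c x ** P) = det (mat 1 :: real^'m^'m)" by simp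
  then have "det P * det P * det (gm c x) = 1" by (simp add: det_mul det_transpose mult.commute mult.left_commute)
  then have "det P * det P * det (gm c x) > 0" by simp
  then show ?thesis using zero_le_square[of "det P"] by (simp add: zero_less_mult_iff)
qed

text \<open>Only orthonormality of the chosen frame is used, and the frame drops out on the
  right-hand side. The choice in \<open>two_form_inner\<close> is thereby replaced by an expression
  in \<open>gi c x\<close>, which varies smoothly.\<close>

lemma two_form_inner_eq:
  assumes c: "c \<in> A" "x \<in> chart_img c"
    and \<alpha>: "bilinear (local_rep A \<alpha> c x)" and \<beta>: "bilinear (local_rep A \<beta> c x)"
  shows "two_form_inner A g \<alpha> \<beta> (chart_inv c x) = form_inner (gi c x) (tmat A \<alpha> c x) (tmat A \<beta> c x)"
proof -
  let ?p = "chart_inv c x"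
  have p: "?p \<in> chart_dom c" by (rule chart_inv_in[OF c(2)])
  define e where "e = (SOME e. orthonormal_frame A g ?p e)"
  obtain E0 :: "'m \<Rightarrow> real^'m" where E0: "\<forall>i j. local_rep A g c x (E0 i) (E0 j) = (if i = j then 1 else 0)"
    using frame_coords_exist[OF c] by (elim exE) (rule that)
  have "orthonormal_frame A g ?p (\<lambda>i. coord_vec A c ?p (E0 i))"
    unfolding orthonormal_frame_def using E0 coord_vec_in_tangent_space[OF atlasA c(1) p]
    by (simp add: local_rep_def Let_def)
  then have e: "orthonormal_frame A g ?p e" unfolding e_def by (rule someI[where P="orthonormal_frame A g ?p"])
  define E where "E i = e i c" for i
  have eE: "e i = coord_vec A c ?p (E i)" for i
    unfolding E_def using e by (simp add: orthonormal_frame_def coord_vec_components[OF c(1) p])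
  have lr: "\<gamma> ?p (e i) (e j) = local_rep A \<gamma> c x (E i) (E j)" for \<gamma> i j
    unfolding eE local_rep_def Let_def ..
  have on: "local_rep A g c x (E i) (E j) = (if i = j then 1 else 0)" for i j
    using e unfolding lr[symmetric] orthonormal_frame_def by simp
  define P where "P = (\<chi> k i. E i $ k)"
  have col: "column i P = E i" for i by (simp add: P_def column_def vec_eq_iff)
  have en: "local_rep A \<gamma> c x (E i) (E j) = (transpose P ** tmat A \<gamma> c x ** P) $ i $ j"
    if "bilinear (local_rep A \<gamma> c x)" for \<gamma> i j
    unfolding congruent_matrix_entry col tmat_def by (rule bilinear_matrix[OF that])
  have gi: "gi c x = P ** transpose P" unfolding P_def by (rule frame_matrix(3)[OF c on])
  show ?thesis
    unfolding two_form_inner_def Let_def e_def[symmetric] lr en[OF \<alpha>] en[OF \<beta>] gi form_inner_factor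
    by simp
qed

lemma form_inner_nonneg:
  assumes "c \<in> A" "x \<in> chart_img c"
  shows "form_inner (gi c x) a a \<ge> 0"
proof -
  obtain P :: "real^'m^'m" where P: "gi c x = P ** transpose P" by (rule inverse_metric_factor[OF assms])
  show ?thesis unfolding P form_inner_factor by (simp add: sum_nonneg)
qed

lemma form_inner_sym:
  assumes "c \<in> A" "x \<in> chart_img c"
  shows "form_inner (gi c x) a b = form_inner (gi c x) b a"
proof -
  obtain P :: "real^'m^'m" where P: "gi c x = P ** transpose P" by (rule inverse_metric_factor[OF assms])
  show ?thesis unfolding P form_inner_factor by (simp add: mult.commute)
qed

lemma smooth_gm: "c \<in> A \<Longrightarrow> smooth_on (chart_img c) (\<lambda>x. gm c x $ i $ j)"
  by (simp add: tmat_def metric_smooth)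

text \<open>Column \<open>j\<close> of the inverse solves a linear system with smooth matrix and
  constant right-hand side.\<close>

lemma smooth_gi:
  assumes c: "c \<in> A"
  shows "smooth_on (chart_img c) (\<lambda>x. gi c x $ i $ j)"
proof -
  have "smooth_on (chart_img c) (\<lambda>x. column j (gi c x))"
  proof (rule smooth_on_linear_solve[OF open_chart_img[OF atlasA c] smooth_gm[OF c]])
    show "det (gm c x) \<noteq> 0" if "x \<in> chart_img c" for x using metric_det_pos[OF c that] by simp
    show "gm c x *v column j (gi c x) = axis j 1" if "x \<in> chart_img c" for x
      unfolding matrix_vector_mult_basis[symmetric] matrix_vector_mul_assoc
        matrix_inv_works(1)[OF metric_invertible[OF c that]] by simp
    show "smooth_on (chart_img c) (\<lambda>x. axis j 1 $ i)" for i by (rule smooth_on_const)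
  qed
  from smooth_on_nth[OF open_chart_img[OF atlasA c] this, of i] show ?thesis by (simp add: column_def)
qed

definition weight :: "('a, 'm) chart \<Rightarrow> real^'m \<Rightarrow> real" where
  "weight c x = \<rho> c (chart_inv c x) * volume_coeff A g c x"

lemma volume_coeff_eq: "volume_coeff A g c x = sqrt (det (gm c x))"
  by (simp add: volume_coeff_def tmat_def)

lemma continuous_volume_coeff:
  assumes c: "c \<in> A"
  shows "continuous_on (chart_img c) (volume_coeff A g c)"
  unfolding volume_coeff_eq
  by (intro continuous_on_real_sqrt smooth_on_continuous[OF smooth_on_det[OF open_chart_img[OF atlasA c] smooth_gm[OF c]]])

lemma smooth_\<rho>:
  assumes c: "c \<in> F"
  shows "smooth_on (chart_img c) (\<lambda>x. \<rho> c (chart_inv c x))"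
  using partition c F_A[OF c] by (auto simp: partition_of_unity_def smooth_fun_def o_def)

lemma weight_continuous:
  assumes c: "c \<in> F"
  shows "continuous_on (chart_img c) (weight c)"
  unfolding weight_def
  by (intro continuous_on_mult continuous_volume_coeff F_A c smooth_on_continuous[OF smooth_\<rho>])

lemma weight_nonneg:
  assumes c: "c \<in> F" and x: "x \<in> chart_img c"
  shows "weight c x \<ge> 0"
proof -
  have "\<rho> c p \<ge> 0" for p using partition c by (simp add: partition_of_unity_def)
  then show ?thesis using metric_det_pos[OF F_A[OF c] x] by (simp add: weight_def volume_coeff_eq)
qed

definition supp :: "('a, 'm) chart \<Rightarrow> (real^'m) set" where
  "supp c = snd c ` closure {p. \<rho> c p \<noteq> 0}"

lemma supp_compact: "c \<in> F \<Longrightarrow> compact (supp c)"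
  and supp_subset: "c \<in> F \<Longrightarrow> supp c \<subseteq> chart_img c"
  and \<rho>_outside_supp: "c \<in> F \<Longrightarrow> x \<in> chart_img c - supp c \<Longrightarrow> \<rho> c (chart_inv c x) = 0"
proof -
  assume c: "c \<in> F"
  have s: "closure {p. \<rho> c p \<noteq> 0} \<subseteq> chart_dom c" using partition c by (simp add: partition_of_unity_def)
  have "compact (closure {p. \<rho> c p \<noteq> 0})"
    using compact_Int_closed[OF cpt closed_closure] by simp
  then show "compact (supp c)" unfolding supp_def
    by (rule compact_continuous_image[OF continuous_on_subset[OF continuous_on_chart[OF atlasA F_A[OF c]] s]])
  show "supp c \<subseteq> chart_img c" unfolding supp_def using s by (rule image_mono)
  assume x: "x \<in> chart_img c - supp c"
  show "\<rho> c (chart_inv c x) = 0"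
  proof (rule ccontr)
    assume "\<rho> c (chart_inv c x) \<noteq> 0"
    then have "chart_inv c x \<in> closure {p. \<rho> c p \<noteq> 0}" by (intro subsetD[OF closure_subset]) simp
    then have "snd c (chart_inv c x) \<in> supp c" unfolding supp_def by (rule imageI)
    then show False using x by (simp add: chart_chart_inv)
  qed
qed

lemma weight_outside_supp: "c \<in> F \<Longrightarrow> x \<in> chart_img c - supp c \<Longrightarrow> weight c x = 0"
  by (simp add: weight_def \<rho>_outside_supp)

text \<open>The L^2 inner product of 2-forms, written in the charts of the fixed partition. Its
  arguments are arbitrary families of matrices indexed by charts, so parameter derivatives of
  coefficients can be inserted directly.\<close>

definition pairing :: "(('a, 'm) chart \<Rightarrow> real^'m \<Rightarrow> real^'m^'m) \<Rightarrow> (('a, 'm) chart \<Rightarrow> real^'m \<Rightarrow> real^'m^'m) \<Rightarrow> real" where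
  "pairing a b = (\<Sum>c\<in>F. integral (chart_img c) (\<lambda>x. weight c x * form_inner (gi c x) (a c x) (b c x)))"

lemma pairing_cong:
  assumes "\<And>c x. c \<in> A \<Longrightarrow> x \<in> chart_img c \<Longrightarrow> a c x = a' c x" "\<And>c x. c \<in> A \<Longrightarrow> x \<in> chart_img c \<Longrightarrow> b c x = b' c x"
  shows "pairing a b = pairing a' b'"
  unfolding pairing_def
  by (intro sum.cong refl Henstock_Kurzweil_Integration.integral_cong) (simp add: assms F_A)

lemma pairing_integrable:
  assumes c: "c \<in> F" and a: "continuous_on (chart_img c) a" and b: "continuous_on (chart_img c) b"
  shows "(\<lambda>x. weight c x * form_inner (gi c x) (a x) (b x)) integrable_on chart_img c"
proof -
  obtain l where "supp c \<subseteq> cbox (- l) l"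
    using bounded_subset_cbox_symmetric compact_imp_bounded supp_compact[OF c] by blast
  then show ?thesis
    by (rule supported_integral(1)[OF open_chart_img[OF atlasA F_A[OF c]] supp_compact[OF c] supp_subset[OF c], rotated 2])
      (auto intro!: continuous_on_mult weight_continuous c continuous_on_form_inner
        smooth_on_continuous[OF smooth_gi[OF F_A[OF c]]] continuous_on_component a b simp: weight_outside_supp[OF c])
qed

lemma pairing_nonneg:
  assumes "\<And>c. c \<in> A \<Longrightarrow> continuous_on (chart_img c) (a c)"
  shows "pairing a a \<ge> 0"
  unfolding pairing_def
  by (intro sum_nonneg Henstock_Kurzweil_Integration.integral_nonneg pairing_integrable assms F_A
      mult_nonneg_nonneg weight_nonneg form_inner_nonneg)

lemma pairing_sum:
  assumes "finite I" and a: "\<And>c. c \<in> A \<Longrightarrow> continuous_on (chart_img c) (a c)"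
    and b: "\<And>i c. i \<in> I \<Longrightarrow> c \<in> A \<Longrightarrow> continuous_on (chart_img c) (b i c)"
  shows "pairing a (\<lambda>c x. \<Sum>i\<in>I. b i c x) = (\<Sum>i\<in>I. pairing a (b i))"
proof -
  have l: "linear (form_inner H w)" for H w :: "real^'m^'m" using bilinear_form_inner by (auto simp: bilinear_def)
  have "pairing a (\<lambda>c x. \<Sum>i\<in>I. b i c x)
    = (\<Sum>c\<in>F. integral (chart_img c) (\<lambda>x. \<Sum>i\<in>I. weight c x * form_inner (gi c x) (a c x) (b i c x)))"
    unfolding pairing_def linear_sum[OF l] sum_distrib_left ..
  also have "\<dots> = (\<Sum>c\<in>F. \<Sum>i\<in>I. integral (chart_img c) (\<lambda>x. weight c x * form_inner (gi c x) (a c x) (b i c x)))"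
    by (intro sum.cong refl Henstock_Kurzweil_Integration.integral_sum assms(1) pairing_integrable a b F_A)
  also have "\<dots> = (\<Sum>i\<in>I. pairing a (b i))" unfolding pairing_def by (rule sum.swap)
  finally show ?thesis .
qed

lemma pairing_sym: "pairing a b = pairing b a"
  unfolding pairing_def
  by (intro sum.cong refl Henstock_Kurzweil_Integration.integral_cong) (simp add: form_inner_sym[OF F_A])

text \<open>Differentiation under the integral is possible because the support of each partition
  function is a compact set independent of the parameter. Moving along
  \<open>z0 + r *\<^sub>R w\<close> covers every direction of a parameter space of any
  dimension.\<close>

lemma pairing_derivative:
  fixes a b :: "('a, 'm) chart \<Rightarrow> 't::euclidean_space \<times> (real^'m) \<Rightarrow> real^'m^'m"
  assumes T: "open T" "z0 \<in> T"
    and a: "\<And>c. c \<in> A \<Longrightarrow> smooth_on (T \<times> chart_img c) (a c)"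
    and b: "\<And>c. c \<in> A \<Longrightarrow> smooth_on (T \<times> chart_img c) (b c)"
  shows "((\<lambda>r. pairing (\<lambda>c x. a c (z0 + r *\<^sub>R w, x)) (\<lambda>c x. b c (z0 + r *\<^sub>R w, x))) has_real_derivative
     pairing (\<lambda>c x. a c (z0, x)) (\<lambda>c x. dd (b c) (w, 0) (z0, x))
     + pairing (\<lambda>c x. dd (a c) (w, 0) (z0, x)) (\<lambda>c x. b c (z0, x))) (at 0)"
proof -
  define R where "R = (\<lambda>r. z0 + r *\<^sub>R w) -` T"
  have "open R" unfolding R_def
    by (rule open_vimage[OF T(1)]) (intro continuous_intros)
  moreover have "0 \<in> R" using T by (simp add: R_def)
  \<comment> \<open>A ball is taken because \<open>leibniz_supported\<close> asks for a convex open
    set of parameters.\<close>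
  ultimately obtain \<delta> where \<delta>: "\<delta> > 0" "ball 0 \<delta> \<subseteq> R" using openE by blast
  let ?T = "ball (0::real) \<delta>"
  have inT: "z0 + r *\<^sub>R w \<in> T" if "r \<in> ?T" for r using that \<delta> by (auto simp: R_def)
  have der: "((\<lambda>r. f (z0 + r *\<^sub>R w, x)) has_vector_derivative dd f (w, 0) (z0 + r *\<^sub>R w, x)) (at r)"
    if f: "smooth_on (T \<times> chart_img c) f" and r: "r \<in> ?T" and x: "x \<in> chart_img c"
    for f :: "'t \<times> (real^'m) \<Rightarrow> real^'m^'m" and c r x
  proof -
    have d: "f differentiable (at (z0 + r *\<^sub>R w, x))"
      by (rule smooth_on_differentiable[OF f]) (use inT[OF r] x in simp)
    have "((\<lambda>r. (z0 + r *\<^sub>R w, x)) has_derivative (\<lambda>h. (h *\<^sub>R w, 0))) (at r)"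
      by (auto intro!: derivative_eq_intros)
    from diff_chain_at[OF this has_derivative_dd[OF d]]
    have "((\<lambda>r. f (z0 + r *\<^sub>R w, x)) has_derivative (\<lambda>h. dd f (h *\<^sub>R w, 0) (z0 + r *\<^sub>R w, x))) (at r)"
      by (simp add: o_def)
    moreover have "dd f (h *\<^sub>R w, 0) (z0 + r *\<^sub>R w, x) = h *\<^sub>R dd f (w, 0) (z0 + r *\<^sub>R w, x)" for h
      using linear_scale[OF linear_dd[OF d], of h "(w, 0)"] by simp
    ultimately show ?thesis by (simp add: has_vector_derivative_def)
  qed
  have cont: "continuous_on (?T \<times> chart_img c) (\<lambda>z. f (z0 + fst z *\<^sub>R w, snd z))"
    if "smooth_on (T \<times> chart_img c) f" for f :: "'t \<times> (real^'m) \<Rightarrow> real^'m^'m" and c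
    by (rule continuous_on_compose2[OF smooth_on_continuous[OF that]]) (use inT in \<open>auto intro!: continuous_intros\<close>)
  have "((\<lambda>r. integral (chart_img c) (\<lambda>x. weight c x * form_inner (gi c x) (a c (z0 + r *\<^sub>R w, x)) (b c (z0 + r *\<^sub>R w, x))))
    has_real_derivative integral (chart_img c) (\<lambda>x.
      weight c x * form_inner (gi c x) (a c (z0 + 0 *\<^sub>R w, x)) (dd (b c) (w, 0) (z0 + 0 *\<^sub>R w, x)) +
      weight c x * form_inner (gi c x) (dd (a c) (w, 0) (z0 + 0 *\<^sub>R w, x)) (b c (z0 + 0 *\<^sub>R w, x)))) (at 0)"
    if c: "c \<in> F" for c
  proof (rule leibniz_supported[where T = ?T and K = "supp c"])
    note cA = F_A[OF c]
    have cgi: "continuous_on (?T \<times> chart_img c) (\<lambda>z. gi c (snd z) $ i $ j)" for i j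
      by (rule continuous_on_compose2[OF smooth_on_continuous[OF smooth_gi[OF cA]]]) (auto intro!: continuous_intros)
    have cw: "continuous_on (?T \<times> chart_img c) (\<lambda>z. weight c (snd z))"
      by (rule continuous_on_compose2[OF weight_continuous[OF c]]) (auto intro!: continuous_intros)
    have cq: "continuous_on (?T \<times> chart_img c) (\<lambda>z. weight c (snd z) *
        form_inner (gi c (snd z)) (f1 (z0 + fst z *\<^sub>R w, snd z)) (f2 (z0 + fst z *\<^sub>R w, snd z)))"
      if "smooth_on (T \<times> chart_img c) f1" "smooth_on (T \<times> chart_img c) f2" for f1 f2
      by (intro continuous_on_mult cw continuous_on_form_inner cgi continuous_on_component cont that)
    show "open (chart_img c)" by (rule open_chart_img[OF atlasA cA])
    show "compact (supp c)" "supp c \<subseteq> chart_img c" using supp_compact[OF c] supp_subset[OF c] by auto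
    show "continuous_on (?T \<times> chart_img c) (\<lambda>(r, x).
      weight c x * form_inner (gi c x) (a c (z0 + r *\<^sub>R w, x)) (dd (b c) (w, 0) (z0 + r *\<^sub>R w, x)) +
      weight c x * form_inner (gi c x) (dd (a c) (w, 0) (z0 + r *\<^sub>R w, x)) (b c (z0 + r *\<^sub>R w, x)))"
      unfolding split_def
      by (intro continuous_on_add cq a[OF cA] b[OF cA] smooth_on_dd)
    show "continuous_on (chart_img c) (\<lambda>x. weight c x * form_inner (gi c x) (a c (z0 + r *\<^sub>R w, x)) (b c (z0 + r *\<^sub>R w, x)))"
      if "r \<in> ?T" for r
    proof -
      have "continuous_on (chart_img c) (\<lambda>x. (\<lambda>z. weight c (snd z) *
        form_inner (gi c (snd z)) (a c (z0 + fst z *\<^sub>R w, snd z)) (b c (z0 + fst z *\<^sub>R w, snd z))) (r, x))"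
        by (rule continuous_on_compose2[OF cq[OF a[OF cA] b[OF cA]] continuous_on_Pair[OF continuous_on_const continuous_on_id]])
          (use that in auto)
      then show ?thesis by simp
    qed
    show "((\<lambda>r. weight c x * form_inner (gi c x) (a c (z0 + r *\<^sub>R w, x)) (b c (z0 + r *\<^sub>R w, x))) has_real_derivative
      weight c x * form_inner (gi c x) (a c (z0 + r *\<^sub>R w, x)) (dd (b c) (w, 0) (z0 + r *\<^sub>R w, x)) +
      weight c x * form_inner (gi c x) (dd (a c) (w, 0) (z0 + r *\<^sub>R w, x)) (b c (z0 + r *\<^sub>R w, x))) (at r)"
      if r: "r \<in> ?T" and x: "x \<in> chart_img c" for r x
    proof -
      have bb: "bounded_bilinear (form_inner (gi c x))"
        using bilinear_form_inner bilinear_conv_bounded_bilinear by blast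
      have "((\<lambda>r. form_inner (gi c x) (a c (z0 + r *\<^sub>R w, x)) (b c (z0 + r *\<^sub>R w, x))) has_vector_derivative
        form_inner (gi c x) (a c (z0 + r *\<^sub>R w, x)) (dd (b c) (w, 0) (z0 + r *\<^sub>R w, x)) +
        form_inner (gi c x) (dd (a c) (w, 0) (z0 + r *\<^sub>R w, x)) (b c (z0 + r *\<^sub>R w, x))) (at r)"
        by (rule bounded_bilinear.has_vector_derivative[OF bb der[OF a[OF cA] r x] der[OF b[OF cA] r x]])
      then have "((\<lambda>r. form_inner (gi c x) (a c (z0 + r *\<^sub>R w, x)) (b c (z0 + r *\<^sub>R w, x))) has_real_derivative
        form_inner (gi c x) (a c (z0 + r *\<^sub>R w, x)) (dd (b c) (w, 0) (z0 + r *\<^sub>R w, x)) +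
        form_inner (gi c x) (dd (a c) (w, 0) (z0 + r *\<^sub>R w, x)) (b c (z0 + r *\<^sub>R w, x))) (at r)"
        by (simp add: has_real_derivative_iff_has_vector_derivative)
      from DERIV_cmult[OF this, of "weight c x"] show ?thesis by (simp add: distrib_left)
    qed
  qed (use \<delta> weight_outside_supp[OF c] in auto)
  from DERIV_sum[of F, OF this]
  have "((\<lambda>r. pairing (\<lambda>c x. a c (z0 + r *\<^sub>R w, x)) (\<lambda>c x. b c (z0 + r *\<^sub>R w, x))) has_real_derivative
    (\<Sum>c\<in>F. integral (chart_img c) (\<lambda>x.
      weight c x * form_inner (gi c x) (a c (z0, x)) (dd (b c) (w, 0) (z0, x)) +
      weight c x * form_inner (gi c x) (dd (a c) (w, 0) (z0, x)) (b c (z0, x))))) (at 0)"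
    by (simp add: pairing_def)
  moreover have "(\<Sum>c\<in>F. integral (chart_img c) (\<lambda>x.
      weight c x * form_inner (gi c x) (a c (z0, x)) (dd (b c) (w, 0) (z0, x)) +
      weight c x * form_inner (gi c x) (dd (a c) (w, 0) (z0, x)) (b c (z0, x))))
    = pairing (\<lambda>c x. a c (z0, x)) (\<lambda>c x. dd (b c) (w, 0) (z0, x))
     + pairing (\<lambda>c x. dd (a c) (w, 0) (z0, x)) (\<lambda>c x. b c (z0, x))"
    unfolding pairing_def sum.distrib[symmetric]
  proof (intro sum.cong refl Henstock_Kurzweil_Integration.integral_add pairing_integrable)
    fix c assume "c \<in> F"
    then have cA: "c \<in> A" by (rule F_A)
    have *: "continuous_on (chart_img c) (\<lambda>x. f (z0, x))" if "smooth_on (T \<times> chart_img c) f"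
      for f :: "'t \<times> (real^'m) \<Rightarrow> real^'m^'m"
      by (rule continuous_on_compose2[OF smooth_on_continuous[OF that]]) (use T in \<open>auto intro!: continuous_intros\<close>)
    show "continuous_on (chart_img c) (\<lambda>x. a c (z0, x))" "continuous_on (chart_img c) (\<lambda>x. b c (z0, x))"
      "continuous_on (chart_img c) (\<lambda>x. dd (a c) (w, 0) (z0, x))" "continuous_on (chart_img c) (\<lambda>x. dd (b c) (w, 0) (z0, x))"
      by (intro * a b cA smooth_on_dd)+
  qed
  ultimately show ?thesis by simp
qed

end

section \<open>Variations of the energy\<close>

text \<open>The covariance clause makes the coefficient vectors one global object, whose value on
  the tangent vector with components \<open>u\<close> is
  \<open>\<eta> c x \<bullet> u\<close>.\<close>

definition one_form :: "('a, 'm::finite) chart set \<Rightarrow> (('a, 'm) chart \<Rightarrow> real^'m \<Rightarrow> real^'m) \<Rightarrow> bool" where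
  "one_form A \<eta> \<longleftrightarrow> (\<forall>c\<in>A. smooth_on (chart_img c) (\<eta> c)) \<and>
     (\<forall>c\<in>A. \<forall>c'\<in>A. \<forall>p\<in>chart_dom c \<inter> chart_dom c'. \<forall>u.
        \<eta> c (snd c p) \<bullet> u = \<eta> c' (snd c' p) \<bullet> transition_deriv c c' p u)"

text \<open>The exterior derivative in coordinates, as an antisymmetric matrix.\<close>

definition dform :: "(('a, 'm::finite) chart \<Rightarrow> real^'m \<Rightarrow> real^'m) \<Rightarrow> ('a, 'm) chart \<Rightarrow> real^'m \<Rightarrow> real^'m^'m" where
  "dform \<eta> c x = (\<chi> i j. dd (\<lambda>x. \<eta> c x $ j) (axis i 1) x - dd (\<lambda>x. \<eta> c x $ i) (axis j 1) x)"

lemma one_form_smooth: "one_form A \<eta> \<Longrightarrow> c \<in> A \<Longrightarrow> smooth_on (chart_img c) (\<eta> c)"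
  by (simp add: one_form_def)

lemma one_form_change:
  assumes "one_form A \<eta>" "c \<in> A" "c' \<in> A" "p \<in> chart_dom c" "p \<in> chart_dom c'"
  shows "\<eta> c (snd c p) \<bullet> u = \<eta> c' (snd c' p) \<bullet> transition_deriv c c' p u"
proof -
  have "\<forall>c\<in>A. \<forall>c'\<in>A. \<forall>p\<in>chart_dom c \<inter> chart_dom c'. \<forall>u.
        \<eta> c (snd c p) \<bullet> u = \<eta> c' (snd c' p) \<bullet> transition_deriv c c' p u"
    using assms(1) unfolding one_form_def by (rule conjunct2)
  from this[rule_format, OF assms(2,3) IntI[OF assms(4,5)]] show ?thesis .
qed

lemma dd_nth:
  fixes f :: "'x::real_normed_vector \<Rightarrow> 'y::real_normed_vector^'n"
  shows "f differentiable (at x) \<Longrightarrow> dd (\<lambda>x. f x $ i) v x = dd f v x $ i"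
  by (rule dd_linear_compose[OF bounded_linear_vec_nth])

lemma dform_cong:
  assumes A: "smooth_atlas A" "c \<in> A" and x: "x \<in> chart_img c"
    and \<eta>: "smooth_on (chart_img c) (\<eta> c)" and e: "\<And>x. x \<in> chart_img c \<Longrightarrow> \<eta> c x = \<eta>' c x"
  shows "dform \<eta> c x = dform \<eta>' c x"
proof -
  have "dd (\<lambda>x. \<eta> c x $ i) v x = dd (\<lambda>x. \<eta>' c x $ i) v x" for i v
    by (rule dd_cong_open[OF open_chart_img[OF A] x])
      (simp_all add: e smooth_on_differentiable[OF smooth_on_nth[OF open_chart_img[OF A] \<eta>] x])
  then show ?thesis by (simp add: dform_def)
qed

lemma smooth_dform:
  assumes A: "smooth_atlas A" "c \<in> A" and \<eta>: "smooth_on (chart_img c) (\<eta> c)"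
  shows "smooth_on (chart_img c) (dform \<eta> c)"
proof -
  note op = open_chart_img[OF A]
  have "smooth_on (chart_img c) (\<lambda>x. \<chi> i j. dd (\<lambda>x. \<eta> c x $ j) (axis i 1) x - dd (\<lambda>x. \<eta> c x $ i) (axis j 1) x)"
    by (intro smooth_on_vec smooth_on_diff smooth_on_dd smooth_on_nth \<eta> op)
  then show ?thesis by (rule smooth_on_cong[OF op]) (simp add: dform_def)
qed

lemma dd_slice:
  assumes "f differentiable (at (t, x))"
  shows "dd (\<lambda>x. f (t, x)) v x = dd f (0, v) (t, x)"
proof -
  have "((\<lambda>x. (t, x)) has_derivative (\<lambda>u. (0, u))) (at x)"
    by (intro has_derivative_Pair has_derivative_const has_derivative_ident)
  from diff_chain_at[OF this has_derivative_dd[OF assms]] show ?thesis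
    by (intro dd_eqI[THEN trans]) (auto simp: o_def)
qed

section \<open>Parameter derivatives of pulled-back forms\<close>

context form_family
begin

definition amat :: "('a, 'm) chart \<Rightarrow> 't \<times> (real^'m) \<Rightarrow> real^'m^'m" where
  "amat c z = (\<chi> i j. pb B \<omega> c \<Phi> (0, axis i 1) (0, axis j 1) z)"

text \<open>The contraction of the pull-back form on the product with a parameter direction.\<close>
definition gam :: "'t \<Rightarrow> ('a, 'm) chart \<Rightarrow> 't \<times> (real^'m) \<Rightarrow> real^'m" where
  "gam w c z = (\<chi> j. pb B \<omega> c \<Phi> (w, 0) (0, axis j 1) z)"

lemma linear_pb2:
  assumes c: "c \<in> A" and z: "z \<in> T \<times> chart_img c"
  shows "linear (\<lambda>v. pb B \<omega> c \<Phi> u v z)"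
proof -
  have "linear (\<lambda>v. - pb B \<omega> c \<Phi> v u z)" by (rule linear_compose_neg[OF linear_pb[OF c z]])
  then show ?thesis using pb_antisym[OF c z, of u] by simp
qed

lemma smooth_amat: "c \<in> A \<Longrightarrow> smooth_on (T \<times> chart_img c) (amat c)"
  unfolding amat_def[abs_def] by (intro smooth_on_vec open_img pb_smooth)

lemma smooth_gam: "c \<in> A \<Longrightarrow> smooth_on (T \<times> chart_img c) (gam w c)"
  unfolding gam_def[abs_def] by (intro smooth_on_vec open_img pb_smooth)

lemma gam_inner:
  assumes c: "c \<in> A" and z: "z \<in> T \<times> chart_img c"
  shows "gam w c z \<bullet> u = pb B \<omega> c \<Phi> (w, 0) (0, u) z"
proof -
  have l: "linear (\<lambda>u. pb B \<omega> c \<Phi> (w, 0) (0, u) z)"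
    using linear_compose[OF _ linear_pb2[OF c z], of "\<lambda>u. (0, u)" "(w, 0)"]
    by (simp add: o_def linear_iff)
  have "pb B \<omega> c \<Phi> (w, 0) (0, u) z = pb B \<omega> c \<Phi> (w, 0) (0, \<Sum>j\<in>UNIV. u $ j *\<^sub>R axis j 1) z"
    using basis_expansion[of u] by (simp add: scalar_mult_eq_scaleR)
  also have "\<dots> = (\<Sum>j\<in>UNIV. u $ j *\<^sub>R pb B \<omega> c \<Phi> (w, 0) (0, axis j 1) z)"
    unfolding linear_sum[OF l] linear_scale[OF l] ..
  finally show ?thesis by (simp add: gam_def inner_vec_def mult.commute)
qed

lemma gam_change:
  assumes c: "c \<in> A" "c' \<in> A" and p: "p \<in> chart_dom c" "p \<in> chart_dom c'" and t: "t \<in> T"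
  shows "gam w c (t, snd c p) \<bullet> u = gam w c' (t, snd c' p) \<bullet> transition_deriv c c' p u"
proof -
  have z: "(t, snd c p) \<in> T \<times> chart_img c" "(t, snd c' p) \<in> T \<times> chart_img c'" using t p by auto
  have "transition_deriv c c' p 0 = 0" by (rule linear_0[OF linear_transition_deriv[OF atlasA c p]])
  then show ?thesis
    unfolding gam_inner[OF c(1) z(1)] gam_inner[OF c(2) z(2)] pb_chart_change[OF c p t] by simp
qed

lemma smooth_slice:
  assumes c: "c \<in> A" and t: "t \<in> T" and f: "smooth_on (T \<times> chart_img c) f"
  shows "smooth_on (chart_img c) (\<lambda>x. f (t, x))"
  by (rule smooth_on_compose[OF open_chart_img[OF atlasA c] open_img[OF c] _ f])
    (auto intro!: smooth_on_Pair smooth_on_const smooth_on_id open_chart_img[OF atlasA c] simp: t)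

lemma one_form_gam:
  assumes t: "t \<in> T"
  shows "one_form A (\<lambda>c x. gam w c (t, x))"
  unfolding one_form_def
proof (intro conjI ballI allI)
  show "smooth_on (chart_img c) (\<lambda>x. gam w c (t, x))" if "c \<in> A" for c
    by (rule smooth_slice[OF that t smooth_gam[OF that]])
qed (rule gam_change, use t in auto)

text \<open>Transition maps do not depend on the parameter, so the covariance relation of
  \<open>gam\<close> may be differentiated in it. The result is a primitive of a second parameter
  derivative of the pull-back, hence the 1-form to which coclosedness is applied in the second
  variation.\<close>

lemma one_form_dd_gam:
  assumes t: "t \<in> T"
  shows "one_form A (\<lambda>c x. dd (gam w c) (w', 0) (t, x))"
  unfolding one_form_def
proof (intro conjI ballI allI)
  show "smooth_on (chart_img c) (\<lambda>x. dd (gam w c) (w', 0) (t, x))" if "c \<in> A" for c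
    by (rule smooth_slice[OF that t smooth_on_dd[OF smooth_gam[OF that]]])
  fix c c' p u assume c: "c \<in> A" "c' \<in> A" and p: "p \<in> chart_dom c \<inter> chart_dom c'"
  have *: "((\<lambda>s. gam w c (s, snd c p) \<bullet> u) has_derivative (\<lambda>h. dd (gam w c) (h, 0) (t, snd c p) \<bullet> u)) (at t)"
    if "c \<in> A" "p \<in> chart_dom c" for c u
  proof -
    have d: "gam w c differentiable (at (t, snd c p))"
      by (rule smooth_on_differentiable[OF smooth_gam[OF that(1)]]) (use t that in auto)
    have "((\<lambda>s. (s, snd c p)) has_derivative (\<lambda>h. (h, 0))) (at t)"
      by (intro has_derivative_Pair has_derivative_const has_derivative_ident)
    from diff_chain_at[OF this has_derivative_dd[OF d]]
    show ?thesis by (intro bounded_linear.has_derivative[OF bounded_linear_inner_left]) (simp add: o_def)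
  qed
  have "((\<lambda>s. gam w c (s, snd c p) \<bullet> u) has_derivative
      (\<lambda>h. dd (gam w c') (h, 0) (t, snd c' p) \<bullet> transition_deriv c c' p u)) (at t)"
  proof (rule has_derivative_transform_within_open[OF *[OF c(2)] open_T t])
    show "p \<in> chart_dom c'" using p by simp
    show "gam w c' (s, snd c' p) \<bullet> transition_deriv c c' p u = gam w c (s, snd c p) \<bullet> u" if "s \<in> T" for s
      by (rule gam_change[symmetric, OF c _ _ that]) (use p in auto)
  qed
  from has_derivative_unique[OF *[OF c(1)] this] p
  have "(\<lambda>h. dd (gam w c) (h, 0) (t, snd c p) \<bullet> u)
    = (\<lambda>h. dd (gam w c') (h, 0) (t, snd c' p) \<bullet> transition_deriv c c' p u)" by simp
  then show "dd (gam w c) (w', 0) (t, snd c p) \<bullet> u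
    = dd (gam w c') (w', 0) (t, snd c' p) \<bullet> transition_deriv c c' p u" by (rule fun_cong)
qed

lemma dd_amat_nth:
  assumes c: "c \<in> A" and z: "z \<in> T \<times> chart_img c"
  shows "dd (amat c) w z $ i $ j = dd (pb B \<omega> c \<Phi> (0, axis i 1) (0, axis j 1)) w z"
proof -
  have s: "smooth_on (T \<times> chart_img c) (\<lambda>z. amat c z $ i)" by (rule smooth_on_nth[OF open_img[OF c] smooth_amat[OF c]])
  have "dd (pb B \<omega> c \<Phi> (0, axis i 1) (0, axis j 1)) w z = dd (\<lambda>z. amat c z $ i $ j) w z" by (simp add: amat_def)
  also have "\<dots> = dd (\<lambda>z. amat c z $ i) w z $ j" by (rule dd_nth[OF smooth_on_differentiable[OF s z]])
  also have "\<dots> = dd (amat c) w z $ i $ j"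
    by (simp add: dd_nth[OF smooth_on_differentiable[OF smooth_amat[OF c] z]])
  finally show ?thesis ..
qed

lemma dd_gam_nth:
  assumes c: "c \<in> A" and z: "z \<in> T \<times> chart_img c"
  shows "dd (gam w c) v z $ j = dd (pb B \<omega> c \<Phi> (w, 0) (0, axis j 1)) v z"
  using dd_nth[OF smooth_on_differentiable[OF smooth_gam[OF c] z], of w j v] by (simp add: gam_def)

text \<open>Cartan's formula, obtained from closedness of the product form on \<open>(0, u)\<close>,
  \<open>(0, v)\<close> and \<open>(w, 0)\<close>. These are constant fields on the product, so no
  bracket terms occur.\<close>

lemma dd_pb_time:
  assumes c: "c \<in> A" and z: "z \<in> T \<times> chart_img c"
  shows "dd (pb B \<omega> c \<Phi> (0, u) (0, v)) (w, 0) z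
    = dd (pb B \<omega> c \<Phi> (w, 0) (0, v)) (0, u) z - dd (pb B \<omega> c \<Phi> (w, 0) (0, u)) (0, v) z"
proof -
  have "dd (pb B \<omega> c \<Phi> (0, v) (w, 0)) (0, u) z = dd (\<lambda>z. - pb B \<omega> c \<Phi> (w, 0) (0, v) z) (0, u) z"
    by (rule dd_cong_open[OF open_img[OF c] z pb_antisym[OF c] smooth_on_differentiable[OF pb_smooth[OF c] z]])
  also have "\<dots> = - dd (pb B \<omega> c \<Phi> (w, 0) (0, v)) (0, u) z"
    by (rule dd_linear_compose[OF bounded_linear_minus[OF bounded_linear_ident] smooth_on_differentiable[OF pb_smooth[OF c] z]])
  finally show ?thesis using pb_closed[OF c z, of "(0, u)" "(0, v)" "(w, 0)"] by simp
qed

lemma dd_amat_time: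
  assumes c: "c \<in> A" and t: "t \<in> T" and x: "x \<in> chart_img c"
  shows "dd (amat c) (w, 0) (t, x) = dform (\<lambda>c x. gam w c (t, x)) c x"
proof -
  have z: "(t, x) \<in> T \<times> chart_img c" using t x by simp
  have "dd (\<lambda>x. gam w c (t, x) $ j) v x = dd (pb B \<omega> c \<Phi> (w, 0) (0, axis j 1)) (0, v) (t, x)" for v j
    using dd_slice[OF smooth_on_differentiable[OF pb_smooth[OF c] z], of "(w, 0)" "(0, axis j 1)" v]
    by (simp add: gam_def)
  then show ?thesis
    by (simp add: vec_eq_iff dd_amat_nth[OF c z] dd_pb_time[OF c z] dform_def)
qed

text \<open>The second parameter derivative is moved past the spatial ones by
  \<open>dd_commute_real\<close>, so that it acts on the primitive \<open>gam\<close>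
  itself.\<close>

lemma dd_dd_amat_time:
  assumes c: "c \<in> A" and t: "t \<in> T" and x: "x \<in> chart_img c"
  shows "dd (dd (amat c) (w, 0)) (w', 0) (t, x) = dform (\<lambda>c x. dd (gam w c) (w', 0) (t, x)) c x"
proof -
  have z: "(t, x) \<in> T \<times> chart_img c" using t x by simp
  note op = open_img[OF c]
  let ?p = "\<lambda>u v. pb B \<omega> c \<Phi> u v"
  have sm: "smooth_on (T \<times> chart_img c) (?p u v)" for u v by (rule pb_smooth[OF c])
  have sa: "smooth_on (T \<times> chart_img c) (dd (amat c) (w, 0))" by (rule smooth_on_dd[OF smooth_amat[OF c]])
  have 1: "dd (dd (amat c) (w, 0)) (w', 0) (t, x) $ i $ j
    = dd (dd (?p (w, 0) (0, axis j 1)) (w', 0)) (0, axis i 1) (t, x)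
      - dd (dd (?p (w, 0) (0, axis i 1)) (w', 0)) (0, axis j 1) (t, x)" for i j
  proof -
    have "dd (dd (amat c) (w, 0)) (w', 0) (t, x) $ i $ j = dd (\<lambda>z. dd (amat c) (w, 0) z $ i $ j) (w', 0) (t, x)"
      by (simp add: dd_nth[OF smooth_on_differentiable[OF smooth_on_nth[OF op sa] z]] dd_nth[OF smooth_on_differentiable[OF sa z]])
    also have "\<dots> = dd (\<lambda>z. dd (?p (w, 0) (0, axis j 1)) (0, axis i 1) z - dd (?p (w, 0) (0, axis i 1)) (0, axis j 1) z) (w', 0) (t, x)"
    proof (rule dd_cong_open[OF op z])
      show "dd (amat c) (w, 0) y $ i $ j
          = dd (?p (w, 0) (0, axis j 1)) (0, axis i 1) y - dd (?p (w, 0) (0, axis i 1)) (0, axis j 1) y"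
        if "y \<in> T \<times> chart_img c" for y
        unfolding dd_amat_nth[OF c that] by (rule dd_pb_time[OF c that])
      show "(\<lambda>z. dd (amat c) (w, 0) z $ i $ j) differentiable (at (t, x))"
        by (rule smooth_on_differentiable[OF smooth_on_nth[OF op smooth_on_nth[OF op sa]] z])
    qed
    also have "\<dots> = dd (dd (?p (w, 0) (0, axis j 1)) (0, axis i 1)) (w', 0) (t, x)
        - dd (dd (?p (w, 0) (0, axis i 1)) (0, axis j 1)) (w', 0) (t, x)"
      by (rule dd_eqI) (intro has_derivative_diff smooth_on_has_derivative[OF smooth_on_dd[OF sm] z])
    also have "\<dots> = dd (dd (?p (w, 0) (0, axis j 1)) (w', 0)) (0, axis i 1) (t, x)
        - dd (dd (?p (w, 0) (0, axis i 1)) (w', 0)) (0, axis j 1) (t, x)"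
      unfolding dd_commute_real[OF op z sm, of _ _ "(0, axis i 1)" "(w', 0)"]
        dd_commute_real[OF op z sm, of _ _ "(0, axis j 1)" "(w', 0)"] ..
    finally show ?thesis .
  qed
  have 2: "dd (\<lambda>x. dd (gam w c) (w', 0) (t, x) $ j) v x = dd (dd (?p (w, 0) (0, axis j 1)) (w', 0)) (0, v) (t, x)" for v j
  proof -
    have "dd (\<lambda>x. dd (gam w c) (w', 0) (t, x) $ j) v x = dd (\<lambda>x. dd (?p (w, 0) (0, axis j 1)) (w', 0) (t, x)) v x"
    proof (rule dd_cong_open[OF open_chart_img[OF atlasA c] x])
      show "dd (gam w c) (w', 0) (t, y) $ j = dd (?p (w, 0) (0, axis j 1)) (w', 0) (t, y)" if "y \<in> chart_img c" for y
        by (rule dd_gam_nth[OF c]) (use t that in simp)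
      show "(\<lambda>x. dd (gam w c) (w', 0) (t, x) $ j) differentiable (at x)"
        by (rule smooth_on_differentiable[OF smooth_on_nth[OF open_chart_img[OF atlasA c] smooth_slice[OF c t smooth_on_dd[OF smooth_gam[OF c]]]] x])
    qed
    also have "\<dots> = dd (dd (?p (w, 0) (0, axis j 1)) (w', 0)) (0, v) (t, x)"
      by (rule dd_slice[OF smooth_on_differentiable[OF smooth_on_dd[OF sm] z]])
    finally show ?thesis .
  qed
  show ?thesis by (simp add: vec_eq_iff 1 dform_def 2)
qed

lemma loc_time_derivative:
  assumes c: "c \<in> A" and d: "d \<in> B" and p: "p \<in> chart_dom c" and t: "t \<in> T" "\<Phi> t p \<in> chart_dom d"
  shows "((\<lambda>r. snd d (\<Phi> (t + r *\<^sub>R w) p)) has_vector_derivative dd (loc c d \<Phi>) (w, 0) (t, snd c p)) (at 0)"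
proof -
  have df: "loc c d \<Phi> differentiable (at (t + 0 *\<^sub>R w, snd c p))"
    using loc_differentiable[OF c d loc_dom_chart[OF c p t]] by simp
  have "((\<lambda>r. (t + r *\<^sub>R w, snd c p)) has_derivative (\<lambda>h. (h *\<^sub>R w, 0))) (at 0)"
    by (auto intro!: derivative_eq_intros)
  from diff_chain_at[OF this has_derivative_dd[OF df]]
  have "((\<lambda>r. snd d (\<Phi> (t + r *\<^sub>R w) p)) has_derivative (\<lambda>h. dd (loc c d \<Phi>) (h *\<^sub>R w, 0) (t, snd c p))) (at 0)"
    by (simp add: o_def loc_def chart_inv_chart[OF atlasA c p])
  moreover have "dd (loc c d \<Phi>) (h *\<^sub>R w, 0) (t, snd c p) = h *\<^sub>R dd (loc c d \<Phi>) (w, 0) (t, snd c p)" for h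
    using linear_scale[OF linear_dd[OF df], of h "(w, 0)"] by simp
  ultimately show ?thesis by (simp add: has_vector_derivative_def)
qed

lemma velocity_eq:
  assumes c: "c \<in> A" and d: "d \<in> B" and p: "p \<in> chart_dom c" and t: "0 \<in> T" "\<Phi> 0 p \<in> chart_dom d"
  shows "velocity B (\<lambda>r. \<Phi> (r *\<^sub>R w) p) d = dd (loc c d \<Phi>) (w, 0) (0, snd c p)"
  using vector_derivative_at[OF loc_time_derivative[OF assms, of w]] d t
  by (simp add: velocity_def o_def)

text \<open>At parameter 0 the 1-form \<open>gam\<close> depends on the family only through the map
  and its velocity field. This has two uses: equal velocities give equal \<open>gam\<close>, and a
  prescribed 1-form is reached by prescribing a velocity.\<close>

lemma gam_velocity:
  assumes c: "c \<in> A" and d: "d \<in> B" and p: "p \<in> chart_dom c" and t: "0 \<in> T" "\<Phi> 0 p \<in> chart_dom d"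
  shows "gam w c (0, snd c p) \<bullet> u = local_rep B \<omega> d (snd d (\<Phi> 0 p)) (velocity B (\<lambda>r. \<Phi> (r *\<^sub>R w) p) d)
    (dd (\<lambda>x. snd d (\<Phi> 0 (chart_inv c x))) u (snd c p))"
proof -
  have z: "(0, snd c p) \<in> loc_dom c d T \<Phi>" by (rule loc_dom_chart[OF c p t])
  show ?thesis
    unfolding gam_inner[OF c loc_domD(1)[OF z]] pb_eq[OF c d z] velocity_eq[OF c d p t]
      dd_eqI[OF dd_loc_space[OF c d z]]
    by (simp add: loc_def chart_inv_chart[OF atlasA c p])
qed

end

section \<open>First and second variation of the energy\<close>

locale energy_setting = riemannian A g F \<rho> + closed_form B \<omega>
  for A :: "('a::t2_space, 'm::finite) chart set" and g F \<rho>
    and B :: "('b::t2_space, 'n::finite) chart set" and \<omega>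
begin

definition E :: "('a \<Rightarrow> 'b) \<Rightarrow> real" where
  "E \<phi> = 1 / 2 * volume_integral A g (two_form_inner A g (pullback_form A B \<phi> \<omega>) (pullback_form A B \<phi> \<omega>))"

abbreviation "pm \<phi> \<equiv> tmat A (pullback_form A B \<phi> \<omega>)"

text \<open>The weak form of a vanishing codifferential: L^2-orthogonality to all exact 2-forms.
  This is the form in which the variation formulas use it and in which criticality delivers
  it.\<close>

definition coclosed :: "('a \<Rightarrow> 'b) \<Rightarrow> bool" where
  "coclosed \<phi> \<longleftrightarrow> (\<forall>\<eta>. one_form A \<eta> \<longrightarrow> pairing (pm \<phi>) (dform \<eta>) = 0)"

lemma form_familyI: "open T \<Longrightarrow> smooth_family A B T \<Phi> \<Longrightarrow> form_family B \<omega> A T \<Phi>"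
  by (intro form_family.intro closed_form_axioms form_family_axioms.intro atlasA)

lemma amat_eq:
  assumes "form_family B \<omega> A T \<Phi>" "t \<in> T" "c \<in> A" "x \<in> chart_img c"
  shows "form_family.amat B \<omega> \<Phi> c (t, x) = pm (\<Phi> t) c x"
  by (simp add: form_family.amat_def[OF assms(1)] tmat_def form_family.pullback_local_rep[OF assms(1,3,2,4)])

text \<open>Turns the energy into a quadratic form in the pulled-back coefficients. Bilinearity of
  the pull-back comes first, since eliminating the frame by \<open>two_form_inner_eq\<close> depends
  on it.\<close>

lemma E_eq:
  fixes T :: "'t::euclidean_space set"
  assumes ff: "form_family B \<omega> A T \<Phi>" and t: "t \<in> T"
  shows "E (\<Phi> t) = 1 / 2 * pairing (pm (\<Phi> t)) (pm (\<Phi> t))"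
proof -
  interpret form_family B \<omega> A T \<Phi> by (rule ff)
  let ?\<alpha> = "pullback_form A B (\<Phi> t) \<omega>"
  have bil: "bilinear (local_rep A ?\<alpha> c x)" if c: "c \<in> A" and x: "x \<in> chart_img c" for c x
  proof -
    have z: "(t, x) \<in> T \<times> chart_img c" using t x by simp
    have e: "local_rep A ?\<alpha> c x = (\<lambda>u v. pb B \<omega> c \<Phi> (0, u) (0, v) (t, x))"
      by (intro ext pullback_local_rep[OF c t x])
    have l: "linear (\<lambda>u::real^'m. (0::'t, u))" by (simp add: linear_iff)
    show ?thesis unfolding e bilinear_def
      using linear_compose[OF l linear_pb[OF c z]] linear_compose[OF l linear_pb2[OF c z]] by (simp add: o_def)
  qed
  have "volume_integral A g (two_form_inner A g ?\<alpha> ?\<alpha>)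
    = (\<Sum>c\<in>F. integral (chart_img c) (\<lambda>x. \<rho> c (chart_inv c x) * two_form_inner A g ?\<alpha> ?\<alpha> (chart_inv c x) * volume_coeff A g c x))"
    unfolding volume_integral_def partition_choice by simp
  also have "\<dots> = pairing (pm (\<Phi> t)) (pm (\<Phi> t))"
    unfolding pairing_def
  proof (intro sum.cong refl Henstock_Kurzweil_Integration.integral_cong)
    fix c x assume "c \<in> F" and x: "x \<in> chart_img c"
    then have c: "c \<in> A" by (simp add: F_A)
    show "\<rho> c (chart_inv c x) * two_form_inner A g ?\<alpha> ?\<alpha> (chart_inv c x) * volume_coeff A g c x
      = weight c x * form_inner (gi c x) (pm (\<Phi> t) c x) (pm (\<Phi> t) c x)"
      unfolding two_form_inner_eq[OF c x bil[OF c x] bil[OF c x]] weight_def by simp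
  qed
  finally show ?thesis by (simp add: E_def)
qed

lemma first_variation:
  assumes ff: "form_family B \<omega> A T \<Phi>" and t: "t \<in> T"
  shows "((\<lambda>r. E (\<Phi> (t + r *\<^sub>R w))) has_real_derivative
    pairing (\<lambda>c x. form_family.amat B \<omega> \<Phi> c (t, x)) (\<lambda>c x. dd (form_family.amat B \<omega> \<Phi> c) (w, 0) (t, x))) (at 0)"
proof -
  interpret form_family B \<omega> A T \<Phi> by (rule ff)
  have "((\<lambda>r. pairing (\<lambda>c x. amat c (t + r *\<^sub>R w, x)) (\<lambda>c x. amat c (t + r *\<^sub>R w, x))) has_real_derivative
     pairing (\<lambda>c x. amat c (t, x)) (\<lambda>c x. dd (amat c) (w, 0) (t, x))
     + pairing (\<lambda>c x. dd (amat c) (w, 0) (t, x)) (\<lambda>c x. amat c (t, x))) (at 0)"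
    by (rule pairing_derivative[OF open_T t smooth_amat smooth_amat])
  \<comment> \<open>The factor 1/2 absorbs the two equal terms of the product rule.\<close>
  from DERIV_cmult[OF this, of "1 / 2"]
  have d: "((\<lambda>r. 1 / 2 * pairing (\<lambda>c x. amat c (t + r *\<^sub>R w, x)) (\<lambda>c x. amat c (t + r *\<^sub>R w, x))) has_real_derivative
     pairing (\<lambda>c x. amat c (t, x)) (\<lambda>c x. dd (amat c) (w, 0) (t, x))) (at 0)"
    unfolding pairing_sym[of "\<lambda>c x. dd (amat c) (w, 0) (t, x)"] by simp
  let ?R = "(\<lambda>r. t + r *\<^sub>R w) -` T"
  show ?thesis
  proof (rule has_field_derivative_transform_within_open[OF d])
    show "open ?R" by (rule open_vimage[OF open_T]) (intro continuous_intros)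
    show "0 \<in> ?R" using t by simp
    fix r assume "r \<in> ?R"
    then have r: "t + r *\<^sub>R w \<in> T" by simp
    show "1 / 2 * pairing (\<lambda>c x. amat c (t + r *\<^sub>R w, x)) (\<lambda>c x. amat c (t + r *\<^sub>R w, x)) = E (\<Phi> (t + r *\<^sub>R w))"
      unfolding E_eq[OF ff r] by (intro arg_cong2[where f = "(*)"] refl pairing_cong amat_eq[OF ff r])
  qed
qed

lemma first_variation_one_form:
  assumes ff: "form_family B \<omega> A T \<Phi>" and t: "t \<in> T"
  shows "((\<lambda>r. E (\<Phi> (t + r *\<^sub>R w))) has_real_derivative
    pairing (pm (\<Phi> t)) (dform (\<lambda>c x. form_family.gam B \<omega> \<Phi> w c (t, x)))) (at 0)"
proof -
  interpret form_family B \<omega> A T \<Phi> by (rule ff)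
  have "pairing (\<lambda>c x. amat c (t, x)) (\<lambda>c x. dd (amat c) (w, 0) (t, x))
    = pairing (pm (\<Phi> t)) (dform (\<lambda>c x. gam w c (t, x)))"
    by (intro pairing_cong amat_eq[OF ff t] dd_amat_time t)
  then show ?thesis using first_variation[OF ff t, of w] by simp
qed

lemma coclosed_critical:
  assumes cc: "coclosed \<phi>" and v: "variation A B \<phi> \<Phi>"
  shows "((\<lambda>t. E (\<Phi> t)) has_real_derivative 0) (at 0)"
proof -
  obtain \<epsilon> where \<epsilon>: "\<epsilon> > 0" "smooth_family A B {-\<epsilon><..<\<epsilon>} \<Phi>" and \<Phi>0: "\<Phi> 0 = \<phi>"
    using v by (auto simp: variation_def)
  have ff: "form_family B \<omega> A {-\<epsilon><..<\<epsilon>} \<Phi>" by (rule form_familyI[OF _ \<epsilon>(2)]) simp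
  have 0: "(0::real) \<in> {-\<epsilon><..<\<epsilon>}" using \<epsilon> by simp
  interpret form_family B \<omega> A "{-\<epsilon><..<\<epsilon>}" \<Phi> by (rule ff)
  have "pairing (pm \<phi>) (dform (\<lambda>c x. gam 1 c (0, x))) = 0"
    using cc one_form_gam[OF 0] by (simp add: coclosed_def)
  then show ?thesis using first_variation_one_form[OF ff 0, of 1] by (simp add: \<Phi>0)
qed

text \<open>With \<open>a\<close> the pull-back, the derivative of <a, d_t a> in \<open>s\<close> is
  <a, d_s d_t a> + <d_s a, d_t a>. The first term pairs a coclosed form with an exact one; the
  second is a square because both velocity fields equal \<open>X\<close>. The bound holds for every
  such variation, hence for whichever one \<open>hessian\<close> selects.\<close>

lemma coclosed_hessian_nonneg:
  assumes cc: "coclosed \<phi>" and v: "variation2 A B \<phi> X X \<Phi>"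
  shows "deriv (\<lambda>s. deriv (\<lambda>t. E (\<Phi> (s, t))) 0) 0 \<ge> 0"
proof -
  obtain \<epsilon> where \<epsilon>: "\<epsilon> > 0" "smooth_family A B ({-\<epsilon><..<\<epsilon>} \<times> {-\<epsilon><..<\<epsilon>}) \<Phi>" and \<Phi>0: "\<Phi> (0, 0) = \<phi>"
    and X: "\<And>p. velocity B (\<lambda>t. \<Phi> (0, t) p) = X p" "\<And>p. velocity B (\<lambda>s. \<Phi> (s, 0) p) = X p"
    using v by (auto simp: variation2_def)
  let ?T = "{-\<epsilon><..<\<epsilon>} \<times> {-\<epsilon><..<\<epsilon>}"
  have oT: "open ?T" by (intro open_Times) auto
  have ff: "form_family B \<omega> A ?T \<Phi>" by (rule form_familyI[OF oT \<epsilon>(2)])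
  interpret form_family B \<omega> A ?T \<Phi> by (rule ff)
  have 0: "0 \<in> ?T" using \<epsilon> by (simp add: zero_prod_def)
  let ?a = "amat" and ?b = "\<lambda>c. dd (amat c) ((0, 1), 0)"
  \<comment> \<open>The inner derivative is needed for all small \<open>s\<close>, since it is
    differentiated once more; away from 0 the map need not be critical, so the full first variation
    is kept.\<close>
  have inner: "deriv (\<lambda>t. E (\<Phi> (s, t))) 0 = pairing (\<lambda>c x. amat c ((s, 0), x)) (\<lambda>c x. ?b c ((s, 0), x))"
    if s: "s \<in> {-\<epsilon><..<\<epsilon>}" for s
    using first_variation[OF ff, of "(s, 0)" "(0, 1)"] s \<epsilon>(1) by (intro DERIV_imp_deriv) simp
  have "((\<lambda>r. pairing (\<lambda>c x. amat c (0 + r *\<^sub>R (1, 0), x)) (\<lambda>c x. ?b c (0 + r *\<^sub>R (1, 0), x))) has_real_derivative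
     pairing (\<lambda>c x. amat c (0, x)) (\<lambda>c x. dd (?b c) ((1, 0), 0) (0, x))
     + pairing (\<lambda>c x. dd (amat c) ((1, 0), 0) (0, x)) (\<lambda>c x. ?b c (0, x))) (at 0)"
    by (rule pairing_derivative[OF oT 0 smooth_amat smooth_on_dd[OF smooth_amat]])
  also have "pairing (\<lambda>c x. amat c (0, x)) (\<lambda>c x. dd (?b c) ((1, 0), 0) (0, x))
     = pairing (pm \<phi>) (dform (\<lambda>c x. dd (gam (0, 1) c) ((1, 0), 0) (0, x)))"
    using amat_eq[OF ff 0] \<Phi>0 by (intro pairing_cong dd_dd_amat_time 0) (simp add: zero_prod_def)
  also have "\<dots> = 0" using cc one_form_dd_gam[OF 0] by (simp add: coclosed_def)
  also have "pairing (\<lambda>c x. dd (amat c) ((1, 0), 0) (0, x)) (\<lambda>c x. ?b c (0, x))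
     = pairing (\<lambda>c x. ?b c (0, x)) (\<lambda>c x. ?b c (0, x))"
  proof (rule pairing_cong[OF _ refl])
    fix c x assume c: "c \<in> A" and x: "x \<in> chart_img c"
    \<comment> \<open>Both parameter directions have velocity \<open>X\<close>, hence the same
      contraction, hence the same first derivative of the pull-back.\<close>
    have eq: "gam (1, 0) c (0, y) = gam (0, 1) c (0, y)" if y: "y \<in> chart_img c" for y
    proof (rule vector_eq_ldot[THEN iffD1], rule allI)
      fix u
      define p where "p = chart_inv c y"
      have p: "p \<in> chart_dom c" "y = snd c p" unfolding p_def using chart_inv_in[OF y] chart_chart_inv[OF y] by auto
      obtain d where d: "d \<in> B" "\<Phi> 0 p \<in> chart_dom d" using atlas_cover[OF atlas] by blast
      have "velocity B (\<lambda>r. \<Phi> (r *\<^sub>R (1, 0)) p) = velocity B (\<lambda>r. \<Phi> (r *\<^sub>R (0, 1)) p)"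
        using X[of p] by simp
      then have "gam (1, 0) c (0, y) \<bullet> u = gam (0, 1) c (0, y) \<bullet> u"
        unfolding p(2) gam_velocity[OF c d(1) p(1) 0 d(2)] by simp
      then show "u \<bullet> gam (1, 0) c (0, y) = u \<bullet> gam (0, 1) c (0, y)" by (simp add: inner_commute)
    qed
    show "dd (amat c) ((1, 0), 0) (0, x) = ?b c (0, x)"
      unfolding dd_amat_time[OF c 0 x]
      by (rule dform_cong[where \<eta> = "\<lambda>c x. gam (1, 0) c (0, x)" and \<eta>' = "\<lambda>c x. gam (0, 1) c (0, x)",
            OF atlasA c x smooth_slice[OF c 0 smooth_gam[OF c]] eq])
  qed
  finally have "((\<lambda>r. pairing (\<lambda>c x. amat c ((r, 0), x)) (\<lambda>c x. ?b c ((r, 0), x))) has_real_derivative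
     pairing (\<lambda>c x. ?b c (0, x)) (\<lambda>c x. ?b c (0, x))) (at 0)" by simp
  then have "((\<lambda>s. deriv (\<lambda>t. E (\<Phi> (s, t))) 0) has_real_derivative
     pairing (\<lambda>c x. ?b c (0, x)) (\<lambda>c x. ?b c (0, x))) (at 0)"
    by (rule has_field_derivative_transform_within_open[where S = "{-\<epsilon><..<\<epsilon>}"]) (use \<epsilon> inner in auto)
  then have "deriv (\<lambda>s. deriv (\<lambda>t. E (\<Phi> (s, t))) 0) 0 = pairing (\<lambda>c x. ?b c (0, x)) (\<lambda>c x. ?b c (0, x))"
    by (rule DERIV_imp_deriv)
  also have "\<dots> \<ge> 0"
    by (intro pairing_nonneg smooth_on_continuous smooth_slice[OF _ 0] smooth_on_dd smooth_amat)
  finally show ?thesis .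
qed

end

section \<open>Construction of variations\<close>

text \<open>Lets statements about families be applied to a single map, and provides the start for
  the construction of variations.\<close>

lemma smooth_map_family:
  fixes A :: "('a::t2_space, 'm::finite) chart set" and B :: "('b::t2_space, 'n::finite) chart set"
    and T :: "'t::euclidean_space set"
  assumes A: "smooth_atlas A" and B: "smooth_atlas B" and \<phi>: "smooth_map A B \<phi>" and T: "open T"
  shows "smooth_family A B T (\<lambda>_. \<phi>)"
  unfolding smooth_family_def
proof (intro conjI ballI)
  have c: "continuous_on UNIV \<phi>" using \<phi> by (simp add: smooth_map_def)
  have "continuous_on (T \<times> UNIV) (\<lambda>z. \<phi> (snd z))"
    by (rule continuous_on_compose2[OF c continuous_on_snd[OF continuous_on_id]]) auto
  then show "continuous_on (T \<times> UNIV) (\<lambda>(t, p). \<phi> p)" by (simp add: split_def)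
  fix c d assume c: "c \<in> A" and d: "d \<in> B"
  let ?N = "{x \<in> chart_img c. \<phi> (chart_inv c x) \<in> chart_dom d}"
  have "open (\<phi> -` chart_dom d)"
    using \<phi> open_chart_dom[OF B d] by (auto simp: smooth_map_def intro: open_vimage)
  from open_chart_preimage[OF A c this] have N: "open ?N" by simp
  have sm: "smooth_on ?N (snd d \<circ> \<phi> \<circ> chart_inv c)" using \<phi> c d by (simp add: smooth_map_def)
  have "smooth_on (T \<times> ?N) (\<lambda>z. (snd d \<circ> \<phi> \<circ> chart_inv c) (snd z))"
    by (rule smooth_on_compose[OF open_Times[OF T N] N smooth_on_snd sm]) auto
  moreover have "{(t, x). t \<in> T \<and> x \<in> chart_img c \<and> \<phi> (chart_inv c x) \<in> chart_dom d} = T \<times> ?N" by auto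
  ultimately show "smooth_on {(t, x). t \<in> T \<and> x \<in> chart_img c \<and> \<phi> (chart_inv c x) \<in> chart_dom d}
      (\<lambda>(t, x). snd d (\<phi> (chart_inv c x)))"
    by (simp add: split_def o_def)
qed

context energy_setting
begin

text \<open>Adding \<open>t Z\<close> in a chart of the target moves the family in the direction \<open>Z\<close>; composing such steps
  produces variations with a prescribed velocity without using an exponential map.\<close>
lemma push_variation:
  fixes \<psi> :: "real \<Rightarrow> 'a \<Rightarrow> 'b" and Z :: "'a \<Rightarrow> real^'n"
  assumes \<epsilon>: "\<epsilon> > 0" and fam: "smooth_family A B {-\<epsilon><..<\<epsilon>} \<psi>" and d: "d \<in> B"
    and K: "compact K" and KD: "\<forall>p\<in>K. \<psi> 0 p \<in> chart_dom d"
    and Z: "smooth_vfun A Z" and Z0: "\<forall>p. p \<notin> K \<longrightarrow> Z p = 0"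
  shows "\<exists>\<epsilon>'>0. \<exists>\<psi>'. smooth_family A B {-\<epsilon>'<..<\<epsilon>'} \<psi>' \<and> \<psi>' 0 = \<psi> 0 \<and> (\<forall>p. p \<notin> K \<longrightarrow> (\<forall>t. \<psi>' t p = \<psi> t p)) \<and>
    (\<forall>p\<in>K. \<forall>e\<in>B. \<psi> 0 p \<in> chart_dom e \<longrightarrow>
      velocity B (\<lambda>t. \<psi>' t p) e = velocity B (\<lambda>t. \<psi> t p) e + transition_deriv d e (\<psi> 0 p) (Z p))"
proof -
  note K = K KD[rule_format] and Z = Z Z0[rule_format]
  let ?T = "{-\<epsilon><..<\<epsilon>}"
  have oT: "open ?T" by simp
  interpret form_family B \<omega> A ?T \<psi> by (rule form_familyI[OF oT fam])
  have c\<psi>: "continuous_on (?T \<times> UNIV) (\<lambda>z. \<psi> (fst z) (snd z))"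
    using fam by (simp add: smooth_family_def split_def)
  \<comment> \<open>The pushed family read in the chart \<open>d\<close>. It makes sense where
    \<open>\<psi>\<close> lies in the chart domain (\<open>G0\<close>), and \<open>G\<close> is the
    part where the result has not left the chart image.\<close>
  define f where "f z = snd d (\<psi> (fst z) (snd z)) + fst z *\<^sub>R Z (snd z)" for z
  define G0 where "G0 = (?T \<times> UNIV) \<inter> (\<lambda>z. \<psi> (fst z) (snd z)) -` chart_dom d"
  have oG0: "open G0" unfolding G0_def
    by (rule continuous_open_preimage[OF c\<psi> open_Times[OF oT open_UNIV] open_chart_dom[OF atlas d]])
  have cf: "continuous_on G0 f" unfolding f_def
  proof (intro continuous_on_add continuous_on_scaleR continuous_on_fst continuous_on_id)
    have c\<psi>0: "continuous_on G0 (\<lambda>z. \<psi> (fst z) (snd z))"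
      by (rule continuous_on_subset[OF c\<psi>]) (auto simp: G0_def)
    show "continuous_on G0 (\<lambda>z. snd d (\<psi> (fst z) (snd z)))"
      by (rule continuous_on_compose2[OF continuous_on_chart[OF atlas d] c\<psi>0]) (auto simp: G0_def)
    show "continuous_on G0 (\<lambda>z. Z (snd z))"
      by (rule continuous_on_compose2[OF smooth_vfun_continuous[OF atlasA Z(1)] continuous_on_snd[OF continuous_on_id]]) auto
  qed
  define G where "G = G0 \<inter> f -` chart_img d"
  have oG: "open G" unfolding G_def by (rule continuous_open_preimage[OF cf oG0 open_chart_img[OF atlas d]])
  have "{0} \<times> K \<subseteq> G"
    using K(2) \<epsilon> chart_in[of _ d] by (auto simp: G_def G0_def f_def)
  \<comment> \<open>Compactness of \<open>K\<close> gives one time interval during which no point of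
    \<open>K\<close> leaves the chart.\<close>
  from Elementary_Topology.tube_lemma[OF K(1) oG this]
  obtain X0 where X0: "0 \<in> X0" "open X0" "X0 \<times> K \<subseteq> G" by (elim exE conjE) (rule that)
  have "open (X0 \<inter> ?T)" "0 \<in> X0 \<inter> ?T" using X0 \<epsilon> by auto
  then obtain \<epsilon>' where \<epsilon>': "\<epsilon>' > 0" "ball 0 \<epsilon>' \<subseteq> X0 \<inter> ?T" by (rule openE)
  define T' where "T' = {-\<epsilon>'<..<\<epsilon>'}"
  have T': "T' \<subseteq> X0" "T' \<subseteq> ?T" "open T'" "0 \<in> T'"
    using \<epsilon>' by (auto simp: T'_def subset_eq dist_real_def)
  define \<psi>' where "\<psi>' t p = (if p \<in> K then chart_inv d (f (t, p)) else \<psi> t p)" for t p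
  have GD: "\<psi> t p \<in> chart_dom d" "f (t, p) \<in> chart_img d" if "(t, p) \<in> G" for t p
    using that by (simp_all add: G_def G0_def)
  \<comment> \<open>On all of \<open>G\<close>, also off \<open>K\<close>, the new family is given
    by the chart expression, because \<open>Z\<close> vanishes off \<open>K\<close>. The two
    branches thus agree on an open set around the boundary of \<open>K\<close>, and continuity and
    smoothness pass across it.\<close>
  have eqG: "\<psi>' t p = chart_inv d (f (t, p))" if "(t, p) \<in> G" for t p
    using GD[OF that] Z(2)[of p] by (simp add: \<psi>'_def f_def chart_inv_chart[OF atlas d])
  have TK: "(t, p) \<in> G" if "t \<in> T'" "p \<in> K" for t p using that T'(1) X0(3) by auto
  have 0: "\<psi>' 0 = \<psi> 0"
    using K(2) by (auto simp: fun_eq_iff \<psi>'_def f_def chart_inv_chart[OF atlas d])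
  have "continuous_on ((G \<inter> (T' \<times> UNIV)) \<union> (T' \<times> (- K))) (\<lambda>z. \<psi>' (fst z) (snd z))"
  proof (rule continuous_on_open_Un)
    show "open (G \<inter> (T' \<times> UNIV))" "open (T' \<times> (- K))"
      using oG T' compact_imp_closed[OF K(1)] by (auto intro!: open_Int open_Times)
    have "continuous_on G (\<lambda>z. chart_inv d (f z))"
      by (rule continuous_on_compose2[OF continuous_on_chart_inv[OF atlas d] continuous_on_subset[OF cf]])
        (auto simp: G_def)
    then have "continuous_on (G \<inter> (T' \<times> UNIV)) (\<lambda>z. chart_inv d (f z))" by (rule continuous_on_subset) auto
    then show "continuous_on (G \<inter> (T' \<times> UNIV)) (\<lambda>z. \<psi>' (fst z) (snd z))"
      by (rule continuous_on_eq) (use eqG in auto)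
    have "continuous_on (T' \<times> (- K)) (\<lambda>z. \<psi> (fst z) (snd z))"
      by (rule continuous_on_subset[OF c\<psi>]) (use T' in auto)
    then show "continuous_on (T' \<times> (- K)) (\<lambda>z. \<psi>' (fst z) (snd z))"
      by (rule continuous_on_eq) (auto simp: \<psi>'_def)
  qed
  moreover have "(G \<inter> (T' \<times> UNIV)) \<union> (T' \<times> (- K)) = T' \<times> UNIV" using TK by auto
  ultimately have cont: "continuous_on (T' \<times> UNIV) (\<lambda>(t, p). \<psi>' t p)" by (simp add: split_def)
  have sm: "smooth_on {(t, x). t \<in> T' \<and> x \<in> chart_img c \<and> \<psi>' t (chart_inv c x) \<in> chart_dom e}
        (\<lambda>(t, x). snd e (\<psi>' t (chart_inv c x)))" (is "smooth_on ?S ?F") if c: "c \<in> A" and e: "e \<in> B" for c e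
  proof -
    let ?L = "loc_dom c d ?T \<psi> \<inter> (T' \<times> UNIV)"
    define f1 where "f1 z = loc c d \<psi> z + fst z *\<^sub>R Z (chart_inv c (snd z))" for z
    let ?V = "{y \<in> chart_img d. chart_inv d y \<in> chart_dom e}"
    have oL: "open ?L" by (intro open_Int open_loc_dom[OF c d] open_Times T' open_UNIV)
    have oV: "open ?V" by (rule open_chart_preimage[OF atlas d open_chart_dom[OF atlas e]])
    have sZ: "smooth_on ?L (\<lambda>z. Z (chart_inv c (snd z)))"
      by (rule smooth_on_compose[OF oL open_chart_img[OF atlasA c] smooth_on_snd smooth_vfun_chart[OF Z(1) c]])
        (auto simp: loc_dom_def)
    have sf1: "smooth_on ?L f1" unfolding f1_def[abs_def]
      by (intro smooth_on_add smooth_on_scaleR smooth_on_fst sZ oL smooth_on_subset[OF loc_smooth[OF c d]]) auto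
    let ?S1 = "?L \<inter> f1 -` ?V"
    have oS1: "open ?S1" by (rule continuous_open_preimage[OF smooth_on_continuous[OF sf1] oL oV])
    have "smooth_on ?S1 (\<lambda>z. (snd e \<circ> chart_inv d) (f1 z))"
      by (rule smooth_on_compose[OF oS1 oV smooth_on_subset[OF sf1] smooth_transition[OF atlas d e]]) auto
    then have s1: "smooth_on ?S1 ?F"
    proof (rule smooth_on_cong[OF oS1])
      fix z assume z: "z \<in> ?S1"
      have f1: "f1 z = f (fst z, chart_inv c (snd z))" by (simp add: f1_def f_def loc_def split_def)
      have "(fst z, chart_inv c (snd z)) \<in> G"
        using z T' f1 by (auto simp: G_def G0_def loc_dom_def)
      from eqG[OF this] show "(snd e \<circ> chart_inv d) (f1 z) = ?F z" by (simp add: f1 split_def)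
    qed
    \<comment> \<open>\<open>?S1\<close> takes care of the points over \<open>K\<close>, where the
      chart expression is available, and \<open>?S2\<close> of those over the open complement of
      \<open>K\<close>, where nothing has changed.\<close>
    let ?S2 = "loc_dom c e ?T \<psi> \<inter> (T' \<times> {x \<in> chart_img c. chart_inv c x \<in> - K})"
    have oS2: "open ?S2"
      by (intro open_Int open_loc_dom[OF c e] open_Times T' open_chart_preimage[OF atlasA c] open_Compl compact_imp_closed K(1))
    have "smooth_on ?S2 (loc c e \<psi>)" by (rule smooth_on_subset[OF loc_smooth[OF c e]]) auto
    then have s2: "smooth_on ?S2 ?F"
      by (rule smooth_on_cong[OF oS2]) (auto simp: loc_def \<psi>'_def)
    have "?S \<subseteq> ?S1 \<union> ?S2"
    proof
      fix z assume z: "z \<in> ?S"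
      obtain t x where tx: "z = (t, x)" by (rule prod.exhaust)
      with z have t: "t \<in> T'" and x: "x \<in> chart_img c" and m: "\<psi>' t (chart_inv c x) \<in> chart_dom e" by auto
      show "z \<in> ?S1 \<union> ?S2"
      proof (cases "chart_inv c x \<in> K")
        case True
        note g = TK[OF t True]
        have f1: "f1 z = f (t, chart_inv c x)" by (simp add: f1_def f_def loc_def tx)
        have "z \<in> ?L" using t x T' GD(1)[OF g] by (auto simp: tx loc_dom_def)
        moreover have "f1 z \<in> ?V" using GD(2)[OF g] m eqG[OF g] by (simp add: f1)
        ultimately show ?thesis by simp
      next
        case False
        then have "z \<in> ?S2" using t x m T' by (auto simp: tx loc_dom_def \<psi>'_def)
        then show ?thesis by simp
      qed
    qed
    then show ?thesis by (rule smooth_on_subset[OF smooth_on_Un[OF oS1 oS2 s1 s2]])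
  qed
  \<comment> \<open>In the chart \<open>d\<close> the velocity is shifted by \<open>Z p\<close>;
    linearity of the transition derivative carries the shift to every other chart.\<close>
  have vel: "velocity B (\<lambda>t. \<psi>' t p) e = velocity B (\<lambda>t. \<psi> t p) e + transition_deriv d e (\<psi> 0 p) (Z p)"
    if p: "p \<in> K" and e: "e \<in> B" "\<psi> 0 p \<in> chart_dom e" for p e
  proof -
    obtain c where c: "c \<in> A" "p \<in> chart_dom c" using atlas_cover[OF atlasA] by blast
    note q = K(2)[OF p]
    have t0: "0 \<in> ?T" using \<epsilon> by simp
    let ?vd = "dd (loc c d \<psi>) (1, 0) (0, snd c p)" and ?ve = "dd (loc c e \<psi>) (1, 0) (0, snd c p)"
    have vd: "((\<lambda>r. snd d (\<psi> r p)) has_vector_derivative ?vd) (at 0)"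
      using loc_time_derivative[OF c(1) d c(2) t0 q, of 1] by simp
    have ve: "velocity B (\<lambda>t. \<psi> t p) e = ?ve" using velocity_eq[OF c(1) e(1) c(2) t0 e(2), of 1] by simp
    have tr: "?ve = transition_deriv d e (\<psi> 0 p) ?vd"
      using dd_loc_change[OF c(1) d e(1) loc_dom_chart[OF c t0 q] loc_dom_chart[OF c t0 e(2)], of "(1, 0)"]
      by (simp add: chart_inv_chart[OF atlasA c])
    have "((\<lambda>r. snd d (\<psi> r p) + r *\<^sub>R Z p) has_vector_derivative ?vd + 1 *\<^sub>R Z p) (at 0)"
      by (intro has_vector_derivative_add vd) (auto intro!: derivative_eq_intros)
    then have h: "((\<lambda>r. f (r, p)) has_derivative (\<lambda>s. s *\<^sub>R (?vd + Z p))) (at 0)"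
      by (simp add: f_def has_vector_derivative_def)
    have "((snd e \<circ> chart_inv d) has_derivative transition_deriv d e (\<psi> 0 p)) (at (f (0, p)))"
      unfolding transition_deriv_def f_def
      using has_derivative_dd[OF transition_differentiable[OF atlas d e(1) q e(2)]] by simp
    from diff_chain_at[OF h this]
    have "((\<lambda>r. snd e (chart_inv d (f (r, p)))) has_derivative (\<lambda>s. transition_deriv d e (\<psi> 0 p) (s *\<^sub>R (?vd + Z p)))) (at 0)"
      by (simp add: o_def)
    then have "((\<lambda>r. snd e (chart_inv d (f (r, p)))) has_vector_derivative transition_deriv d e (\<psi> 0 p) (?vd + Z p)) (at 0)"
      by (simp add: has_vector_derivative_def linear_scale[OF linear_transition_deriv[OF atlas d e(1) q e(2)]])
    then have "((\<lambda>r. snd e (\<psi>' r p)) has_vector_derivative transition_deriv d e (\<psi> 0 p) (?vd + Z p)) (at 0)"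
      by (rule has_vector_derivative_transform_within_open[OF _ T'(3,4)]) (use p in \<open>simp add: \<psi>'_def\<close>)
    from vector_derivative_at[OF this]
    have "velocity B (\<lambda>t. \<psi>' t p) e = transition_deriv d e (\<psi> 0 p) (?vd + Z p)"
      using e 0 by (simp add: velocity_def o_def)
    then show ?thesis
      by (simp add: ve tr linear_add[OF linear_transition_deriv[OF atlas d e(1) q e(2)]])
  qed
  have "smooth_family A B {-\<epsilon>'<..<\<epsilon>'} \<psi>'"
    unfolding smooth_family_def T'_def[symmetric] using cont sm by simp
  then show ?thesis
    using \<epsilon>'(1) 0 vel by (intro exI[of _ \<epsilon>'] exI[of _ \<psi>'] conjI) (auto simp: \<psi>'_def)
qed

lemma velocity_const: "velocity B (\<lambda>t. q) = (\<lambda>_. 0)"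
  by (auto simp: velocity_def fun_eq_iff o_def)

text \<open>\<open>X\<close> is cut by a partition of unity into pieces
  \<open>\<xi> i p *\<^sub>R X p\<close>, each supported over one target chart, and these are pushed
  one after another. A push keeps the map at time 0 and adds to the velocity, so the induction
  maintains that the velocity is a partial sum of the \<open>\<xi> i\<close> times
  \<open>X\<close>.\<close>

lemma variation_with_velocity_exists:
  assumes \<phi>: "smooth_map A B \<phi>" and X: "X \<in> sections_along A B \<phi>"
  shows "\<exists>\<epsilon>>0. \<exists>\<psi>. smooth_family A B {-\<epsilon><..<\<epsilon>::real} \<psi> \<and> \<psi> 0 = \<phi> \<and> (\<forall>p. velocity B (\<lambda>t. \<psi> t p) = X p)"
proof -
  have XT: "X p \<in> tangent_space B (\<phi> p)" for p using X by (simp add: sections_along_def)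
  have Xs: "smooth_on {x \<in> chart_img c. \<phi> (chart_inv c x) \<in> chart_dom d} (\<lambda>x. X (chart_inv c x) d)"
    if "c \<in> A" "d \<in> B" for c d using X that by (simp add: sections_along_def)
  have oV: "open (\<phi> -` chart_dom d)" if "d \<in> B" for d
    using \<phi> open_chart_dom[OF atlas that] by (auto simp: smooth_map_def intro: open_vimage)
  have "\<exists>(I :: 'a set) \<xi>. finite I \<and> (\<forall>i\<in>I. smooth_fun A (\<xi> i) \<and> (\<forall>p. 0 \<le> \<xi> i p) \<and>
      (\<exists>U\<in>(\<lambda>d. \<phi> -` chart_dom d) ` B. \<exists>K. compact K \<and> K \<subseteq> U \<and> (\<forall>p. p \<notin> K \<longrightarrow> \<xi> i p = 0))) \<and> (\<forall>p. (\<Sum>i\<in>I. \<xi> i p) = 1)"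
  proof (rule subordinate_partition_exists[OF atlasA cpt])
    show "open U" if "U \<in> (\<lambda>d. \<phi> -` chart_dom d) ` B" for U using that oV by auto
    show "\<Union> ((\<lambda>d. \<phi> -` chart_dom d) ` B) = UNIV" using atlas_cover[OF atlas] by auto
  qed
  then obtain I :: "'a set" and \<xi> where I: "finite I" "\<forall>i\<in>I. smooth_fun A (\<xi> i) \<and> (\<forall>p. 0 \<le> \<xi> i p) \<and>
      (\<exists>U\<in>(\<lambda>d. \<phi> -` chart_dom d) ` B. \<exists>K. compact K \<and> K \<subseteq> U \<and> (\<forall>p. p \<notin> K \<longrightarrow> \<xi> i p = 0))" "\<forall>p. (\<Sum>i\<in>I. \<xi> i p) = 1"
    by (elim exE conjE) (rule that)
  have "\<exists>\<epsilon>>0. \<exists>\<psi>. smooth_family A B {-\<epsilon><..<\<epsilon>::real} \<psi> \<and> \<psi> 0 = \<phi> \<and>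
      (\<forall>p. \<forall>e\<in>B. \<phi> p \<in> chart_dom e \<longrightarrow> velocity B (\<lambda>t. \<psi> t p) e = (\<Sum>i\<in>J. \<xi> i p) *\<^sub>R X p e)" if "J \<subseteq> I" for J
    using finite_subset[OF that I(1)] that
  proof (induction J rule: finite_induct)
    case empty
    have "smooth_family A B {-1<..<1::real} (\<lambda>_. \<phi>)" by (rule smooth_map_family[OF atlasA atlas \<phi>]) simp
    then show ?case by (intro exI[of _ 1] conjI exI[of _ "\<lambda>_. \<phi>"]) (simp_all add: velocity_const)
  next
    case (insert i J)
    then obtain \<epsilon> \<psi> where \<epsilon>: "\<epsilon> > 0" "smooth_family A B {-\<epsilon><..<\<epsilon>::real} \<psi>" "\<psi> 0 = \<phi>"
      and vel: "\<forall>p. \<forall>e\<in>B. \<phi> p \<in> chart_dom e \<longrightarrow> velocity B (\<lambda>t. \<psi> t p) e = (\<Sum>i\<in>J. \<xi> i p) *\<^sub>R X p e"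
      by auto
    have i: "i \<in> I" using insert.prems by simp
    from I(2) i have \<xi>: "smooth_fun A (\<xi> i)" by blast
    from I(2) i have "\<exists>U\<in>(\<lambda>d. \<phi> -` chart_dom d) ` B. \<exists>K. compact K \<and> K \<subseteq> U \<and> (\<forall>p. p \<notin> K \<longrightarrow> \<xi> i p = 0)" by blast
    then obtain d K where d: "d \<in> B" and K: "compact K" "K \<subseteq> \<phi> -` chart_dom d" "\<forall>p. p \<notin> K \<longrightarrow> \<xi> i p = 0"
      by (elim bexE imageE exE conjE) (rule that, assumption, assumption, simp, assumption)
    define Z where "Z p = \<xi> i p *\<^sub>R X p d" for p
    have sZ: "smooth_vfun A Z"
    proof (rule smooth_vfun_extend_by_0[OF atlasA oV[OF d] compact_imp_closed[OF K(1)] K(2)])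
      show "Z p = 0" if "p \<notin> K" for p using K(3) that by (simp add: Z_def)
      fix c assume c: "c \<in> A"
      show "smooth_on {x \<in> chart_img c. chart_inv c x \<in> \<phi> -` chart_dom d} (\<lambda>x. Z (chart_inv c x))"
        unfolding Z_def
      proof (rule smooth_on_scaleR[OF open_chart_preimage[OF atlasA c oV[OF d]]])
        show "smooth_on {x \<in> chart_img c. chart_inv c x \<in> \<phi> -` chart_dom d} (\<lambda>x. \<xi> i (chart_inv c x))"
          by (rule smooth_on_subset[OF smooth_vfun_chart[OF _ c]]) (use \<xi> in \<open>auto simp: smooth_fun_iff_vfun\<close>)
        show "smooth_on {x \<in> chart_img c. chart_inv c x \<in> \<phi> -` chart_dom d} (\<lambda>x. X (chart_inv c x) d)"
          using Xs[OF c d] by simp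
      qed
    qed
    have KD: "\<forall>p\<in>K. \<psi> 0 p \<in> chart_dom d" using K(2) \<epsilon>(3) by auto
    have Z0: "\<forall>p. p \<notin> K \<longrightarrow> Z p = 0" using K(3) by (simp add: Z_def)
    from push_variation[OF \<epsilon>(1,2) d K(1) KD sZ Z0]
    obtain \<epsilon>' \<psi>' where \<epsilon>': "\<epsilon>' > 0" "smooth_family A B {-\<epsilon>'<..<\<epsilon>'} \<psi>'" "\<psi>' 0 = \<psi> 0"
      and out: "\<forall>p. p \<notin> K \<longrightarrow> (\<forall>t. \<psi>' t p = \<psi> t p)"
      and vel': "\<forall>p\<in>K. \<forall>e\<in>B. \<psi> 0 p \<in> chart_dom e \<longrightarrow>
        velocity B (\<lambda>t. \<psi>' t p) e = velocity B (\<lambda>t. \<psi> t p) e + transition_deriv d e (\<psi> 0 p) (Z p)"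
      by (elim exE conjE) (rule that)
    have "velocity B (\<lambda>t. \<psi>' t p) e = (\<Sum>i\<in>insert i J. \<xi> i p) *\<^sub>R X p e" if e: "e \<in> B" "\<phi> p \<in> chart_dom e" for p e
    proof (cases "p \<in> K")
      case True
      then have q: "\<phi> p \<in> chart_dom d" using K(2) by auto
      have "transition_deriv d e (\<phi> p) (Z p) = \<xi> i p *\<^sub>R X p e"
        unfolding Z_def linear_scale[OF linear_transition_deriv[OF atlas d e(1) q e(2)]]
          tangent_vec_transition[OF XT d e(1) q e(2), symmetric] ..
      then show ?thesis
        using vel'[rule_format, OF True e(1)] vel[rule_format, OF e] e(2) insert.hyps
        by (simp add: \<epsilon>(3) scaleR_add_left)
    next
      case False
      then have "(\<lambda>t. \<psi>' t p) = (\<lambda>t. \<psi> t p)" "\<xi> i p = 0" using out K(3) by auto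
      then show ?thesis using vel[rule_format, OF e] insert.hyps by simp
    qed
    then show ?case using \<epsilon>' \<epsilon>(3)
      by (intro exI[of _ \<epsilon>'] conjI exI[of _ \<psi>'] allI ballI impI) (simp_all del: sum.insert)
  qed
  from this[OF subset_refl] obtain \<epsilon> \<psi> where \<epsilon>: "\<epsilon> > 0" "smooth_family A B {-\<epsilon><..<\<epsilon>::real} \<psi>" "\<psi> 0 = \<phi>"
      and vel: "\<forall>p. \<forall>e\<in>B. \<phi> p \<in> chart_dom e \<longrightarrow> velocity B (\<lambda>t. \<psi> t p) e = (\<Sum>i\<in>I. \<xi> i p) *\<^sub>R X p e"
    by (elim exE conjE) (rule that)
  have "velocity B (\<lambda>t. \<psi> t p) e = X p e" for p e
  proof (cases "e \<in> B \<and> \<phi> p \<in> chart_dom e")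
    case True
    then show ?thesis using vel[rule_format, of e p] I(3) by simp
  next
    \<comment> \<open>Outside the charts around the point both sides are 0 by convention.\<close>
    case False
    then show ?thesis using tangent_vec_outside[OF XT False] \<epsilon>(3) by (auto simp: velocity_def)
  qed
  then have "\<forall>p. velocity B (\<lambda>t. \<psi> t p) = X p" by (intro allI ext)
  then show ?thesis using \<epsilon> by (intro exI[of _ \<epsilon>] conjI exI[of _ \<psi>])
qed

text \<open>A one-parameter variation evaluated at \<open>s + t\<close> has velocity
  \<open>X\<close> in both directions. Its existence is what gives meaning to the choice in
  \<open>hessian\<close>.\<close>

lemma variation2_exists:
  assumes \<phi>: "smooth_map A B \<phi>" and X: "X \<in> sections_along A B \<phi>"
  shows "\<exists>\<Phi>. variation2 A B \<phi> X X \<Phi>"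
proof -
  obtain \<epsilon> \<psi> where \<epsilon>: "\<epsilon> > 0" "smooth_family A B {-\<epsilon><..<\<epsilon>::real} \<psi>" "\<psi> 0 = \<phi>" "\<forall>p. velocity B (\<lambda>t. \<psi> t p) = X p"
    using variation_with_velocity_exists[OF assms] by (elim exE conjE) (rule that)
  \<comment> \<open>Halving keeps \<open>s + t\<close> inside the original interval.\<close>
  let ?T = "{-(\<epsilon>/2)<..<\<epsilon>/2} \<times> {-(\<epsilon>/2)<..<\<epsilon>/2}"
  have oT: "open ?T" by (intro open_Times) auto
  let ?\<Phi> = "\<lambda>(s, t). \<psi> (s + t)"
  interpret form_family B \<omega> A "{-\<epsilon><..<\<epsilon>}" \<psi> by (rule form_familyI[OF _ \<epsilon>(2)]) simp
  have sum: "fst w + snd w \<in> {-\<epsilon><..<\<epsilon>}" if "w \<in> ?T" for w using that by auto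
  have "smooth_family A B ?T ?\<Phi>"
    unfolding smooth_family_def
  proof (intro conjI ballI)
    have c: "continuous_on ({-\<epsilon><..<\<epsilon>} \<times> UNIV) (\<lambda>(t, p). \<psi> t p)" using \<epsilon>(2) by (simp add: smooth_family_def)
    have "continuous_on (?T \<times> UNIV) (\<lambda>z. (\<lambda>(t, p). \<psi> t p) (fst (fst z) + snd (fst z), snd z))"
      by (rule continuous_on_compose2[OF c])
        (use sum in \<open>auto intro!: continuous_on_Pair continuous_on_add continuous_on_fst continuous_on_snd continuous_on_id\<close>)
    then show "continuous_on (?T \<times> UNIV) (\<lambda>(t, p). ?\<Phi> t p)" by (simp add: split_def)
    fix c d assume c: "c \<in> A" and d: "d \<in> B"
    let ?S = "{(w, x). w \<in> ?T \<and> x \<in> chart_img c \<and> ?\<Phi> w (chart_inv c x) \<in> chart_dom d}"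
    let ?k = "\<lambda>z. (fst (fst z) + snd (fst z), snd z)"
    have bl: "bounded_linear ?k"
      by (intro bounded_linear_Pair bounded_linear_add bounded_linear_compose[OF bounded_linear_fst bounded_linear_fst]
          bounded_linear_compose[OF bounded_linear_snd bounded_linear_fst] bounded_linear_snd)
    have S: "?S = (?T \<times> UNIV) \<inter> ?k -` loc_dom c d {-\<epsilon><..<\<epsilon>} \<psi>"
      by (auto simp: loc_dom_def)
    have oS: "open ?S" unfolding S
      by (intro open_Int open_Times oT open_UNIV open_vimage open_loc_dom[OF c d] linear_continuous_on[OF bl])
    have "smooth_on ?S (\<lambda>z. loc c d \<psi> (?k z))"
      by (rule smooth_on_compose[OF oS open_loc_dom[OF c d] smooth_on_linear[OF bl] loc_smooth[OF c d]]) (simp add: S)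
    then show "smooth_on ?S (\<lambda>(w, x). snd d (?\<Phi> w (chart_inv c x)))"
      by (simp add: loc_def split_def)
  qed
  then show ?thesis
    unfolding variation2_def using \<epsilon> by (intro exI[of _ ?\<Phi>] conjI exI[of _ "\<epsilon>/2"]) auto
qed

text \<open>At each \<open>x\<close> the unknown \<open>Y\<close> solves a possibly underdetermined
  linear system \<open>R Y = \<eta>\<close>. Injectivity of the differential and nondegeneracy of
  \<open>\<omega>\<close> give \<open>R\<close> full row rank, so \<open>R R^T\<close> is invertible
  and \<open>Y = R^T (R R^T)^{-1} \<eta>\<close> is a solution that depends smoothly on
  \<open>x\<close>.\<close>

lemma local_contraction_exists:
  assumes nd: "\<forall>d\<in>B. \<forall>y\<in>chart_img d. \<forall>u. (\<forall>v. local_rep B \<omega> d y v u = 0) \<longrightarrow> u = 0"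
    and \<phi>: "immersion A B \<phi>" and c: "c \<in> A" and d: "d \<in> B"
    and V: "open V" "V \<subseteq> chart_dom c" "\<phi> ` V \<subseteq> chart_dom d" and \<eta>: "smooth_on (chart_img c) \<eta>"
  defines "N \<equiv> {x \<in> chart_img c. chart_inv c x \<in> V}"
  shows "\<exists>Y. smooth_on N Y \<and> (\<forall>x\<in>N. \<forall>j. local_rep B \<omega> d (snd d (\<phi> (chart_inv c x))) (Y x)
    (dd (\<lambda>x. snd d (\<phi> (chart_inv c x))) (axis j 1) x) = \<eta> x $ j)"
proof -
  have \<phi>s: "smooth_map A B \<phi>" using \<phi> by (simp add: immersion_def)
  let ?y = "\<lambda>x. snd d (\<phi> (chart_inv c x))"
  have N: "open N" unfolding N_def by (rule open_chart_preimage[OF atlasA c V(1)])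
  have ND: "x \<in> chart_img c" "chart_inv c x \<in> V" "\<phi> (chart_inv c x) \<in> chart_dom d" "?y x \<in> chart_img d"
    if "x \<in> N" for x using that V(3) unfolding N_def by auto
  have sy: "smooth_on N ?y"
    using \<phi>s c d unfolding smooth_map_def o_def by (auto intro: smooth_on_subset dest: ND)
  define R where "R x = (\<chi> j k. local_rep B \<omega> d (?y x) (axis k 1) (dd ?y (axis j 1) x))" for x
  have sR: "smooth_on N (\<lambda>x. R x $ j $ k)" for j k
    unfolding R_def vec_lambda_beta
    by (rule smooth_on_bilinear_field[OF open_chart_img[OF atlas d] bilinear[OF d] smooth[OF d] N ND(4) sy
          smooth_on_const smooth_on_dd[OF sy]])
  define M where "M x = R x ** transpose (R x)" for x
  have sM: "smooth_on N (\<lambda>x. M x $ i $ j)" for i j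
    unfolding M_def matrix_matrix_mult_def transpose_def vec_lambda_beta
    by (intro smooth_on_sum smooth_on_mult sR N)
  have inv: "invertible (M x)" if x: "x \<in> N" for x
  proof -
    let ?p = "chart_inv c x"
    have p: "?p \<in> chart_dom c" "snd c ?p = x" using ND(2)[OF x] V(2) chart_chart_inv[OF ND(1)[OF x]] by auto
    have ly: "linear (\<lambda>u. dd ?y u x)" by (rule linear_dd[OF smooth_on_differentiable[OF sy x]])
    \<comment> \<open>The immersion hypothesis speaks of abstract tangent vectors; the constant
      family translates it to the coordinate derivative.\<close>
    have inj: "u = 0" if u: "dd ?y u x = 0" for u
    proof -
      interpret form_family B \<omega> A "UNIV :: real set" "\<lambda>_. \<phi>"
        by (rule form_familyI[OF open_UNIV smooth_map_family[OF atlasA atlas \<phi>s open_UNIV]])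
      have z: "(0::real, x) \<in> loc_dom c d UNIV (\<lambda>_. \<phi>)" using ND[OF x] by (simp add: loc_dom_def)
      have dc: "differential A B \<phi> ?p (coord_vec A c ?p u) = coord_vec B d (\<phi> ?p) (dd ?y u x)" for u
        using differential_coord_vec[OF c d p(1) UNIV_I ND(3)[OF x], where t = "0::real" and u = u]
          dd_eqI[OF dd_loc_space[OF c d z], of u] by (simp add: p(2))
      have "differential A B \<phi> ?p (coord_vec A c ?p u) = differential A B \<phi> ?p (coord_vec A c ?p 0)"
        unfolding dc u linear_0[OF ly] ..
      moreover have "inj_on (differential A B \<phi> ?p) (tangent_space A ?p)" using \<phi> by (simp add: immersion_def)
      ultimately have "coord_vec A c ?p u = coord_vec A c ?p 0"
        using coord_vec_in_tangent_space[OF atlasA c p(1)] by (auto dest: inj_onD)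
      from fun_cong[OF this, of c] show ?thesis by (simp add: coord_vec_self[OF atlasA c p(1)])
    qed
    \<comment> \<open>A kernel vector satisfies \<open>|R^T u|^2 = u . M u = 0\<close>. Then the
      image of \<open>u\<close> under the differential pairs to zero with every vector, so it
      vanishes by nondegeneracy, and \<open>u\<close> vanishes by injectivity.\<close>
    have "u = 0" if u: "M x *v u = 0" for u
    proof -
      have "(u v* R x) \<bullet> (u v* R x) = u \<bullet> (R x *v (transpose (R x) *v u))"
        unfolding dot_lmul_matrix transpose_matrix_vector ..
      also have "\<dots> = 0" using u unfolding M_def matrix_vector_mul_assoc by (simp only: inner_zero_right)
      finally have w: "u v* R x = 0" by simp
      have "local_rep B \<omega> d (?y x) v (dd ?y u x) = 0" for v
      proof -
        have l: "linear (local_rep B \<omega> d (?y x) v)" for v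
          using bilinear[OF d ND(4)[OF x]] by (simp add: bilinear_def)
        have l': "linear (\<lambda>v. local_rep B \<omega> d (?y x) v w)" for w
          using bilinear[OF d ND(4)[OF x]] by (simp add: bilinear_def)
        have 1: "local_rep B \<omega> d (?y x) (axis k 1) (dd ?y u x) = 0" for k
        proof -
          have "dd ?y u x = dd ?y (\<Sum>j\<in>UNIV. u $ j *\<^sub>R axis j 1) x"
            using basis_expansion[of u] by (simp add: scalar_mult_eq_scaleR)
          also have "\<dots> = (\<Sum>j\<in>UNIV. u $ j *\<^sub>R dd ?y (axis j 1) x)"
            unfolding linear_sum[OF ly] linear_scale[OF ly] ..
          finally have "local_rep B \<omega> d (?y x) (axis k 1) (dd ?y u x)
              = (\<Sum>j\<in>UNIV. u $ j *\<^sub>R local_rep B \<omega> d (?y x) (axis k 1) (dd ?y (axis j 1) x))"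
            by (simp add: linear_sum[OF l] linear_scale[OF l])
          also have "\<dots> = (u v* R x) $ k" by (simp add: vector_matrix_mult_def R_def mult.commute)
          finally show ?thesis by (simp add: w)
        qed
        have "local_rep B \<omega> d (?y x) v (dd ?y u x)
          = local_rep B \<omega> d (?y x) (\<Sum>k\<in>UNIV. v $ k *\<^sub>R axis k 1) (dd ?y u x)"
          using basis_expansion[of v] by (simp add: scalar_mult_eq_scaleR)
        also have "\<dots> = 0" by (simp add: linear_sum[OF l'] linear_scale[OF l'] 1)
        finally show ?thesis .
      qed
      then have "dd ?y u x = 0" by (rule nd[rule_format, OF d ND(4)[OF x]])
      then show ?thesis by (rule inj)
    qed
    then show ?thesis unfolding invertible_left_inverse matrix_left_invertible_ker by blast
  qed
  define q where "q x = matrix_inv (M x) *v \<eta> x" for x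
  have Mq: "M x *v q x = \<eta> x" if "x \<in> N" for x
    by (simp add: q_def matrix_vector_mul_assoc matrix_inv_works(1)[OF inv[OF that]])
  have s\<eta>: "smooth_on N \<eta>" by (rule smooth_on_subset[OF \<eta>]) (auto simp: N_def)
  have sq: "smooth_on N q"
    by (rule smooth_on_linear_solve[OF N sM smooth_on_nth[OF N s\<eta>] _ Mq])
      (use inv in \<open>auto simp: invertible_det_nz\<close>)
  define Y where "Y x = transpose (R x) *v q x" for x
  have "smooth_on N (\<lambda>x. \<chi> k. \<Sum>j\<in>UNIV. R x $ j $ k * q x $ j)"
    by (intro smooth_on_vec smooth_on_sum smooth_on_mult sR smooth_on_nth sq N)
  then have sY: "smooth_on N Y"
    by (rule smooth_on_cong[OF N]) (simp add: Y_def matrix_vector_mult_def transpose_def)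
  have "local_rep B \<omega> d (?y x) (Y x) (dd ?y (axis j 1) x) = \<eta> x $ j" if x: "x \<in> N" for x j
  proof -
    have l': "linear (\<lambda>v. local_rep B \<omega> d (?y x) v w)" for w
      using bilinear[OF d ND(4)[OF x]] by (simp add: bilinear_def)
    have "local_rep B \<omega> d (?y x) (Y x) (dd ?y (axis j 1) x)
        = local_rep B \<omega> d (?y x) (\<Sum>k\<in>UNIV. Y x $ k *\<^sub>R axis k 1) (dd ?y (axis j 1) x)"
      using basis_expansion[of "Y x"] by (simp add: scalar_mult_eq_scaleR)
    also have "\<dots> = (\<Sum>k\<in>UNIV. Y x $ k * R x $ j $ k)"
      by (simp add: linear_sum[OF l'] linear_scale[OF l'] R_def)
    also have "\<dots> = (R x *v Y x) $ j" by (simp add: matrix_vector_mult_def mult.commute)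
    also have "R x *v Y x = \<eta> x" using Mq[OF x] unfolding Y_def M_def matrix_vector_mul_assoc .
    finally show ?thesis .
  qed
  then show ?thesis using sY by (intro exI[of _ Y]) auto
qed

text \<open>Criticality tests the pull-back only against contractions that come from variations.
  Each cut-off piece of \<open>\<eta>\<close> is of this kind: the local solution \<open>Y\<close>
  is multiplied by \<open>\<xi> i\<close>, extended by zero and used as the direction of a push. The
  pieces add up to \<open>\<eta>\<close>.\<close>

lemma critical_immersion_coclosed:
  assumes nd: "\<forall>d\<in>B. \<forall>y\<in>chart_img d. \<forall>u. (\<forall>v. local_rep B \<omega> d y v u = 0) \<longrightarrow> u = 0"
    and \<phi>: "immersion A B \<phi>"
    and crit: "\<And>\<Phi>. variation A B \<phi> \<Phi> \<Longrightarrow> ((\<lambda>t. E (\<Phi> t)) has_real_derivative 0) (at 0)"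
  shows "coclosed \<phi>"
  unfolding coclosed_def
proof (intro allI impI)
  fix \<eta> assume \<eta>: "one_form A \<eta>"
  have \<phi>s: "smooth_map A B \<phi>" using \<phi> by (simp add: immersion_def)
  \<comment> \<open>Each piece has to live in one source chart, where \<open>Y\<close> is solved
    for, and over one target chart, where the push takes place.\<close>
  let ?U = "\<lambda>(c, d). chart_dom c \<inter> \<phi> -` chart_dom d"
  have oU: "open (?U (c, d))" if "c \<in> A" "d \<in> B" for c d
    using \<phi>s open_chart_dom[OF atlas that(2)] open_chart_dom[OF atlasA that(1)]
    by (auto simp: smooth_map_def intro: open_vimage)
  have "\<exists>(I :: 'a set) \<xi>. finite I \<and> (\<forall>i\<in>I. smooth_fun A (\<xi> i) \<and> (\<forall>p. 0 \<le> \<xi> i p) \<and>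
      (\<exists>U\<in>?U ` (A \<times> B). \<exists>K. compact K \<and> K \<subseteq> U \<and> (\<forall>p. p \<notin> K \<longrightarrow> \<xi> i p = 0))) \<and> (\<forall>p. (\<Sum>i\<in>I. \<xi> i p) = 1)"
  proof (rule subordinate_partition_exists[OF atlasA cpt])
    show "open U" if "U \<in> ?U ` (A \<times> B)" for U using that oU by auto
    show "\<Union> (?U ` (A \<times> B)) = UNIV"
    proof (rule UNIV_eq_I[symmetric])
      fix p
      obtain c d where "c \<in> A" "p \<in> chart_dom c" "d \<in> B" "\<phi> p \<in> chart_dom d"
        using atlas_cover[OF atlas, of "\<phi> p"] atlas_cover[OF atlasA, of p] by auto
      then show "p \<in> \<Union> (?U ` (A \<times> B))" by (intro UnionI[of "?U (c, d)"] imageI) auto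
    qed
  qed
  then obtain I :: "'a set" and \<xi> where I: "finite I" "\<forall>i\<in>I. smooth_fun A (\<xi> i) \<and> (\<forall>p. 0 \<le> \<xi> i p) \<and>
      (\<exists>U\<in>?U ` (A \<times> B). \<exists>K. compact K \<and> K \<subseteq> U \<and> (\<forall>p. p \<notin> K \<longrightarrow> \<xi> i p = 0))" "\<forall>p. (\<Sum>i\<in>I. \<xi> i p) = 1"
    by (elim exE conjE) (rule that)
  define \<eta>' where "\<eta>' i c x = \<xi> i (chart_inv c x) *\<^sub>R \<eta> c x" for i c x
  have s\<xi>: "smooth_on (chart_img c) (\<lambda>x. \<xi> i (chart_inv c x))" if "i \<in> I" "c \<in> A" for i c
    using I(2) that by (auto simp: smooth_fun_iff_vfun intro: smooth_vfun_chart)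
  have s\<eta>': "smooth_on (chart_img c) (\<eta>' i c)" if "i \<in> I" "c \<in> A" for i c
    unfolding \<eta>'_def[abs_def]
    by (rule smooth_on_scaleR[OF open_chart_img[OF atlasA that(2)] s\<xi>[OF that] one_form_smooth[OF \<eta> that(2)]])
  have zero: "pairing (pm \<phi>) (dform (\<eta>' i)) = 0" if i: "i \<in> I" for i
  proof -
    from I(2) i have \<xi>: "smooth_fun A (\<xi> i)" by blast
    from I(2) i have "\<exists>U\<in>?U ` (A \<times> B). \<exists>K. compact K \<and> K \<subseteq> U \<and> (\<forall>p. p \<notin> K \<longrightarrow> \<xi> i p = 0)" by blast
    then obtain c0 d K where c0: "c0 \<in> A" and d: "d \<in> B"
      and K: "compact K" "K \<subseteq> ?U (c0, d)" "\<forall>p. p \<notin> K \<longrightarrow> \<xi> i p = 0"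
      by (elim bexE imageE SigmaE exE conjE) (rule that, assumption, assumption, assumption, simp, assumption)
    define V where "V = ?U (c0, d)"
    have oV: "open V" unfolding V_def by (rule oU[OF c0 d])
    have V: "V \<subseteq> chart_dom c0" "\<phi> ` V \<subseteq> chart_dom d" by (auto simp: V_def)
    let ?N = "{x \<in> chart_img c0. chart_inv c0 x \<in> V}"
    from local_contraction_exists[OF nd \<phi> c0 d oV V one_form_smooth[OF \<eta> c0]]
    obtain Y where sY: "smooth_on ?N Y" and Y: "\<And>x j. x \<in> ?N \<Longrightarrow> local_rep B \<omega> d (snd d (\<phi> (chart_inv c0 x))) (Y x)
        (dd (\<lambda>x. snd d (\<phi> (chart_inv c0 x))) (axis j 1) x) = \<eta> c0 x $ j" by blast
    \<comment> \<open>\<open>Y\<close> is meaningful on \<open>V\<close> only; the cut-off function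
      vanishes outside a compact subset of \<open>V\<close>, so the extension by zero is
      smooth.\<close>
    define Z where "Z p = (if p \<in> V then \<xi> i p *\<^sub>R Y (snd c0 p) else 0)" for p
    have Z0: "Z p = 0" if "p \<notin> K" for p using K(3) that by (simp add: Z_def)
    have sZ: "smooth_vfun A Z"
    proof (rule smooth_vfun_extend_by_0_chart[OF atlasA c0 oV V(1) compact_imp_closed[OF K(1)] _ Z0])
      show "K \<subseteq> V" using K(2) by (simp add: V_def)
      have oN: "open ?N" by (rule open_chart_preimage[OF atlasA c0 oV])
      have "smooth_on ?N (\<lambda>x. \<xi> i (chart_inv c0 x) *\<^sub>R Y x)"
        by (rule smooth_on_scaleR[OF oN smooth_on_subset[OF s\<xi>[OF i c0]] sY]) auto
      then show "smooth_on ?N (\<lambda>x. Z (chart_inv c0 x))"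
        by (rule smooth_on_cong[OF oN]) (auto simp: Z_def chart_chart_inv)
    qed
    have KD: "\<forall>p\<in>K. (\<lambda>_::real. \<phi>) 0 p \<in> chart_dom d" using K(2) by auto
    have Z0': "\<forall>p. p \<notin> K \<longrightarrow> Z p = 0" using Z0 by simp
    have fam: "smooth_family A B {-1<..<1::real} (\<lambda>_. \<phi>)" by (rule smooth_map_family[OF atlasA atlas \<phi>s]) simp
    from push_variation[OF zero_less_one fam d K(1) KD sZ Z0']
    obtain \<epsilon> \<Phi> where \<epsilon>: "\<epsilon> > 0" "smooth_family A B {-\<epsilon><..<\<epsilon>} \<Phi>" "\<Phi> 0 = \<phi>"
      and out: "\<forall>p. p \<notin> K \<longrightarrow> (\<forall>t. \<Phi> t p = \<phi> p)"
      and vel: "\<forall>p\<in>K. \<forall>e\<in>B. \<phi> p \<in> chart_dom e \<longrightarrow>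
        velocity B (\<lambda>t. \<Phi> t p) e = velocity B (\<lambda>t. \<phi> p) e + transition_deriv d e (\<phi> p) (Z p)"
      by (elim exE conjE) (rule that)
    have ff: "form_family B \<omega> A {-\<epsilon><..<\<epsilon>} \<Phi>" by (rule form_familyI[OF _ \<epsilon>(2)]) simp
    have t0: "0 \<in> {-\<epsilon><..<\<epsilon>}" using \<epsilon> by simp
    interpret form_family B \<omega> A "{-\<epsilon><..<\<epsilon>}" \<Phi> by (rule ff)
    have "variation A B \<phi> \<Phi>" using \<epsilon> by (auto simp: variation_def)
    then have "((\<lambda>t. E (\<Phi> t)) has_real_derivative 0) (at 0)" by (rule crit)
    moreover have "((\<lambda>t. E (\<Phi> t)) has_real_derivative pairing (pm \<phi>) (dform (\<lambda>c x. gam 1 c (0, x)))) (at 0)"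
      using first_variation_one_form[OF ff t0, of 1] by (simp add: \<epsilon>(3))
    ultimately have pz: "pairing (pm \<phi>) (dform (\<lambda>c x. gam 1 c (0, x))) = 0" by (rule DERIV_unique[symmetric])

    \<comment> \<open>The two 1-forms are compared in every chart \<open>c\<close>, not just in
      \<open>c0\<close>: over \<open>V\<close> by changing to \<open>c0\<close>, and off
      \<open>V\<close> because both vanish there.\<close>
    have geq: "gam 1 c (0, x) = \<eta>' i c x" if c: "c \<in> A" and x: "x \<in> chart_img c" for c x
    proof (rule vector_eq_ldot[THEN iffD1], rule allI)
      fix u
      define p where "p = chart_inv c x"
      have p: "p \<in> chart_dom c" "snd c p = x" unfolding p_def using chart_inv_in[OF x] chart_chart_inv[OF x] by auto
      have "gam 1 c (0, snd c p) \<bullet> u = \<eta>' i c (snd c p) \<bullet> u"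
      proof (cases "p \<in> V")
        case True
        then have p0: "p \<in> chart_dom c0" and q: "\<phi> p \<in> chart_dom d" using V by auto
        have N: "snd c0 p \<in> ?N" using p0 True by (simp add: chart_inv_chart[OF atlasA c0 p0])
        have vZ: "velocity B (\<lambda>r. \<Phi> (r *\<^sub>R 1) p) d = Z p"
        proof (cases "p \<in> K")
          case True
          then show ?thesis using vel[rule_format, OF True d q]
            by (simp add: velocity_const transition_deriv_self[OF atlas d q])
        next
          case False
          then show ?thesis using out Z0[OF False] by (simp add: velocity_const)
        qed
        have l': "linear (\<lambda>v. local_rep B \<omega> d (snd d (\<phi> p)) v w)" for w
          using bilinear[OF d chart_in[OF q]] by (simp add: bilinear_def)
        have "gam 1 c0 (0, snd c0 p) $ j = (\<xi> i p *\<^sub>R \<eta> c0 (snd c0 p)) $ j" for j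
        proof -
          have "gam 1 c0 (0, snd c0 p) $ j = gam 1 c0 (0, snd c0 p) \<bullet> axis j 1" by (simp add: inner_axis)
          also have "\<dots> = local_rep B \<omega> d (snd d (\<phi> p)) (Z p) (dd (\<lambda>x. snd d (\<phi> (chart_inv c0 x))) (axis j 1) (snd c0 p))"
            using gam_velocity[OF c0 d p0 t0, of 1 "axis j 1"] q unfolding \<epsilon>(3) vZ by simp
          also have "\<dots> = \<xi> i p * \<eta> c0 (snd c0 p) $ j"
            using Y[OF N, of j] True by (simp add: Z_def linear_scale[OF l'] chart_inv_chart[OF atlasA c0 p0])
          finally show ?thesis by simp
        qed
        then have "gam 1 c0 (0, snd c0 p) = \<xi> i p *\<^sub>R \<eta> c0 (snd c0 p)" by (simp add: vec_eq_iff)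
        then show ?thesis
          unfolding gam_change[OF c c0 p(1) p0 t0] \<eta>'_def chart_inv_chart[OF atlasA c p(1)]
          by (simp add: one_form_change[OF \<eta> c c0 p(1) p0])
      next
        case False
        have pK: "p \<notin> K" using False K(2) by (auto simp: V_def)
        obtain d' where d': "d' \<in> B" "\<phi> p \<in> chart_dom d'" using atlas_cover[OF atlas] by blast
        have l': "linear (\<lambda>v. local_rep B \<omega> d' (snd d' (\<phi> p)) v w)" for w
          using bilinear[OF d'(1) chart_in[OF d'(2)]] by (simp add: bilinear_def)
        have v0: "velocity B (\<lambda>r. \<Phi> (r *\<^sub>R 1) p) d' = 0" using out pK by (simp add: velocity_const)
        have "gam 1 c (0, snd c p) \<bullet> u = 0"
          using gam_velocity[OF c d'(1) p(1) t0, of 1 u] d'(2) unfolding \<epsilon>(3) v0 by (simp add: linear_0[OF l'])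
        then show ?thesis using K(3) pK by (simp add: \<eta>'_def chart_inv_chart[OF atlasA c p(1)])
      qed
      then show "u \<bullet> gam 1 c (0, x) = u \<bullet> \<eta>' i c x" by (simp add: p(2) inner_commute)
    qed
    have "pairing (pm \<phi>) (dform (\<lambda>c x. gam 1 c (0, x))) = pairing (pm \<phi>) (dform (\<eta>' i))"
    proof (rule pairing_cong[OF refl])
      fix c x assume c: "c \<in> A" and x: "x \<in> chart_img c"
      show "dform (\<lambda>c x. gam 1 c (0, x)) c x = dform (\<eta>' i) c x"
        by (rule dform_cong[where \<eta> = "\<lambda>c x. gam 1 c (0, x)" and \<eta>' = "\<eta>' i",
              OF atlasA c x smooth_slice[OF c t0 smooth_gam[OF c]] geq[OF c]])
    qed
    with pz show ?thesis by simp
  qed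
  \<comment> \<open>The constant family supplies the continuity of the pulled-back coefficients that
    \<open>pairing_sum\<close> asks for.\<close>
  interpret f: form_family B \<omega> A "UNIV :: real set" "\<lambda>_. \<phi>"
    by (rule form_familyI[OF open_UNIV smooth_map_family[OF atlasA atlas \<phi>s open_UNIV]])
  have cpm: "continuous_on (chart_img c) (pm \<phi> c)" if c: "c \<in> A" for c
  proof -
    have "continuous_on (chart_img c) (\<lambda>x. f.amat c (0, x))"
      by (rule smooth_on_continuous[OF f.smooth_slice[OF c UNIV_I f.smooth_amat[OF c]]])
    then show ?thesis
      by (rule continuous_on_eq) (rule amat_eq[OF f.form_family_axioms UNIV_I c])
  qed
  have "pairing (pm \<phi>) (dform \<eta>) = pairing (pm \<phi>) (\<lambda>c x. \<Sum>i\<in>I. dform (\<eta>' i) c x)"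
  proof (rule pairing_cong[OF refl])
    fix c x assume c: "c \<in> A" and x: "x \<in> chart_img c"
    have op: "open (chart_img c)" by (rule open_chart_img[OF atlasA c])
    \<comment> \<open>The functions \<open>\<xi> i\<close> sum to 1, so the pieces add up to
      \<open>\<eta>\<close> already before differentiation, and additivity of \<open>dform\<close>
      finishes without expanding derivatives of the cut-offs.\<close>
    have e: "\<eta> c y = (\<Sum>i\<in>I. \<eta>' i c y)" for y
      using I(3) by (simp add: \<eta>'_def scaleR_sum_left[symmetric])
    have "dd (\<lambda>x. \<eta> c x $ j) v x = (\<Sum>i\<in>I. dd (\<lambda>x. \<eta>' i c x $ j) v x)" for j v
    proof -
      have "((\<lambda>x. \<Sum>i\<in>I. \<eta>' i c x $ j) has_derivative (\<lambda>v. \<Sum>i\<in>I. dd (\<lambda>x. \<eta>' i c x $ j) v x)) (at x)"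
        by (intro has_derivative_sum smooth_on_has_derivative[OF smooth_on_nth[OF op s\<eta>'] x] c)
      then have "((\<lambda>x. \<eta> c x $ j) has_derivative (\<lambda>v. \<Sum>i\<in>I. dd (\<lambda>x. \<eta>' i c x $ j) v x)) (at x)"
        by (simp add: e)
      then show ?thesis by (rule dd_eqI)
    qed
    then show "dform \<eta> c x = (\<Sum>i\<in>I. dform (\<eta>' i) c x)"
      by (simp add: vec_eq_iff dform_def sum_subtractf)
  qed
  also have "\<dots> = (\<Sum>i\<in>I. pairing (pm \<phi>) (dform (\<eta>' i)))"
  proof (rule pairing_sum[OF I(1)])
    show "continuous_on (chart_img c) (pm \<phi> c)" if "c \<in> A" for c by (rule cpm[OF that])
    show "continuous_on (chart_img c) (dform (\<eta>' i) c)" if "i \<in> I" "c \<in> A" for i c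
      by (rule smooth_on_continuous[OF smooth_dform[where \<eta> = "\<eta>' i", OF atlasA that(2) s\<eta>'[OF that]]])
  qed
  also have "\<dots> = 0" by (simp add: zero)
  finally show "pairing (pm \<phi>) (dform \<eta>) = 0" .
qed

end

section \<open>Integration by parts, determinants and change of variables\<close>

text \<open>As for \<open>inverse\<close>, the induction closes because the derivative is built from
  the reciprocal of the function itself.\<close>

lemma smooth_on_sqrt: "smooth_on {0<..} sqrt"
  unfolding smooth_on_def
proof
  fix k
  show "Ck_on k {0<..} sqrt"
  proof (induction k)
    case 0
    then show ?case by (auto intro!: continuous_intros)
  next
    case (Suc k)
    have op: "open {0::real<..}" by simp
    have op': "open (- {0::real})" by auto
    have d: "(sqrt has_derivative (\<lambda>v. v * (1 / 2 * inverse (sqrt x)))) (at x)" if "x \<in> {0<..}" for x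
    proof -
      have "(sqrt has_derivative (*) (inverse (sqrt x) / 2)) (at x)"
        using DERIV_real_sqrt[of x] that by (simp add: has_field_derivative_def)
      then show ?thesis by (rule has_derivative_eq_rhs) (simp add: fun_eq_iff)
    qed
    have inv: "Ck_on k (- {0::real}) inverse" using smooth_on_inverse_ident by (simp add: smooth_on_def)
    have "Ck_on k {0<..} (\<lambda>x. inverse (sqrt x))"
      by (rule Ck_on_compose[OF op op' _ Suc inv]) auto
    then have "Ck_on k {0<..} (\<lambda>x. v * (1 / 2 * inverse (sqrt x)))" for v
      by (intro Ck_on_bilinear[OF op bounded_bilinear_mult] Ck_on_const)
    then have "Ck_on k {0<..} (dd sqrt v)" for v
      by (rule Ck_on_cong[OF op, rotated]) (use dd_eqI[OF d] in auto)
    then show ?case using d by (auto simp: differentiable_def)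
  qed
qed

section \<open>Integrals of derivatives of compactly supported functions\<close>

lemma integral_translate_supported:
  fixes F :: "'x::euclidean_space \<Rightarrow> real"
  assumes F: "continuous_on UNIV F" and K: "compact K" and z: "\<And>x. x \<notin> K \<Longrightarrow> F x = 0"
  shows "integral UNIV (\<lambda>x. F (x + w)) = integral UNIV F"
proof -
  obtain a where ab: "K \<subseteq> cbox (- a) a"
    using bounded_subset_cbox_symmetric compact_imp_bounded K by blast
  have "integral UNIV F = integral (cbox (- a) a) F"
    using supported_integral(2)[OF open_UNIV K subset_UNIV F _ ab] z by simp
  also have "\<dots> = integral (cbox (- a - w) (a - w)) (\<lambda>x. F (x + w))"
    by (rule integral_shift_cbox[symmetric])
  also have "\<dots> = integral UNIV (\<lambda>x. F (x + w))"
  proof -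
    let ?K = "(\<lambda>x. x - w) ` K"
    have K': "compact ?K" by (rule compact_continuous_image[OF _ K]) (intro continuous_intros)
    have c: "continuous_on UNIV (\<lambda>x. F (x + w))"
      by (rule continuous_on_compose2[OF F]) (auto intro!: continuous_intros)
    have z': "F (x + w) = 0" if "x \<in> UNIV - ?K" for x
    proof (rule z, rule notI)
      assume "x + w \<in> K"
      then have "x + w - w \<in> ?K" by (rule imageI)
      then show False using that by simp
    qed
    have sub: "?K \<subseteq> cbox (- a - w) (a - w)"
      using ab by (auto simp: mem_box inner_diff_left subset_iff)
    show ?thesis using supported_integral(2)[OF open_UNIV K' subset_UNIV c z' sub] by simp
  qed
  finally show ?thesis ..
qed

text \<open>The integral of \<open>F (x + t *\<^sub>R v)\<close> does not depend on
  \<open>t\<close>; differentiating under the integral at \<open>t = 0\<close> gives the claim for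
  any direction at once, without splitting off a coordinate.\<close>

lemma integral_dd_zero:
  fixes f :: "'x::euclidean_space \<Rightarrow> real"
  assumes U: "open U" and K: "compact K" "K \<subseteq> U" and f: "smooth_on U f" and z: "\<And>x. x \<in> U - K \<Longrightarrow> f x = 0"
  shows "integral U (dd f v) = 0"
proof -
  define F where "F x = (if x \<in> U then f x else 0)" for x
  have oK: "open (- K)" using compact_imp_closed[OF K(1)] by auto
  have FK: "F x = 0" if "x \<notin> K" for x using z[of x] that by (auto simp: F_def)
  have "smooth_on (U \<union> - K) F"
  proof (rule smooth_on_Un[OF U oK])
    show "smooth_on U F" by (rule smooth_on_cong[OF U f]) (simp add: F_def)
    show "smooth_on (- K) F" by (rule smooth_on_cong[OF oK smooth_on_const[of _ 0]]) (simp add: FK)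
  qed
  moreover have "U \<union> - K = UNIV" using K(2) by auto
  ultimately have sF: "smooth_on UNIV F" by simp
  have dF: "dd F v x = (if x \<in> U then dd f v x else 0)" for x
  proof (cases "x \<in> U")
    case True
    have "dd f v x = dd F v x"
      by (rule dd_cong_open[OF U True]) (simp_all add: F_def smooth_on_differentiable[OF f True])
    then show ?thesis using True by simp
  next
    case False
    then have "x \<in> - K" using K(2) by auto
    have "dd (\<lambda>_. 0::real) v x = dd F v x"
      by (rule dd_cong_open[OF oK \<open>x \<in> - K\<close>]) (simp_all add: FK)
    then show ?thesis using False by simp
  qed
  have dF0: "dd F v x = 0" if "x \<notin> K" for x
  proof -
    have "dd (\<lambda>_. 0::real) v x = dd F v x"
      by (rule dd_cong_open[OF oK]) (use that in \<open>simp_all add: FK\<close>)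
    then show ?thesis by simp
  qed
  \<comment> \<open>Contains every point that some translation by \<open>t *\<^sub>R v\<close> with
    \<open>\<bar>t\<bar> \<le> 1\<close> moves into \<open>K\<close>, so it is a support common to
    all parameters.\<close>
  let ?K = "(\<lambda>z. fst z - snd z *\<^sub>R v) ` (K \<times> {-1..1::real})"
  have K': "compact ?K"
    by (rule compact_continuous_image) (auto intro!: continuous_intros compact_Times K(1))
  have inK: "x + t *\<^sub>R v \<notin> K" if "t \<in> {-1<..<1}" "x \<in> UNIV - ?K" for t x
  proof
    assume "x + t *\<^sub>R v \<in> K"
    then have "(x + t *\<^sub>R v, t) \<in> K \<times> {-1..1}" using that by auto
    then have "fst (x + t *\<^sub>R v, t) - snd (x + t *\<^sub>R v, t) *\<^sub>R v \<in> ?K" by (rule imageI)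
    then show False using that by simp
  qed
  have "((\<lambda>t. integral UNIV (\<lambda>x. F (x + t *\<^sub>R v))) has_real_derivative
      integral UNIV (\<lambda>x. dd F v (x + 0 *\<^sub>R v))) (at 0)"
  proof (rule leibniz_supported[where T = "{-1<..<1}" and K = ?K and f = "\<lambda>t x. F (x + t *\<^sub>R v)" and f' = "\<lambda>t x. dd F v (x + t *\<^sub>R v)"])
    show "((\<lambda>t. F (x + t *\<^sub>R v)) has_real_derivative dd F v (x + t *\<^sub>R v)) (at t)" for t x
    proof -
      have df: "F differentiable (at (x + t *\<^sub>R v))" by (rule smooth_on_differentiable[OF sF]) simp
      have "((\<lambda>t. x + t *\<^sub>R v) has_derivative (\<lambda>h. h *\<^sub>R v)) (at t)" by (auto intro!: derivative_eq_intros)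
      from diff_chain_at[OF this has_derivative_dd[OF df]]
      show ?thesis
        by (simp add: o_def has_field_derivative_def linear_scale[OF linear_dd[OF df]] mult_commute_abs)
    qed
    show "continuous_on UNIV (\<lambda>x. F (x + t *\<^sub>R v))" for t
      by (rule continuous_on_compose2[OF smooth_on_continuous[OF sF]]) (auto intro!: continuous_intros)
    have "continuous_on ({-1<..<1} \<times> UNIV) (\<lambda>z. dd F v (snd z + fst z *\<^sub>R v))"
      by (rule continuous_on_compose2[OF smooth_on_continuous[OF smooth_on_dd[OF sF]]]) (auto intro!: continuous_intros)
    then show "continuous_on ({-1<..<1} \<times> UNIV) (\<lambda>(t, x). dd F v (x + t *\<^sub>R v))" by (simp add: split_def)
  qed (use K' inK FK dF0 in auto)
  moreover have "(\<lambda>t. integral UNIV (\<lambda>x. F (x + t *\<^sub>R v))) = (\<lambda>t. integral UNIV F)"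
    by (rule ext) (rule integral_translate_supported[OF smooth_on_continuous[OF sF] K(1) FK])
  ultimately have "((\<lambda>t::real. integral UNIV F) has_real_derivative integral UNIV (dd F v)) (at 0)" by simp
  from DERIV_unique[OF this DERIV_const] have "integral UNIV (dd F v) = 0" .
  moreover have "integral UNIV (dd F v) = integral U (dd f v)"
    unfolding dF[abs_def] by (rule Henstock_Kurzweil_Integration.integral_restrict_UNIV)
  ultimately show ?thesis by simp
qed

section \<open>Derivative of the determinant\<close>

lemma has_derivative_det_at_mat_1:
  fixes N :: "'x::real_normed_vector \<Rightarrow> real^'m^'m"
  assumes d: "\<And>i j. ((\<lambda>y. N y $ i $ j) has_derivative (\<lambda>h. N' h $ i $ j)) (at x)" and N: "N x = mat 1"
  shows "((\<lambda>y. det (N y)) has_derivative (\<lambda>h. trace (N' h))) (at x)"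
proof -
  let ?P = "{p. p permutes (UNIV :: 'm set)}"
  have "((\<lambda>y. \<Sum>p\<in>?P. of_int (sign p) * (\<Prod>i\<in>UNIV. N y $ i $ p i)) has_derivative
    (\<lambda>h. \<Sum>p\<in>?P. of_int (sign p) * (\<Sum>i\<in>UNIV. N' h $ i $ p i * (\<Prod>j\<in>UNIV - {i}. N x $ j $ p j)))) (at x)"
    by (intro has_derivative_sum has_derivative_mult_right has_derivative_prod d)
  moreover have "(\<Sum>p\<in>?P. of_int (sign p) * (\<Sum>i\<in>UNIV. N' h $ i $ p i * (\<Prod>j\<in>UNIV - {i}. N x $ j $ p j))) = trace (N' h)" for h
  proof -
    \<comment> \<open>Only the identity permutation contributes: any other one moves at least two
      indices, so after one factor is dropped the product still contains an off-diagonal entry of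
      the unit matrix.\<close>
    have "of_int (sign p) * (\<Sum>i\<in>UNIV. N' h $ i $ p i * (\<Prod>j\<in>UNIV - {i}. N x $ j $ p j)) = (if p = id then trace (N' h) else 0)"
      if p: "p \<in> ?P" for p
    proof (cases "p = id")
      case True
      then show ?thesis by (simp add: N mat_def trace_def sign_id)
    next
      case False
      have p0: "(\<Prod>j\<in>UNIV - {i}. N x $ j $ p j) = 0" for i
      proof -
        have inj: "inj p" using p by (auto intro: permutes_inj)
        obtain k where k: "p k \<noteq> k" using False by (auto simp: fun_eq_iff)
        have "\<exists>j. j \<noteq> i \<and> p j \<noteq> j"
        proof (cases "k = i")
          case True
          have "p (p k) \<noteq> p k" using k inj by (auto dest: injD)
          then show ?thesis using k True by blast
        next
          case False
          then show ?thesis using k by blast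
        qed
        then obtain j where "j \<noteq> i" "p j \<noteq> j" by blast
        then show ?thesis by (intro prod_zero) (auto intro!: bexI[of _ j] simp: N mat_def)
      qed
      show ?thesis using False by (simp only: p0 mult_zero_right sum.neutral_const if_False)
    qed
    then have "(\<Sum>p\<in>?P. of_int (sign p) * (\<Sum>i\<in>UNIV. N' h $ i $ p i * (\<Prod>j\<in>UNIV - {i}. N x $ j $ p j)))
      = (\<Sum>p\<in>?P. if p = id then trace (N' h) else 0)" by (rule sum.cong[OF refl])
    also have "\<dots> = trace (N' h)"
      using finite_permutations[of "UNIV :: 'm set"] permutes_id[of "UNIV :: 'm set"] by simp
    finally show ?thesis .
  qed
  ultimately show ?thesis unfolding det_def by simp
qed

text \<open>Jacobi's formula, reduced to the unit matrix by multiplying with the constant matrix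
  \<open>matrix_inv (M x)\<close>.\<close>

lemma has_derivative_det:
  fixes M :: "'x::real_normed_vector \<Rightarrow> real^'m^'m"
  assumes d: "\<And>i j. ((\<lambda>y. M y $ i $ j) has_derivative (\<lambda>h. M' h $ i $ j)) (at x)" and inv: "invertible (M x)"
  shows "((\<lambda>y. det (M y)) has_derivative (\<lambda>h. det (M x) * trace (matrix_inv (M x) ** M' h))) (at x)"
proof -
  let ?R = "matrix_inv (M x)"
  have "((\<lambda>y. det (?R ** M y)) has_derivative (\<lambda>h. trace (?R ** M' h))) (at x)"
  proof (rule has_derivative_det_at_mat_1)
    show "?R ** M x = mat 1" by (rule matrix_inv_works(2)[OF inv])
    show "((\<lambda>y. (?R ** M y) $ i $ j) has_derivative (\<lambda>h. (?R ** M' h) $ i $ j)) (at x)" for i j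
      unfolding matrix_matrix_mult_def vec_lambda_beta
      by (intro has_derivative_sum has_derivative_mult_right d)
  qed
  then have "((\<lambda>y. det (M x) * det (?R ** M y)) has_derivative (\<lambda>h. det (M x) * trace (?R ** M' h))) (at x)"
    by (rule has_derivative_mult_right)
  moreover have "det (M x) * det (?R ** M y) = det (M y)" for y
  proof -
    have "det (M x) * det ?R = 1"
      using matrix_inv_works(1)[OF inv] by (metis det_I det_mul)
    then show ?thesis by (simp add: det_mul mult.assoc[symmetric])
  qed
  ultimately show ?thesis by simp
qed

text \<open>The change of variables theorem of the library is stated for well-ordered index types only;
  every finite index type has a well-ordered copy.\<close>
typedef 'a wo = "UNIV :: 'a set" morphisms of_wo to_wo by simp

instance wo :: (finite) finite
proof
  have "(UNIV :: 'a wo set) = range to_wo"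
    by (auto intro!: image_eqI[of _ to_wo "of_wo _"] simp: of_wo_inverse)
  then show "finite (UNIV :: 'a wo set)" by (metis finite finite_imageI)
qed

definition wo_index :: "'a::finite wo \<Rightarrow> nat" where
  "wo_index x = to_nat_on UNIV (of_wo x)"

lemma inj_wo_index: "wo_index x = wo_index y \<Longrightarrow> x = y"
  using inj_on_to_nat_on[of "UNIV :: 'a::finite set"]
  by (auto simp: wo_index_def countable_finite of_wo_inject dest: injD)

instantiation wo :: (finite) wellorder
begin

definition less_eq_wo :: "'a wo \<Rightarrow> 'a wo \<Rightarrow> bool" where "less_eq_wo x y \<longleftrightarrow> wo_index x \<le> wo_index y"
definition less_wo :: "'a wo \<Rightarrow> 'a wo \<Rightarrow> bool" where "less_wo x y \<longleftrightarrow> wo_index x < wo_index y"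

instance
proof
  fix P :: "'a wo \<Rightarrow> bool" and a
  assume "\<And>x. (\<And>y. y < x \<Longrightarrow> P y) \<Longrightarrow> P x"
  then show "P a" unfolding less_wo_def by (rule measure_induct_rule[of wo_index])
qed (auto simp: less_eq_wo_def less_wo_def intro: inj_wo_index)

end

definition to_wo_vec :: "real^'m \<Rightarrow> real^('m wo)" where "to_wo_vec x = (\<chi> i. x $ of_wo i)"
definition of_wo_vec :: "real^('m wo) \<Rightarrow> real^'m" where "of_wo_vec y = (\<chi> i. y $ to_wo i)"

lemma of_to_wo_vec [simp]: "of_wo_vec (to_wo_vec x) = x"
  and to_of_wo_vec [simp]: "to_wo_vec (of_wo_vec y) = y"
  by (simp_all add: to_wo_vec_def of_wo_vec_def to_wo_inverse of_wo_inverse vec_eq_iff)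

lemma bounded_linear_to_wo_vec: "bounded_linear (to_wo_vec :: real^'m::finite \<Rightarrow> _)"
  and bounded_linear_of_wo_vec: "bounded_linear (of_wo_vec :: _ \<Rightarrow> real^'m::finite)"
  unfolding linear_conv_bounded_linear[symmetric]
  by (auto simp: linear_iff to_wo_vec_def of_wo_vec_def vec_eq_iff)

lemma bij_of_wo: "bij of_wo" and bij_to_wo: "bij to_wo"
  by (auto intro!: bij_betw_byWitness[where f' = to_wo] bij_betw_byWitness[where f' = of_wo]
      simp: of_wo_inverse to_wo_inverse)

lemma to_wo_vec_cbox: "to_wo_vec ` cbox u v = cbox (to_wo_vec u) (to_wo_vec v)" for u v :: "real^'m::finite"
proof
  show "to_wo_vec ` cbox u v \<subseteq> cbox (to_wo_vec u) (to_wo_vec v)"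
    by (auto simp: mem_box_cart to_wo_vec_def)
  show "cbox (to_wo_vec u) (to_wo_vec v) \<subseteq> to_wo_vec ` cbox u v"
  proof
    fix y assume y: "y \<in> cbox (to_wo_vec u) (to_wo_vec v)"
    have "of_wo_vec y \<in> cbox u v"
      unfolding mem_box_cart
    proof
      fix i
      from y have "to_wo_vec u $ to_wo i \<le> y $ to_wo i \<and> y $ to_wo i \<le> to_wo_vec v $ to_wo i"
        by (simp add: mem_box_cart)
      then show "u $ i \<le> of_wo_vec y $ i \<and> of_wo_vec y $ i \<le> v $ i"
        by (simp add: to_wo_vec_def of_wo_vec_def to_wo_inverse)
    qed
    then show "y \<in> to_wo_vec ` cbox u v" by (intro image_eqI[of _ _ "of_wo_vec y"]) simp
  qed
qed

lemma of_wo_vec_cbox: "of_wo_vec ` cbox u v = cbox (of_wo_vec u) (of_wo_vec v)" for u v :: "real^('m::finite wo)"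
proof -
  have "cbox u v = to_wo_vec ` cbox (of_wo_vec u) (of_wo_vec v)" by (simp add: to_wo_vec_cbox)
  then show ?thesis by (simp add: image_image)
qed

lemma content_to_wo_vec: "measure lborel (to_wo_vec ` cbox u v) = measure lborel (cbox u v)" for u v :: "real^'m::finite"
proof (cases "cbox u v = {}")
  case False
  then have ne: "cbox (to_wo_vec u) (to_wo_vec v) \<noteq> {}" unfolding to_wo_vec_cbox[symmetric] by simp
  have "(\<Prod>i\<in>UNIV. to_wo_vec v $ i - to_wo_vec u $ i) = (\<Prod>i\<in>UNIV. v $ i - u $ i)"
    unfolding to_wo_vec_def vec_lambda_beta
    by (rule prod.reindex_bij_betw[OF bij_of_wo, of "\<lambda>i. v $ i - u $ i"])
  then show ?thesis unfolding to_wo_vec_cbox content_cbox_cart[OF ne] content_cbox_cart[OF False] .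
qed simp

text \<open>Relabelling coordinates maps boxes to boxes and preserves their content, so the integral
  transforms with factor 1.\<close>

lemma integral_wo_cbox:
  fixes f :: "real^('m::finite wo) \<Rightarrow> real"
  assumes "f integrable_on cbox a b"
  shows "integral (cbox (of_wo_vec a) (of_wo_vec b)) (\<lambda>x. f (to_wo_vec x)) = integral (cbox a b) f"
proof -
  have "((\<lambda>x. f (to_wo_vec x)) has_integral (1 / 1) *\<^sub>R integral (cbox a b) f) (of_wo_vec ` cbox a b)"
  proof (rule has_integral_twiddle[where g = to_wo_vec and h = of_wo_vec])
    show "isCont to_wo_vec x" for x :: "real^'m"
      by (rule bounded_linear.isCont[OF bounded_linear_to_wo_vec continuous_ident])
    show "\<exists>w z. to_wo_vec ` cbox u v = cbox w z" for u v :: "real^'m" using to_wo_vec_cbox by blast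
    show "\<exists>w z. of_wo_vec ` cbox u v = cbox w z" for u v :: "real^('m wo)" using of_wo_vec_cbox by blast
    show "measure lborel (to_wo_vec ` cbox u v) = 1 * measure lborel (cbox u v)" for u v :: "real^'m" by (simp add: content_to_wo_vec)
  qed (use assms in \<open>simp_all add: integrable_integral\<close>)
  then show ?thesis by (simp add: of_wo_vec_cbox integral_unique)
qed

lemma to_wo_vec_image: "to_wo_vec ` S = of_wo_vec -` S"
  by (auto intro!: image_eqI[of _ to_wo_vec "of_wo_vec _"])

lemma open_to_wo_vec_image: "open S \<Longrightarrow> open (to_wo_vec ` S)" for S :: "(real^'m::finite) set"
  unfolding to_wo_vec_image
  by (rule open_vimage) (auto intro: linear_continuous_on bounded_linear_of_wo_vec)

lemma integral_wo_supported:
  fixes f :: "real^'m::finite \<Rightarrow> real"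
  assumes U: "open U" and K: "compact K" "K \<subseteq> U" and f: "continuous_on U f" and z: "\<And>x. x \<in> U - K \<Longrightarrow> f x = 0"
  shows "(\<lambda>y. f (of_wo_vec y)) integrable_on to_wo_vec ` U"
    "integral (to_wo_vec ` U) (\<lambda>y. f (of_wo_vec y)) = integral U f"
proof -
  obtain a where ab: "K \<subseteq> cbox (- a) a"
    using bounded_subset_cbox_symmetric compact_imp_bounded K by blast
  let ?U = "to_wo_vec ` U" and ?K = "to_wo_vec ` K" and ?a = "to_wo_vec (- a)" and ?b = "to_wo_vec a"
  have U': "open ?U" by (rule open_to_wo_vec_image[OF U])
  have K': "compact ?K"
    by (rule compact_continuous_image[OF linear_continuous_on[OF bounded_linear_to_wo_vec] K(1)])
  have f': "continuous_on ?U (\<lambda>y. f (of_wo_vec y))"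
    by (rule continuous_on_compose2[OF f linear_continuous_on[OF bounded_linear_of_wo_vec]]) auto
  have z': "f (of_wo_vec y) = 0" if y: "y \<in> ?U - ?K" for y
  proof -
    from y obtain x where x: "x \<in> U" "y = to_wo_vec x" by auto
    then have "x \<notin> K" using y by blast
    then show ?thesis using z[of x] x by simp
  qed
  have ab': "?K \<subseteq> cbox ?a ?b" using ab unfolding to_wo_vec_cbox[symmetric] by (rule image_mono)
  note s = supported_integral[OF U' K' image_mono[OF K(2)] f' z' ab']
  show "(\<lambda>y. f (of_wo_vec y)) integrable_on ?U" by (rule s(1))
  let ?g = "\<lambda>y. if y \<in> ?U then f (of_wo_vec y) else 0"
  have "?g integrable_on UNIV"
    using s(1) by (simp add: Henstock_Kurzweil_Integration.integrable_restrict_UNIV)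
  then have "?g integrable_on cbox ?a ?b" by (rule integrable_on_subcbox) simp
  from integral_wo_cbox[OF this] have I: "integral (cbox (- a) a) (\<lambda>x. ?g (to_wo_vec x)) = integral (cbox ?a ?b) ?g"
    by simp
  have geq: "?g (to_wo_vec x) = (if x \<in> U then f x else 0)" for x
    by (auto dest: arg_cong[of _ _ of_wo_vec])
  have e1: "integral ?U (\<lambda>y. f (of_wo_vec y)) = integral (cbox ?a ?b) ?g" by (rule s(2))
  have e2: "integral U f = integral (cbox (- a) a) (\<lambda>x. if x \<in> U then f x else 0)"
    by (rule supported_integral(2)[OF U K f z ab])
  show "integral ?U (\<lambda>y. f (of_wo_vec y)) = integral U f"
    unfolding e1 e2 using I by (simp only: geq)
qed

text \<open>Conjugation by a bijection sends transpositions to transpositions and keeps their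
  number, hence also the sign.\<close>

lemma swapidseq_wo:
  fixes p :: "'k \<Rightarrow> 'k"
  shows "swapidseq n p \<Longrightarrow> swapidseq n (to_wo \<circ> p \<circ> of_wo)"
proof (induction rule: swapidseq.induct)
  case id
  have "to_wo \<circ> (id :: 'k \<Rightarrow> 'k) \<circ> of_wo = id" by (simp add: fun_eq_iff of_wo_inverse)
  then show ?case by (simp only: swapidseq.id)
next
  case (comp_Suc n p a b)
  have eq: "to_wo \<circ> (Transposition.transpose a b \<circ> p) \<circ> of_wo
      = Transposition.transpose (to_wo a) (to_wo b) \<circ> (to_wo \<circ> p \<circ> of_wo)"
    by (auto simp: fun_eq_iff Transposition.transpose_def to_wo_inject)
  show ?case unfolding eq
    by (rule swapidseq.comp_Suc[OF comp_Suc.IH]) (use comp_Suc.hyps in \<open>simp add: to_wo_inject\<close>)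
qed

lemma sign_wo:
  fixes p :: "'m::finite \<Rightarrow> 'm"
  assumes "p permutes UNIV"
  shows "sign (to_wo \<circ> p \<circ> of_wo) = sign p"
proof -
  have "permutation p" using assms permutation_permutes finite by blast
  then obtain n where n: "swapidseq n p" unfolding permutation_def by blast
  have "evenperm p = even n" by (rule evenperm_unique[OF n refl])
  moreover have "evenperm (to_wo \<circ> p \<circ> of_wo) = even n" by (rule evenperm_unique[OF swapidseq_wo[OF n] refl])
  ultimately show ?thesis by (simp add: sign_def)
qed

lemma det_wo:
  fixes M :: "real^'m^'m"
  shows "det (\<chi> i j. M $ of_wo i $ of_wo j) = det M"
proof -
  have b: "(f permutes UNIV) = bij f" for f :: "'k \<Rightarrow> 'k" by (auto intro: permutes_bij intro!: bij_imp_permutes)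
  have "det M = (\<Sum>q\<in>{q. q permutes (UNIV :: 'm wo set)}. of_int (sign q) * (\<Prod>i\<in>UNIV. M $ of_wo i $ of_wo (q i)))"
    unfolding det_def
  proof (rule sum.reindex_bij_witness[where j = "\<lambda>p. to_wo \<circ> p \<circ> of_wo" and i = "\<lambda>q. of_wo \<circ> q \<circ> to_wo"])
    fix p assume p: "p \<in> {p. p permutes (UNIV :: 'm set)}"
    show "of_wo \<circ> (to_wo \<circ> p \<circ> of_wo) \<circ> to_wo = p" by (simp add: fun_eq_iff to_wo_inverse)
    show "to_wo \<circ> p \<circ> of_wo \<in> {q. q permutes UNIV}"
      using p by (simp add: b bij_comp bij_of_wo bij_to_wo)
    have "(\<Prod>i\<in>UNIV. M $ of_wo i $ of_wo ((to_wo \<circ> p \<circ> of_wo) i)) = (\<Prod>i\<in>UNIV. M $ i $ p i)"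
      using prod.reindex_bij_betw[OF bij_of_wo, of "\<lambda>i. M $ i $ p i"] by (simp add: to_wo_inverse)
    then show "of_int (sign (to_wo \<circ> p \<circ> of_wo)) * (\<Prod>i\<in>UNIV. M $ of_wo i $ of_wo ((to_wo \<circ> p \<circ> of_wo) i))
      = of_int (sign p) * (\<Prod>i\<in>UNIV. M $ i $ p i)" using sign_wo[of p] p by simp
  next
    fix q assume q: "q \<in> {q. q permutes (UNIV :: 'm wo set)}"
    show "to_wo \<circ> (of_wo \<circ> q \<circ> to_wo) \<circ> of_wo = q" by (simp add: fun_eq_iff of_wo_inverse)
    show "of_wo \<circ> q \<circ> to_wo \<in> {p. p permutes UNIV}"
      using q by (simp add: b bij_comp bij_of_wo bij_to_wo)
  qed
  then show ?thesis by (simp add: det_def)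
qed

text \<open>The inverse \<open>\<sigma>\<close> serves twice: it gives injectivity, and it maps
  \<open>K\<close> to the compact support after substitution. The problem is transported to
  relabelled coordinates, solved there and brought back.\<close>

lemma change_of_variables_supported:
  fixes \<tau> \<sigma> :: "real^'m::finite \<Rightarrow> real^'m" and f :: "real^'m \<Rightarrow> real"
  assumes U: "open U" and V: "open V" and \<tau>: "\<tau> ` U = V" "\<And>x. x \<in> U \<Longrightarrow> \<sigma> (\<tau> x) = x"
    and d: "\<And>x. x \<in> U \<Longrightarrow> (\<tau> has_derivative \<tau>' x) (at x)" and dc: "continuous_on U (\<lambda>x. det (matrix (\<tau>' x)))"
    and \<sigma>: "continuous_on V \<sigma>" and K: "compact K" "K \<subseteq> V"
    and f: "continuous_on V f" and z: "\<And>x. x \<in> V - K \<Longrightarrow> f x = 0"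
  shows "integral V f = integral U (\<lambda>x. \<bar>det (matrix (\<tau>' x))\<bar> * f (\<tau> x))"
proof -
  let ?L = to_wo_vec and ?M = of_wo_vec
  let ?U = "?L ` U" and ?V = "?L ` V"
  let ?t = "\<lambda>y. ?L (\<tau> (?M y))" and ?t' = "\<lambda>y h. ?L (\<tau>' (?M y) (?M h))"
  \<comment> \<open>A \<open>real^1\<close>-valued copy of the integrand, to match the vector-valued
    form of \<open>integral_change_of_variables\<close>.\<close>
  let ?f = "\<lambda>y. vec (f (?M y)) :: real^1"
  have img: "?t ` ?U = ?V" using \<tau>(1) by (auto simp: image_image)
  have inj: "inj_on ?t ?U"
  proof (rule inj_on_inverseI)
    show "?L (\<sigma> (?M (?t y))) = y" if "y \<in> ?U" for y using that \<tau>(2) by auto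
  qed
  have der: "(?t has_derivative ?t' y) (at y within ?U)" if "y \<in> ?U" for y
  proof -
    have x: "?M y \<in> U" using that by auto
    have "((\<tau> \<circ> ?M) has_derivative (\<tau>' (?M y) \<circ> ?M)) (at y)"
      by (rule diff_chain_at[OF bounded_linear_imp_has_derivative[OF bounded_linear_of_wo_vec] d[OF x]])
    from bounded_linear.has_derivative[OF bounded_linear_to_wo_vec this]
    have "(?t has_derivative ?t' y) (at y)" by (simp add: o_def)
    then show ?thesis by (rule has_derivative_at_withinI)
  qed
  have mdet: "det (matrix (?t' y)) = det (matrix (\<tau>' (?M y)))" if "y \<in> ?U" for y
  proof -
    have "?M (axis j 1) = axis (of_wo j) (1::real)" for j :: "'m wo"
      by (auto simp: of_wo_vec_def axis_def vec_eq_iff of_wo_inverse to_wo_inverse)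
    then have "matrix (?t' y) = (\<chi> i j. matrix (\<tau>' (?M y)) $ of_wo i $ of_wo j)"
      by (simp add: matrix_def to_wo_vec_def)
    then show ?thesis by (simp add: det_wo)
  qed
  have ab: "?f absolutely_integrable_on ?V"
  proof -
    have cn: "continuous_on V (\<lambda>x. norm (f x))" by (intro continuous_on_norm f)
    have "(\<lambda>y. f (?M y)) integrable_on ?V" by (rule integral_wo_supported(1)[OF V K f z])
    moreover have "(\<lambda>y. norm (f (?M y))) integrable_on ?V"
      by (rule integral_wo_supported(1)[OF V K cn]) (simp add: z)
    ultimately have "(\<lambda>y. f (?M y)) absolutely_integrable_on ?V" by (simp add: absolutely_integrable_on_def)
    then show ?thesis by (simp add: absolutely_integrable_on_1_iff)
  qed
  have "integral (?t ` ?U) ?f = integral ?U (\<lambda>y. \<bar>det (matrix (?t' y))\<bar> *\<^sub>R ?f (?t y))"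
    by (rule integral_change_of_variables[OF _ der inj])
      (use ab img open_to_wo_vec_image[OF U] in \<open>auto intro: lmeasurable_open borel_open\<close>)
  then have "integral ?V ?f $ 1 = integral ?U (\<lambda>y. \<bar>det (matrix (?t' y))\<bar> *\<^sub>R ?f (?t y)) $ 1"
    unfolding img by simp
  then have "integral ?V (\<lambda>y. f (?M y)) = integral ?U (\<lambda>y. \<bar>det (matrix (?t' y))\<bar> * f (\<tau> (?M y)))"
    unfolding integral_on_1_eq by simp
  also have "\<dots> = integral ?U (\<lambda>y. (\<lambda>x. \<bar>det (matrix (\<tau>' x))\<bar> * f (\<tau> x)) (?M y))"
    by (rule Henstock_Kurzweil_Integration.integral_cong) (simp add: mdet)
  also have "\<dots> = integral U (\<lambda>x. \<bar>det (matrix (\<tau>' x))\<bar> * f (\<tau> x))"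
  proof (rule integral_wo_supported(2)[OF U])
    show "compact (\<sigma> ` K)" by (rule compact_continuous_image[OF continuous_on_subset[OF \<sigma> K(2)] K(1)])
    show "\<sigma> ` K \<subseteq> U" using K(2) \<tau> by force
    have "continuous_on U \<tau>" using d by (auto intro!: continuous_at_imp_continuous_on has_derivative_continuous)
    then have "continuous_on U (\<lambda>x. f (\<tau> x))" by (rule continuous_on_compose2[OF f]) (use \<tau> in auto)
    then show "continuous_on U (\<lambda>x. \<bar>det (matrix (\<tau>' x))\<bar> * f (\<tau> x))"
      by (intro continuous_on_mult continuous_on_rabs dc)
    show "\<bar>det (matrix (\<tau>' x))\<bar> * f (\<tau> x) = 0" if "x \<in> U - \<sigma> ` K" for x
    proof -
      have "\<tau> x \<notin> K"
      proof
        assume "\<tau> x \<in> K"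
        then have "\<sigma> (\<tau> x) \<in> \<sigma> ` K" by (rule imageI)
        then show False using that \<tau>(2)[of x] by simp
      qed
      then show ?thesis using that \<tau>(1) z[of "\<tau> x"] by auto
    qed
  qed
  also have "integral ?V (\<lambda>y. f (?M y)) = integral V f" by (rule integral_wo_supported(2)[OF V K f z])
  finally show ?thesis .
qed

section \<open>The Kaehler form is coclosed\<close>

lemma minus_matrix_mult:
  fixes M N :: "real^'m^'m"
  shows "(- M) ** N = - (M ** N)" "M ** (- N) = - (M ** N)"
  by (simp_all add: matrix_matrix_mult_def vec_eq_iff sum_negf)

lemma transpose_uminus: "transpose (- M) = - transpose (M :: real^'m^'m)"
  by (simp add: transpose_def vec_eq_iff)

lemma integral_supported_mono:
  fixes f :: "'x::euclidean_space \<Rightarrow> real"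
  assumes W: "open W" and U: "open U" "U \<subseteq> W" and K: "compact K" "K \<subseteq> U"
    and f: "continuous_on W f" and z: "\<And>x. x \<in> W - K \<Longrightarrow> f x = 0"
  shows "integral W f = integral U f"
proof -
  obtain a where ab: "K \<subseteq> cbox (- a) a"
    using bounded_subset_cbox_symmetric compact_imp_bounded K(1) by blast
  have "integral W f = integral (cbox (- a) a) (\<lambda>x. if x \<in> W then f x else 0)"
    by (rule supported_integral(2)[OF W K(1) _ f z ab]) (use K U in auto)
  also have "\<dots> = integral (cbox (- a) a) (\<lambda>x. if x \<in> U then f x else 0)"
    by (rule Henstock_Kurzweil_Integration.integral_cong) (use z K U in auto)
  also have "\<dots> = integral U f"
    by (rule supported_integral(2)[OF U(1) K continuous_on_subset[OF f U(2)] z ab, symmetric]) (use U in auto)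
  finally show ?thesis .
qed

text \<open>The link between form and metric is \<open>compatible\<close>: it says that the
  endomorphism \<open>g^{-1} \<omega>\<close>, for a Kaehler form the complex structure up to sign,
  squares to -1.\<close>

locale kaehler_volume = riemannian A g F \<rho> + closed_form A \<omega>
  for A :: "('a::t2_space, 'm::finite) chart set" and g F \<rho> \<omega> +
  assumes compatible: "\<And>c x. c \<in> A \<Longrightarrow> x \<in> chart_img c \<Longrightarrow>
    tmat A \<omega> c x ** matrix_inv (tmat A g c x) ** tmat A \<omega> c x = - tmat A g c x"
begin

abbreviation "om c x \<equiv> tmat A \<omega> c x"
abbreviation "oi c x \<equiv> matrix_inv (om c x)"
abbreviation "vol \<equiv> volume_coeff A g"

text \<open>Since raising both indices of \<open>\<omega>\<close> yields minus its inverse, the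
  divergence of the raised form can be studied through \<open>oi\<close>, whose derivative is
  expressed by \<open>\<omega>\<close> alone.\<close>

lemma om_inverse:
  assumes c: "c \<in> A" "x \<in> chart_img c"
  shows "invertible (om c x)" "oi c x = - (gi c x ** om c x ** gi c x)"
proof -
  have "(- (gi c x ** om c x ** gi c x)) ** om c x = - (gi c x ** (om c x ** gi c x ** om c x))"
    by (simp only: minus_matrix_mult matrix_mul_assoc)
  also have "\<dots> = gi c x ** gm c x" by (simp only: compatible[OF c] minus_matrix_mult minus_minus)
  also have "\<dots> = mat 1" by (rule matrix_inv_works(2)[OF metric_invertible[OF c]])
  finally have "(- (gi c x ** om c x ** gi c x)) ** om c x = mat 1" .
  then show "invertible (om c x)" "oi c x = - (gi c x ** om c x ** gi c x)" by (rule matrix_inv_eqI)+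
qed

lemma om_antisym: "c \<in> A \<Longrightarrow> x \<in> chart_img c \<Longrightarrow> om c x $ i $ j = - om c x $ j $ i"
  unfolding tmat_def vec_lambda_beta by (rule antisym)

lemma oi_antisym:
  assumes c: "c \<in> A" "x \<in> chart_img c"
  shows "oi c x $ i $ j = - oi c x $ j $ i"
proof -
  obtain P :: "real^'m^'m" where P: "gi c x = P ** transpose P" by (rule inverse_metric_factor[OF c])
  have g: "transpose (gi c x) = gi c x" unfolding P by (simp add: matrix_transpose_mul)
  have o: "transpose (om c x) = - om c x"
  proof -
    have "transpose (om c x) $ i $ j = (- om c x) $ i $ j" for i j
      using om_antisym[OF c, of j i] by (simp add: transpose_def)
    then show ?thesis by (simp add: vec_eq_iff)
  qed
  have "transpose (oi c x) = - oi c x"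
    unfolding om_inverse(2)[OF c] by (simp add: transpose_uminus matrix_transpose_mul g o minus_matrix_mult matrix_mul_assoc)
  then have "transpose (oi c x) $ j $ i = (- oi c x) $ j $ i" by simp
  then show ?thesis by (simp add: transpose_def)
qed

text \<open>Taking determinants in \<open>compatible\<close> gives the identity up to the factor
  \<open>det (- mat 1)\<close>, which is 1 or -1; the value -1 would make a square negative. The
  derivative of the volume density can thus be computed from \<open>\<omega>\<close> and matched
  with that of \<open>oi\<close>.\<close>

lemma det_om:
  assumes c: "c \<in> A" "x \<in> chart_img c"
  shows "(det (om c x))\<^sup>2 = (det (gm c x))\<^sup>2"
proof -
  define s where "s = det (- mat 1 :: real^'m^'m)"
  have "s * s = det ((- mat 1 :: real^'m^'m) ** (- mat 1))" unfolding s_def by (rule det_mul[symmetric])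
  also have "\<dots> = 1" by (simp add: minus_matrix_mult)
  finally have s: "s * s = 1" .
  have "det (om c x) * det (gi c x) * det (om c x) = det (om c x ** gi c x ** om c x)" by (simp add: det_mul)
  also have "\<dots> = det ((- mat 1) ** gm c x)" unfolding compatible[OF c] by (simp add: minus_matrix_mult)
  also have "\<dots> = s * det (gm c x)" unfolding s_def by (rule det_mul)
  finally have 1: "det (om c x) * det (gi c x) * det (om c x) = s * det (gm c x)" .
  have "det (gm c x ** gi c x) = 1" unfolding matrix_inv_works(1)[OF metric_invertible[OF c]] by simp
  then have 2: "det (gm c x) * det (gi c x) = 1" by (simp add: det_mul)
  have "(det (om c x))\<^sup>2 = det (gm c x) * (det (om c x) * det (gi c x) * det (om c x))"
    using 2 by (simp add: power2_eq_square mult.assoc mult.left_commute)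
  also have "\<dots> = s * (det (gm c x))\<^sup>2" unfolding 1 by (simp add: power2_eq_square)
  finally have e: "(det (om c x))\<^sup>2 = s * (det (gm c x))\<^sup>2" .
  have gp: "(det (gm c x))\<^sup>2 > 0" using metric_det_pos[OF c] by simp
  have "s = 1 \<or> s = -1" using s by (simp add: square_eq_1_iff)
  moreover have "s \<noteq> -1"
  proof
    assume "s = -1"
    then have "(det (om c x))\<^sup>2 < 0" using e gp by simp
    then show False using zero_le_power2[of "det (om c x)"] by linarith
  qed
  ultimately show ?thesis using e by simp
qed

lemma smooth_om: "c \<in> A \<Longrightarrow> smooth_on (chart_img c) (\<lambda>x. om c x $ i $ j)"
  unfolding tmat_def vec_lambda_beta by (rule smooth)

lemma smooth_oi:
  assumes c: "c \<in> A"
  shows "smooth_on (chart_img c) (\<lambda>x. oi c x $ i $ j)"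
proof -
  note op = open_chart_img[OF atlasA c]
  have "smooth_on (chart_img c) (\<lambda>x. (gi c x ** om c x ** gi c x) $ i $ j)"
    unfolding matrix_matrix_mult_def vec_lambda_beta
    by (intro smooth_on_sum smooth_on_mult smooth_gi smooth_om c op)
  then have "smooth_on (chart_img c) (\<lambda>x. - (gi c x ** om c x ** gi c x) $ i $ j)"
    by (rule smooth_on_minus[OF op])
  then show ?thesis by (rule smooth_on_cong[OF op]) (simp add: om_inverse(2)[OF c])
qed

lemma smooth_vol:
  assumes c: "c \<in> A"
  shows "smooth_on (chart_img c) (vol c)"
proof -
  have "smooth_on (chart_img c) (\<lambda>x. sqrt (det (gm c x)))"
    by (rule smooth_on_compose[OF open_chart_img[OF atlasA c] _ smooth_on_det[OF open_chart_img[OF atlasA c] smooth_gm[OF c]] smooth_on_sqrt])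
      (use metric_det_pos[OF c] in auto)
  then show ?thesis by (rule smooth_on_cong[OF open_chart_img[OF atlasA c]]) (simp add: volume_coeff_eq)
qed

definition dom_mat :: "('a, 'm) chart \<Rightarrow> real^'m \<Rightarrow> real^'m \<Rightarrow> real^'m^'m" where
  "dom_mat c v x = (\<chi> i j. dd (\<lambda>x. om c x $ i $ j) v x)"

text \<open>Obtained by differentiating \<open>om ** oi = mat 1\<close> entrywise and solving for
  the derivative of the inverse.\<close>

lemma dd_oi:
  assumes c: "c \<in> A" "x \<in> chart_img c"
  shows "dd (\<lambda>x. oi c x $ i $ j) v x = - (oi c x ** dom_mat c v x ** oi c x) $ i $ j"
proof -
  note op = open_chart_img[OF atlasA c(1)]
  define D where "D = (\<chi> i j. dd (\<lambda>x. oi c x $ i $ j) v x)"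
  have "(om c x ** D + dom_mat c v x ** oi c x) $ i $ j = 0" for i j
  proof -
    have "((\<lambda>x. \<Sum>k\<in>UNIV. om c x $ i $ k * oi c x $ k $ j) has_derivative
      (\<lambda>v. \<Sum>k\<in>UNIV. om c x $ i $ k * dd (\<lambda>x. oi c x $ k $ j) v x + dd (\<lambda>x. om c x $ i $ k) v x * oi c x $ k $ j)) (at x)"
      by (intro has_derivative_sum has_derivative_mult smooth_on_has_derivative[OF smooth_oi[OF c(1)] c(2)]
          smooth_on_has_derivative[OF smooth_om[OF c(1)] c(2)])
    then have d: "dd (\<lambda>x. \<Sum>k\<in>UNIV. om c x $ i $ k * oi c x $ k $ j) v x
      = (\<Sum>k\<in>UNIV. om c x $ i $ k * D $ k $ j + dom_mat c v x $ i $ k * oi c x $ k $ j)"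
      and df: "(\<lambda>x. \<Sum>k\<in>UNIV. om c x $ i $ k * oi c x $ k $ j) differentiable (at x)"
      by (simp_all add: dd_eqI D_def dom_mat_def differentiableI)
    have "dd (\<lambda>x. \<Sum>k\<in>UNIV. om c x $ i $ k * oi c x $ k $ j) v x = dd (\<lambda>_. (mat 1 :: real^'m^'m) $ i $ j) v x"
    proof (rule dd_cong_open[OF op c(2) _ df])
      fix y assume y: "y \<in> chart_img c"
      have "(om c y ** oi c y) $ i $ j = (mat 1 :: real^'m^'m) $ i $ j"
        unfolding matrix_inv_works(1)[OF om_inverse(1)[OF c(1) y]] ..
      then show "(\<Sum>k\<in>UNIV. om c y $ i $ k * oi c y $ k $ j) = (mat 1 :: real^'m^'m) $ i $ j"
        by (simp add: matrix_matrix_mult_def)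
    qed
    then show ?thesis unfolding d by (simp add: matrix_matrix_mult_def sum.distrib)
  qed
  then have "om c x ** D + dom_mat c v x ** oi c x = 0" by (simp add: vec_eq_iff)
  then have e: "om c x ** D = - (dom_mat c v x ** oi c x)" by (simp add: add_eq_0_iff2)
  have "D = (oi c x ** om c x) ** D" unfolding matrix_inv_works(2)[OF om_inverse(1)[OF c]] by simp
  also have "\<dots> = oi c x ** (om c x ** D)" by (simp only: matrix_mul_assoc)
  also have "\<dots> = - (oi c x ** dom_mat c v x ** oi c x)"
    unfolding e by (simp only: minus_matrix_mult matrix_mul_assoc)
  finally have "D = - (oi c x ** dom_mat c v x ** oi c x)" .
  then have "D $ i $ j = (- (oi c x ** dom_mat c v x ** oi c x)) $ i $ j" by simp
  then show ?thesis by (simp add: D_def)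
qed

text \<open>The squares of \<open>det g\<close> and \<open>det \<omega>\<close> agree on the whole
  chart, so Jacobi's formula for \<open>\<omega>\<close> gives the logarithmic derivative of
  \<open>det g\<close>; the factor 1/2 comes from the square root.\<close>

lemma dd_vol:
  assumes c: "c \<in> A" "x \<in> chart_img c"
  shows "dd (vol c) v x = 1 / 2 * vol c x * trace (oi c x ** dom_mat c v x)"
proof -
  note op = open_chart_img[OF atlasA c(1)]
  let ?G = "\<lambda>x. det (gm c x)" and ?O = "\<lambda>x. det (om c x)"
  have sG: "smooth_on (chart_img c) ?G" by (rule smooth_on_det[OF op smooth_gm[OF c(1)]])
  have Gd: "(?G has_derivative (\<lambda>v. dd ?G v x)) (at x)" by (rule smooth_on_has_derivative[OF sG c(2)])
  have Od: "(?O has_derivative (\<lambda>v. ?O x * trace (oi c x ** dom_mat c v x))) (at x)"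
  proof (rule has_derivative_det[where M = "om c" and x = x and M' = "\<lambda>v. dom_mat c v x", OF _ om_inverse(1)[OF c]])
    show "((\<lambda>x. om c x $ i $ j) has_derivative (\<lambda>v. dom_mat c v x $ i $ j)) (at x)" for i j
      unfolding dom_mat_def vec_lambda_beta by (rule smooth_on_has_derivative[OF smooth_om[OF c(1)] c(2)])
  qed
  have 1: "((\<lambda>x. ?G x * ?G x) has_derivative (\<lambda>v. ?G x * dd ?G v x + dd ?G v x * ?G x)) (at x)"
    by (rule has_derivative_mult[OF Gd Gd])
  have "((\<lambda>x. ?O x * ?O x) has_derivative (\<lambda>v. ?O x * (?O x * trace (oi c x ** dom_mat c v x))
      + (?O x * trace (oi c x ** dom_mat c v x)) * ?O x)) (at x)"
    by (rule has_derivative_mult[OF Od Od])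
  then have "((\<lambda>x. ?G x * ?G x) has_derivative (\<lambda>v. ?O x * (?O x * trace (oi c x ** dom_mat c v x))
      + (?O x * trace (oi c x ** dom_mat c v x)) * ?O x)) (at x)"
    by (rule has_derivative_transform_within_open[OF _ op c(2)])
      (use det_om[OF c(1)] in \<open>simp add: power2_eq_square\<close>)
  from fun_cong[OF has_derivative_unique[OF 1 this], of v]
  have "?G x * dd ?G v x = (?O x)\<^sup>2 * trace (oi c x ** dom_mat c v x)" by (simp add: power2_eq_square)
  also have "\<dots> = ?G x * (?G x * trace (oi c x ** dom_mat c v x))" unfolding det_om[OF c] by (simp add: power2_eq_square)
  finally have G': "dd ?G v x = ?G x * trace (oi c x ** dom_mat c v x)" using metric_det_pos[OF c] by simp
  have "(vol c has_derivative (\<lambda>v. dd ?G v x * (inverse (sqrt (?G x)) / 2))) (at x)"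
  proof -
    have "(sqrt has_derivative (\<lambda>h. h * (inverse (sqrt (?G x)) / 2))) (at (?G x))"
      using DERIV_real_sqrt[OF metric_det_pos[OF c]] unfolding has_field_derivative_def
      by (rule has_derivative_eq_rhs) (simp add: fun_eq_iff)
    from diff_chain_at[OF Gd this] show ?thesis by (simp add: o_def volume_coeff_eq[abs_def])
  qed
  then have "dd (vol c) v x = dd ?G v x * (inverse (sqrt (?G x)) / 2)" by (rule dd_eqI)
  also have "\<dots> = 1 / 2 * (?G x / sqrt (?G x)) * trace (oi c x ** dom_mat c v x)"
    unfolding G' by (simp only: divide_inverse mult_1_left mult_ac)
  also have "?G x / sqrt (?G x) = vol c x" using metric_det_pos[OF c] by (simp add: real_div_sqrt volume_coeff_eq)
  finally show ?thesis .
qed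

text \<open>Contracting \<open>d\<omega> = 0\<close> with \<open>\<omega>\<^sup>-\<^sup>1\<close> cancels the derivative of the inverse matrix against that of
  the volume density.\<close>
lemma divergence_free:
  assumes c: "c \<in> A" "x \<in> chart_img c"
  shows "(\<Sum>k\<in>UNIV. dd (\<lambda>x. vol c x * oi c x $ k $ l) (axis k 1) x) = 0"
proof -
  let ?o = "oi c x" and ?d = "\<lambda>k. dom_mat c (axis k 1) x"
  have an: "?o $ i $ j = - ?o $ j $ i" for i j by (rule oi_antisym[OF c])
  have dan: "?d k $ i $ j = - ?d k $ j $ i" for k i j
  proof -
    have "dd (\<lambda>x. om c x $ i $ j) (axis k 1) x = dd (\<lambda>x. - om c x $ j $ i) (axis k 1) x"
      by (rule dd_cong_open[OF open_chart_img[OF atlasA c(1)] c(2) om_antisym[OF c(1)] smooth_on_differentiable[OF smooth_om[OF c(1)] c(2)]])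
    also have "\<dots> = - dd (\<lambda>x. om c x $ j $ i) (axis k 1) x"
      by (rule dd_linear_compose[OF bounded_linear_minus[OF bounded_linear_ident] smooth_on_differentiable[OF smooth_om[OF c(1)] c(2)]])
    finally show ?thesis by (simp add: dom_mat_def)
  qed
  have cl: "?d k $ a $ b + ?d a $ b $ k + ?d b $ k $ a = 0" for k a b
    using closed[unfolded closed_two_form_def, rule_format, OF c,
        where u = "axis k 1" and v = "axis a 1" and w = "axis b 1"]
    by (simp add: dom_mat_def tmat_def)
  \<comment> \<open>Both contributions to the divergence, from the inverse matrix and from the
    volume density, reduce to this contraction of the inverse with the derivative of
    \<open>\<omega>\<close>.\<close>
  define C where "C b = (\<Sum>k\<in>UNIV. \<Sum>a\<in>UNIV. ?o $ k $ a * ?d k $ a $ b)" for b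
  \<comment> \<open>Closedness contracted with the inverse in \<open>k\<close> and \<open>a\<close>:
    two of the cyclic terms equal \<open>C b\<close>, the third is minus the trace. The factor 2
    cancels the 1/2 in \<open>dd_vol\<close>.\<close>
  have t: "trace (?o ** ?d b) = 2 * C b" for b
  proof -
    have "(\<Sum>k\<in>UNIV. \<Sum>a\<in>UNIV. ?o $ k $ a * (?d k $ a $ b + ?d a $ b $ k + ?d b $ k $ a)) = 0"
      by (simp add: cl)
    then have 0: "C b + (\<Sum>k\<in>UNIV. \<Sum>a\<in>UNIV. ?o $ k $ a * ?d a $ b $ k) + (\<Sum>k\<in>UNIV. \<Sum>a\<in>UNIV. ?o $ k $ a * ?d b $ k $ a) = 0"
      by (simp add: distrib_left sum.distrib C_def)
    have "(\<Sum>k\<in>UNIV. \<Sum>a\<in>UNIV. ?o $ k $ a * ?d a $ b $ k) = (\<Sum>k\<in>UNIV. \<Sum>a\<in>UNIV. ?o $ a $ k * ?d k $ b $ a)"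
      by (rule sum.swap)
    also have "\<dots> = C b"
      unfolding C_def
    proof (intro sum.cong refl)
      show "?o $ a $ k * ?d k $ b $ a = ?o $ k $ a * ?d k $ a $ b" for k a
        unfolding an[of a k] dan[of k b a] by (rule minus_mult_minus)
    qed
    finally have 1: "(\<Sum>k\<in>UNIV. \<Sum>a\<in>UNIV. ?o $ k $ a * ?d a $ b $ k) = C b" .
    have "(\<Sum>k\<in>UNIV. \<Sum>a\<in>UNIV. ?o $ k $ a * ?d b $ k $ a) = (\<Sum>k\<in>UNIV. \<Sum>a\<in>UNIV. - (?o $ k $ a * ?d b $ a $ k))"
    proof (intro sum.cong refl)
      show "?o $ k $ a * ?d b $ k $ a = - (?o $ k $ a * ?d b $ a $ k)" for k a
        unfolding dan[of b k a] by (rule mult_minus_right)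
    qed
    also have "\<dots> = - trace (?o ** ?d b)" by (simp add: trace_def matrix_matrix_mult_def sum_negf)
    finally show ?thesis using 0 1 by simp
  qed
  have S: "dd (\<lambda>x. vol c x * oi c x $ k $ l) v x
    = vol c x * (- (?o ** dom_mat c v x ** ?o) $ k $ l) + (1 / 2 * vol c x * trace (?o ** dom_mat c v x)) * ?o $ k $ l" for k v
  proof -
    have "((\<lambda>x. vol c x * oi c x $ k $ l) has_derivative
        (\<lambda>v. vol c x * dd (\<lambda>x. oi c x $ k $ l) v x + dd (vol c) v x * oi c x $ k $ l)) (at x)"
      by (intro has_derivative_mult smooth_on_has_derivative[OF smooth_oi[OF c(1)] c(2)] smooth_on_has_derivative[OF smooth_vol[OF c(1)] c(2)])
    from dd_eqI[OF this, of v] show ?thesis unfolding dd_oi[OF c] dd_vol[OF c] .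
  qed
  have "(\<Sum>k\<in>UNIV. dd (\<lambda>x. vol c x * oi c x $ k $ l) (axis k 1) x)
    = vol c x * ((\<Sum>k\<in>UNIV. C k * ?o $ k $ l) - (\<Sum>k\<in>UNIV. (?o ** ?d k ** ?o) $ k $ l))"
    unfolding S t by (simp add: sum_distrib_left sum_subtractf algebra_simps)
  also have "(\<Sum>k\<in>UNIV. (?o ** ?d k ** ?o) $ k $ l) = (\<Sum>k\<in>UNIV. C k * ?o $ k $ l)"
  proof -
    have "(\<Sum>k\<in>UNIV. (?o ** ?d k ** ?o) $ k $ l) = (\<Sum>k\<in>UNIV. \<Sum>b\<in>UNIV. (\<Sum>a\<in>UNIV. ?o $ k $ a * ?d k $ a $ b) * ?o $ b $ l)"
      by (simp add: matrix_matrix_mult_def)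
    also have "\<dots> = (\<Sum>b\<in>UNIV. \<Sum>k\<in>UNIV. (\<Sum>a\<in>UNIV. ?o $ k $ a * ?d k $ a $ b) * ?o $ b $ l)"
      by (rule sum.swap)
    finally show ?thesis unfolding C_def sum_distrib_right .
  qed
  finally show ?thesis by simp
qed

text \<open>Raising the indices of \<open>\<omega>\<close> gives \<open>- oi\<close>, and by
  antisymmetry of \<open>oi\<close> the two halves of \<open>dform\<close> contribute equally, which
  uses up the factor 1/2.\<close>

lemma form_inner_om:
  assumes c: "c \<in> A" "x \<in> chart_img c"
  shows "form_inner (gi c x) (om c x) (dform \<eta> c x)
    = - (\<Sum>k\<in>UNIV. \<Sum>l\<in>UNIV. oi c x $ k $ l * dd (\<lambda>x. \<eta> c x $ l) (axis k 1) x)"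
proof -
  let ?b = "dform \<eta> c x" and ?D = "\<lambda>k l. dd (\<lambda>x. \<eta> c x $ l) (axis k 1) x"
  have "trace (om c x ** gi c x ** transpose ?b ** gi c x) = trace (gi c x ** (om c x ** gi c x ** transpose ?b))"
    by (rule trace_mul_sym)
  also have "gi c x ** (om c x ** gi c x ** transpose ?b) = (gi c x ** om c x ** gi c x) ** transpose ?b"
    by (simp only: matrix_mul_assoc)
  also have "gi c x ** om c x ** gi c x = - oi c x" unfolding om_inverse(2)[OF c] by simp
  also have "trace ((- oi c x) ** transpose ?b) = - (\<Sum>k\<in>UNIV. \<Sum>l\<in>UNIV. oi c x $ k $ l * ?b $ k $ l)"
    unfolding trace_mult_transpose by (simp add: sum_negf)
  also have "(\<Sum>k\<in>UNIV. \<Sum>l\<in>UNIV. oi c x $ k $ l * ?b $ k $ l)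
      = (\<Sum>k\<in>UNIV. \<Sum>l\<in>UNIV. oi c x $ k $ l * ?D k l) - (\<Sum>k\<in>UNIV. \<Sum>l\<in>UNIV. oi c x $ k $ l * ?D l k)"
    by (simp add: dform_def right_diff_distrib sum_subtractf)
  also have "(\<Sum>k\<in>UNIV. \<Sum>l\<in>UNIV. oi c x $ k $ l * ?D l k) = (\<Sum>k\<in>UNIV. \<Sum>l\<in>UNIV. oi c x $ l $ k * ?D k l)"
    by (rule sum.swap)
  also have "\<dots> = (\<Sum>k\<in>UNIV. \<Sum>l\<in>UNIV. - (oi c x $ k $ l * ?D k l))"
  proof (intro sum.cong refl)
    show "oi c x $ l $ k * ?D k l = - (oi c x $ k $ l * ?D k l)" for k l
      unfolding oi_antisym[OF c, of l k] by (rule mult_minus_left)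
  qed
  also have "\<dots> = - (\<Sum>k\<in>UNIV. \<Sum>l\<in>UNIV. oi c x $ k $ l * ?D k l)" by (simp add: sum_negf)
  finally show ?thesis by (simp add: form_inner_def)
qed

section \<open>A divergence theorem across charts\<close>

lemma vol_chart_change:
  assumes c: "c \<in> A" "c' \<in> A" and p: "p \<in> chart_dom c" "p \<in> chart_dom c'"
  shows "vol c (snd c p) = \<bar>det (matrix (transition_deriv c c' p))\<bar> * vol c' (snd c' p)"
proof -
  let ?P = "matrix (transition_deriv c c' p)"
  have col: "column i ?P = transition_deriv c c' p (axis i 1)" for i
    by (simp add: column_def matrix_def vec_eq_iff)
  have "gm c (snd c p) $ i $ j = (transpose ?P ** gm c' (snd c' p) ** ?P) $ i $ j" for i j
  proof -
    have "gm c (snd c p) $ i $ j = local_rep A g c' (snd c' p) (column i ?P) (column j ?P)"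
      unfolding col by (simp add: tmat_def local_rep_change[OF atlasA c p])
    also have "\<dots> = column i ?P \<bullet> (gm c' (snd c' p) *v column j ?P)"
      unfolding tmat_def by (rule bilinear_matrix[OF metric_bilinear[OF c(2) chart_in[OF p(2)]]])
    finally show ?thesis unfolding congruent_matrix_entry .
  qed
  then have "gm c (snd c p) = transpose ?P ** gm c' (snd c' p) ** ?P" by (simp add: vec_eq_iff)
  then have "det (gm c (snd c p)) = (det ?P)\<^sup>2 * det (gm c' (snd c' p))"
    by (simp add: det_mul det_transpose power2_eq_square)
  then show ?thesis by (simp add: volume_coeff_eq real_sqrt_mult)
qed

text \<open>The vector field \<open>V\<close> dual to \<open>\<eta>\<close>, determined by
  \<open>\<omega> (u, V) = \<eta> u\<close> for all \<open>u\<close>. By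
  \<open>divergence_free\<close> and \<open>form_inner_om\<close>, the inner product of
  \<open>\<omega>\<close> with the exterior derivative of \<open>\<eta>\<close> is minus the
  divergence of \<open>V\<close>.\<close>

definition vfield :: "(('a, 'm) chart \<Rightarrow> real^'m \<Rightarrow> real^'m) \<Rightarrow> ('a, 'm) chart \<Rightarrow> real^'m \<Rightarrow> real^'m" where
  "vfield \<eta> c x = oi c x *v \<eta> c x"

text \<open>Both sides have the same contraction with \<open>\<omega>\<close>, because
  \<open>\<omega>\<close> and \<open>\<eta>\<close> transform covariantly, and the matrix of
  \<open>\<omega>\<close> is invertible.\<close>

lemma vfield_chart_change:
  assumes \<eta>: "one_form A \<eta>" and c: "c \<in> A" "c' \<in> A" and p: "p \<in> chart_dom c" "p \<in> chart_dom c'"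
  shows "vfield \<eta> c' (snd c' p) = transition_deriv c c' p (vfield \<eta> c (snd c p))"
proof -
  note x = chart_in[OF p(1)] and x' = chart_in[OF p(2)]
  let ?D = "transition_deriv c c' p"
  have e: "u \<bullet> (om c (snd c p) *v v) = local_rep A \<omega> c (snd c p) u v" if "c \<in> A" "p \<in> chart_dom c" for c u v
    unfolding tmat_def by (rule bilinear_matrix[OF bilinear[OF that(1) chart_in[OF that(2)]], symmetric])
  have "w \<bullet> (om c' (snd c' p) *v ?D (vfield \<eta> c (snd c p))) = w \<bullet> \<eta> c' (snd c' p)" for w
  proof -
    define u where "u = transition_deriv c' c p w"
    have w: "w = ?D u"
      unfolding u_def using transition_deriv_trans[OF atlasA c(2,1,2) p(2,1,2)] transition_deriv_self[OF atlasA c(2) p(2)] by simp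
    have "w \<bullet> (om c' (snd c' p) *v ?D (vfield \<eta> c (snd c p))) = local_rep A \<omega> c' (snd c' p) (?D u) (?D (vfield \<eta> c (snd c p)))"
      unfolding e[OF c(2) p(2)] w ..
    also have "\<dots> = u \<bullet> (om c (snd c p) *v vfield \<eta> c (snd c p))"
      unfolding e[OF c(1) p(1)] by (rule local_rep_change[OF atlasA c p, symmetric])
    also have "om c (snd c p) *v vfield \<eta> c (snd c p) = \<eta> c (snd c p)"
      unfolding vfield_def matrix_vector_mul_assoc matrix_inv_works(1)[OF om_inverse(1)[OF c(1) x]] by simp
    also have "u \<bullet> \<eta> c (snd c p) = \<eta> c' (snd c' p) \<bullet> ?D u"
      unfolding inner_commute[of u] by (rule one_form_change[OF \<eta> c p])
    finally show ?thesis unfolding w by (simp only: inner_commute)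
  qed
  then have "\<forall>w. w \<bullet> (om c' (snd c' p) *v ?D (vfield \<eta> c (snd c p))) = w \<bullet> \<eta> c' (snd c' p)" by (rule allI)
  then have "om c' (snd c' p) *v ?D (vfield \<eta> c (snd c p)) = \<eta> c' (snd c' p)"
    by (rule vector_eq_ldot[THEN iffD1])
  then have "oi c' (snd c' p) *v (om c' (snd c' p) *v ?D (vfield \<eta> c (snd c p))) = vfield \<eta> c' (snd c' p)"
    by (simp add: vfield_def)
  then show ?thesis
    unfolding matrix_vector_mul_assoc matrix_inv_works(2)[OF om_inverse(1)[OF c(2) x']] by simp
qed

lemma smooth_vfield:
  assumes \<eta>: "one_form A \<eta>" and c: "c \<in> A"
  shows "smooth_on (chart_img c) (\<lambda>x. vfield \<eta> c x $ k)"
proof -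
  note op = open_chart_img[OF atlasA c]
  have "smooth_on (chart_img c) (\<lambda>x. \<Sum>l\<in>UNIV. oi c x $ k $ l * \<eta> c x $ l)"
    by (intro smooth_on_sum smooth_on_mult smooth_oi smooth_on_nth one_form_smooth[OF \<eta>] c op)
  then show ?thesis by (rule smooth_on_cong[OF op]) (simp add: vfield_def matrix_vector_mult_def)
qed

text \<open>The derivative of the function \<open>\<sigma>\<close> along the field
  \<open>vfield \<eta>\<close>. The choice of chart is harmless because the field transforms as a
  vector, which \<open>ell_eq\<close> makes precise.\<close>

definition ell :: "(('a, 'm) chart \<Rightarrow> real^'m \<Rightarrow> real^'m) \<Rightarrow> ('a \<Rightarrow> real) \<Rightarrow> 'a \<Rightarrow> real" where
  "ell \<eta> \<sigma> p = (let c = (SOME c. c \<in> A \<and> p \<in> chart_dom c)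
    in dd (\<lambda>x. \<sigma> (chart_inv c x)) (vfield \<eta> c (snd c p)) (snd c p))"

lemma ell_eq:
  assumes \<eta>: "one_form A \<eta>" and \<sigma>: "smooth_fun A \<sigma>" and c: "c \<in> A" "p \<in> chart_dom c"
  shows "ell \<eta> \<sigma> p = dd (\<lambda>x. \<sigma> (chart_inv c x)) (vfield \<eta> c (snd c p)) (snd c p)"
proof -
  define c' where "c' = (SOME c. c \<in> A \<and> p \<in> chart_dom c)"
  have "c' \<in> A \<and> p \<in> chart_dom c'" unfolding c'_def by (rule someI[of _ c]) (use c in simp)
  then have c': "c' \<in> A" "p \<in> chart_dom c'" by simp_all
  let ?\<tau> = "snd c' \<circ> chart_inv c" and ?S = "\<lambda>c x. \<sigma> (chart_inv c x)"
  have sm: "smooth_on (chart_img c) (?S c)" if "c \<in> A" for c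
    using \<sigma> that by (simp add: smooth_fun_iff_vfun smooth_vfun_chart)
  have \<tau>p: "?\<tau> (snd c p) = snd c' p" by (simp add: chart_inv_chart[OF atlasA c])
  have d\<tau>: "?\<tau> differentiable (at (snd c p))" by (rule transition_differentiable[OF atlasA c(1) c'(1) c(2) c'(2)])
  have dS: "?S c' differentiable (at (?\<tau> (snd c p)))"
    unfolding \<tau>p by (rule smooth_on_differentiable[OF sm[OF c'(1)] chart_in[OF c'(2)]])
  let ?N = "{x \<in> chart_img c. chart_inv c x \<in> chart_dom c'}"
  have "dd (?S c) v (snd c p) = dd (\<lambda>x. ?S c' (?\<tau> x)) v (snd c p)" for v
  proof (rule dd_cong_open)
    show "open ?N" by (rule open_chart_preimage[OF atlasA c(1) open_chart_dom[OF atlasA c'(1)]])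
    show "snd c p \<in> ?N" using c c' by (simp add: chart_inv_chart[OF atlasA c])
    show "?S c y = ?S c' (?\<tau> y)" if "y \<in> ?N" for y using that by (simp add: chart_inv_chart[OF atlasA c'(1)])
  qed (rule smooth_on_differentiable[OF sm[OF c(1)] chart_in[OF c(2)]])
  also have "dd (\<lambda>x. ?S c' (?\<tau> x)) v (snd c p) = dd (?S c') (transition_deriv c c' p v) (snd c' p)" for v
    unfolding dd_chain[OF d\<tau> dS] \<tau>p transition_deriv_def ..
  finally show ?thesis
    unfolding ell_def Let_def c'_def[symmetric] vfield_chart_change[OF \<eta> c(1) c'(1) c(2) c'(2)] ..
qed

lemma smooth_ell:
  assumes \<eta>: "one_form A \<eta>" and \<sigma>: "smooth_fun A \<sigma>"
  shows "smooth_vfun A (ell \<eta> \<sigma>)"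
  unfolding smooth_vfun_def
proof
  fix c assume c: "c \<in> A"
  note op = open_chart_img[OF atlasA c]
  have sm: "smooth_on (chart_img c) (\<lambda>x. \<sigma> (chart_inv c x))"
    using \<sigma> c by (simp add: smooth_fun_iff_vfun smooth_vfun_chart)
  have "smooth_on (chart_img c) (\<lambda>x. \<Sum>k\<in>UNIV. vfield \<eta> c x $ k * dd (\<lambda>x. \<sigma> (chart_inv c x)) (axis k 1) x)"
    by (intro smooth_on_sum smooth_on_mult smooth_vfield[OF \<eta> c] smooth_on_dd sm op)
  then show "smooth_on (chart_img c) (\<lambda>x. ell \<eta> \<sigma> (chart_inv c x))"
  proof (rule smooth_on_cong[OF op])
    fix x assume x: "x \<in> chart_img c"
    let ?v = "vfield \<eta> c x"
    have l: "linear (\<lambda>v. dd (\<lambda>x. \<sigma> (chart_inv c x)) v x)" by (rule linear_dd[OF smooth_on_differentiable[OF sm x]])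
    have "ell \<eta> \<sigma> (chart_inv c x) = dd (\<lambda>x. \<sigma> (chart_inv c x)) ?v x"
      using ell_eq[OF \<eta> \<sigma> c chart_inv_in[OF x]] by (simp add: chart_chart_inv[OF x])
    also have "\<dots> = dd (\<lambda>x. \<sigma> (chart_inv c x)) (\<Sum>k\<in>UNIV. ?v $ k *\<^sub>R axis k 1) x"
      using basis_expansion[of ?v] by (simp add: scalar_mult_eq_scaleR)
    also have "\<dots> = (\<Sum>k\<in>UNIV. ?v $ k * dd (\<lambda>x. \<sigma> (chart_inv c x)) (axis k 1) x)"
      unfolding linear_sum[OF l] linear_scale[OF l] by simp
    finally show "(\<Sum>k\<in>UNIV. ?v $ k * dd (\<lambda>x. \<sigma> (chart_inv c x)) (axis k 1) x) = ell \<eta> \<sigma> (chart_inv c x)" ..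
  qed
qed

abbreviation "csupp c \<equiv> closure {p. \<rho> c p \<noteq> 0}"

lemma csupp: "c \<in> F \<Longrightarrow> compact (csupp c)" "c \<in> F \<Longrightarrow> csupp c \<subseteq> chart_dom c"
  using partition compact_Int_closed[OF cpt closed_closure] by (auto simp: partition_of_unity_def)

lemma \<rho>_outside: "p \<notin> csupp c \<Longrightarrow> \<rho> c p = 0"
  using closure_subset[of "{p. \<rho> c p \<noteq> 0}"] by auto

lemma smooth_fun_\<rho>: "c \<in> F \<Longrightarrow> smooth_fun A (\<rho> c)"
  using partition by (simp add: partition_of_unity_def)

lemma ell_outside:
  assumes \<eta>: "one_form A \<eta>" and c: "c \<in> F" and p: "p \<notin> csupp c"
  shows "ell \<eta> (\<rho> c) p = 0"
proof -
  obtain d where d: "d \<in> A" "p \<in> chart_dom d" using atlas_cover[OF atlasA] by blast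
  let ?N = "{x \<in> chart_img d. chart_inv d x \<in> - csupp c}"
  have "dd (\<lambda>_. 0::real) v (snd d p) = dd (\<lambda>x. \<rho> c (chart_inv d x)) v (snd d p)" for v
  proof (rule dd_cong_open)
    show "open ?N" by (rule open_chart_preimage[OF atlasA d(1)]) (simp add: open_Compl)
    show "snd d p \<in> ?N" using d p by (simp add: chart_inv_chart[OF atlasA d])
    show "0 = \<rho> c (chart_inv d y)" if "y \<in> ?N" for y
    proof -
      have "chart_inv d y \<notin> csupp c" using that by blast
      then show ?thesis by (rule \<rho>_outside[symmetric])
    qed
  qed simp
  then show ?thesis unfolding ell_eq[OF \<eta> smooth_fun_\<rho>[OF c] d] by simp
qed

text \<open>The partition functions sum to the constant 1, whose derivative along any field
  vanishes.\<close>

lemma sum_ell: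
  assumes \<eta>: "one_form A \<eta>"
  shows "(\<Sum>c\<in>F. ell \<eta> (\<rho> c) p) = 0"
proof -
  obtain d where d: "d \<in> A" "p \<in> chart_dom d" using atlas_cover[OF atlasA] by blast
  let ?v = "vfield \<eta> d (snd d p)"
  have "((\<lambda>x. \<Sum>c\<in>F. \<rho> c (chart_inv d x)) has_derivative (\<lambda>v. \<Sum>c\<in>F. dd (\<lambda>x. \<rho> c (chart_inv d x)) v (snd d p))) (at (snd d p))"
  proof (intro has_derivative_sum)
    fix c assume "c \<in> F"
    then have "smooth_vfun A (\<rho> c)" using smooth_fun_\<rho> by (simp add: smooth_fun_iff_vfun)
    then have "smooth_on (chart_img d) (\<lambda>x. \<rho> c (chart_inv d x))" by (rule smooth_vfun_chart[OF _ d(1)])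
    then show "((\<lambda>x. \<rho> c (chart_inv d x)) has_derivative (\<lambda>v. dd (\<lambda>x. \<rho> c (chart_inv d x)) v (snd d p))) (at (snd d p))"
      by (rule smooth_on_has_derivative[OF _ chart_in[OF d(2)]])
  qed
  moreover have "(\<Sum>c\<in>F. \<rho> c q) = 1" for q using partition by (simp add: partition_of_unity_def)
  ultimately have "((\<lambda>x. 1::real) has_derivative (\<lambda>v. \<Sum>c\<in>F. dd (\<lambda>x. \<rho> c (chart_inv d x)) v (snd d p))) (at (snd d p))" by simp
  from dd_eqI[OF this, of ?v] have "(\<Sum>c\<in>F. dd (\<lambda>x. \<rho> c (chart_inv d x)) ?v (snd d p)) = 0" by simp
  then show ?thesis using ell_eq[OF \<eta> smooth_fun_\<rho> d] by simp
qed

definition chart_integral :: "('a, 'm) chart \<Rightarrow> ('a \<Rightarrow> real) \<Rightarrow> real" where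
  "chart_integral c f = integral (chart_img c) (\<lambda>x. vol c x * f (chart_inv c x))"

lemma chart_integrand:
  assumes c: "c \<in> A" and f: "continuous_on UNIV f" and K: "compact K" "K \<subseteq> chart_dom c" and z: "\<And>p. p \<notin> K \<Longrightarrow> f p = 0"
  shows "continuous_on (chart_img c) (\<lambda>x. vol c x * f (chart_inv c x))"
    and "compact (snd c ` K)" and "snd c ` K \<subseteq> chart_img c"
    and "\<And>x. x \<in> chart_img c - snd c ` K \<Longrightarrow> vol c x * f (chart_inv c x) = 0"
proof -
  have "continuous_on (chart_img c) (\<lambda>x. f (chart_inv c x))"
    by (rule continuous_on_compose2[OF f continuous_on_chart_inv[OF atlasA c]]) simp
  then show "continuous_on (chart_img c) (\<lambda>x. vol c x * f (chart_inv c x))"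
    by (intro continuous_on_mult continuous_volume_coeff c)
  show "compact (snd c ` K)"
    by (rule compact_continuous_image[OF continuous_on_subset[OF continuous_on_chart[OF atlasA c] K(2)] K(1)])
  show "snd c ` K \<subseteq> chart_img c" using K(2) by (rule image_mono)
  show "vol c x * f (chart_inv c x) = 0" if x: "x \<in> chart_img c - snd c ` K" for x
  proof -
    have "chart_inv c x \<notin> K"
    proof
      assume "chart_inv c x \<in> K"
      then have "snd c (chart_inv c x) \<in> snd c ` K" by (rule imageI)
      then show False using x by (simp add: chart_chart_inv)
    qed
    then show ?thesis by (simp add: z)
  qed
qed

lemma chart_integrand_integrable:
  assumes "c \<in> A" "continuous_on UNIV f" "compact K" "K \<subseteq> chart_dom c" "\<And>p. p \<notin> K \<Longrightarrow> f p = 0"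
  shows "(\<lambda>x. vol c x * f (chart_inv c x)) integrable_on chart_img c"
proof -
  note k = chart_integrand[OF assms]
  obtain a where "snd c ` K \<subseteq> cbox (- a) a"
    using bounded_subset_cbox_symmetric compact_imp_bounded k(2) by blast
  from supported_integral(1)[OF open_chart_img[OF atlasA assms(1)] k(2,3,1) _ this] k(4) show ?thesis by blast
qed

text \<open>Substitution multiplies by the absolute value of the Jacobian determinant, which is
  exactly how the density \<open>vol\<close> changes, so charts of either orientation are
  covered.\<close>

lemma chart_integral_change:
  assumes c: "c \<in> A" "c' \<in> A" and f: "continuous_on UNIV f"
    and K: "compact K" "K \<subseteq> chart_dom c" "K \<subseteq> chart_dom c'" and z: "\<And>p. p \<notin> K \<Longrightarrow> f p = 0"
  shows "chart_integral c f = chart_integral c' f"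
proof -
  let ?U = "{x \<in> chart_img c. chart_inv c x \<in> chart_dom c'}" and ?V = "{y \<in> chart_img c'. chart_inv c' y \<in> chart_dom c}"
  let ?\<tau> = "snd c' \<circ> chart_inv c" and ?\<sigma> = "snd c \<circ> chart_inv c'"
  have oU: "open ?U" and oV: "open ?V"
    using open_chart_preimage[OF atlasA c(1) open_chart_dom[OF atlasA c(2)]]
      open_chart_preimage[OF atlasA c(2) open_chart_dom[OF atlasA c(1)]] by simp_all
  note k = chart_integrand[OF c(1) f K(1,2) z] and k' = chart_integrand[OF c(2) f K(1,3) z]
  have KU: "snd c ` K \<subseteq> ?U" using K by (auto simp: chart_inv_chart[OF atlasA c(1)] subset_iff)
  have KV: "snd c' ` K \<subseteq> ?V" using K by (auto simp: chart_inv_chart[OF atlasA c(2)] subset_iff)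
  have 1: "chart_integral c f = integral ?U (\<lambda>x. vol c x * f (chart_inv c x))"
    unfolding chart_integral_def
    by (rule integral_supported_mono[OF open_chart_img[OF atlasA c(1)] oU _ k(2) KU k(1) k(4)]) auto
  have 2: "chart_integral c' f = integral ?V (\<lambda>x. vol c' x * f (chart_inv c' x))"
    unfolding chart_integral_def
    by (rule integral_supported_mono[OF open_chart_img[OF atlasA c(2)] oV _ k'(2) KV k'(1) k'(4)]) auto
  let ?\<tau>' = "\<lambda>x. transition_deriv c c' (chart_inv c x)"
  have "integral ?V (\<lambda>x. vol c' x * f (chart_inv c' x))
    = integral ?U (\<lambda>x. \<bar>det (matrix (?\<tau>' x))\<bar> * (\<lambda>x. vol c' x * f (chart_inv c' x)) (?\<tau> x))"
  proof (rule change_of_variables_supported[OF oU oV _ _ _ _ _ k'(2) KV, where \<sigma> = ?\<sigma>])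
    show \<sigma>\<tau>: "?\<sigma> (?\<tau> x) = x" if "x \<in> ?U" for x
      using that by (simp add: chart_inv_chart[OF atlasA c(2)] chart_chart_inv)
    show "?\<tau> ` ?U = ?V"
    proof
      show "?\<tau> ` ?U \<subseteq> ?V" by (auto simp: chart_inv_chart[OF atlasA c(2)] chart_inv_chart[OF atlasA c(1)])
      show "?V \<subseteq> ?\<tau> ` ?U"
      proof
        fix y assume y: "y \<in> ?V"
        show "y \<in> ?\<tau> ` ?U"
          by (rule image_eqI[of _ _ "?\<sigma> y"])
            (use y in \<open>auto simp: chart_inv_chart[OF atlasA c(1)] chart_chart_inv chart_inv_chart[OF atlasA c(2)]\<close>)
      qed
    qed
    have \<tau>s: "smooth_on ?U ?\<tau>" by (rule smooth_transition[OF atlasA c])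
    show \<tau>d: "(?\<tau> has_derivative ?\<tau>' x) (at x)" if "x \<in> ?U" for x
      using smooth_on_has_derivative[OF \<tau>s that] that unfolding transition_deriv_def
      by (simp add: chart_chart_inv)
    have "continuous_on ?U (\<lambda>x. det (\<chi> i j. dd ?\<tau> (axis j 1) x $ i))"
      by (rule smooth_on_continuous[OF smooth_on_det[OF oU]])
        (unfold vec_lambda_beta, intro smooth_on_nth smooth_on_dd \<tau>s oU)
    then show "continuous_on ?U (\<lambda>x. det (matrix (?\<tau>' x)))"
      by (rule continuous_on_eq) (simp add: matrix_def transition_deriv_def chart_chart_inv)
    show "continuous_on ?V ?\<sigma>" by (rule smooth_on_continuous[OF smooth_transition[OF atlasA c(2,1)]])
    show "continuous_on ?V (\<lambda>x. vol c' x * f (chart_inv c' x))"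
      by (rule continuous_on_subset[OF k'(1)]) auto
    show "vol c' x * f (chart_inv c' x) = 0" if "x \<in> ?V - snd c' ` K" for x using k'(4)[of x] that by auto
  qed
  also have "\<dots> = integral ?U (\<lambda>x. vol c x * f (chart_inv c x))"
  proof (rule Henstock_Kurzweil_Integration.integral_cong)
    fix x assume x: "x \<in> ?U"
    define p where "p = chart_inv c x"
    have p: "p \<in> chart_dom c" "p \<in> chart_dom c'" "x = snd c p"
      unfolding p_def using x chart_inv_in[of x c] chart_chart_inv[of x c] by auto
    show "\<bar>det (matrix (?\<tau>' x))\<bar> * (\<lambda>x. vol c' x * f (chart_inv c' x)) (?\<tau> x) = vol c x * f (chart_inv c x)"
      unfolding p(3) using vol_chart_change[OF c p(1,2)]
      by (simp add: chart_inv_chart[OF atlasA c(1) p(1)] chart_inv_chart[OF atlasA c(2) p(2)])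
  qed
  finally show ?thesis using 1 2 by simp
qed

text \<open>The functions \<open>f k\<close> are the components of the density
  \<open>\<rho> c * vol * V\<close> with \<open>V\<close> the field \<open>vfield \<eta>\<close>.
  Their divergence is \<open>vol * V(\<rho> c)\<close> minus the integrand on the left, because the
  coefficients are divergence free, and it integrates to zero by compact support.\<close>

lemma integration_by_parts:
  assumes \<eta>: "one_form A \<eta>" and c: "c \<in> F"
  shows "integral (chart_img c) (\<lambda>x. weight c x * form_inner (gi c x) (om c x) (dform \<eta> c x))
    = chart_integral c (ell \<eta> (\<rho> c))"
proof -
  note cA = F_A[OF c]
  note op = open_chart_img[OF atlasA cA]
  let ?r = "\<lambda>x. \<rho> c (chart_inv c x)"
  have sr: "smooth_on (chart_img c) ?r" by (rule smooth_\<rho>[OF c])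
  have sS: "smooth_on (chart_img c) (\<lambda>x. vol c x * oi c x $ k $ l)" for k l
    by (intro smooth_on_mult smooth_vol smooth_oi op cA)
  have s\<eta>: "smooth_on (chart_img c) (\<lambda>x. \<eta> c x $ l)" for l by (intro smooth_on_nth op one_form_smooth[OF \<eta> cA])
  define f where "f k x = (\<Sum>l\<in>UNIV. ?r x * ((vol c x * oi c x $ k $ l) * \<eta> c x $ l))" for k x
  have sf: "smooth_on (chart_img c) (f k)" for k
    unfolding f_def[abs_def] by (intro smooth_on_sum smooth_on_mult sr s\<eta> op smooth_vol cA smooth_oi)
  have f0: "f k x = 0" if "x \<in> chart_img c - supp c" for k x
    unfolding f_def using \<rho>_outside_supp[OF c that] by simp
  let ?w = "\<lambda>x. weight c x * form_inner (gi c x) (om c x) (dform \<eta> c x)"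
  let ?e = "\<lambda>x. vol c x * ell \<eta> (\<rho> c) (chart_inv c x)"
  have df: "(\<Sum>k\<in>UNIV. dd (f k) (axis k 1) x) = ?e x - ?w x" if x: "x \<in> chart_img c" for x
  proof -
    have 1: "dd (f k) v x = (\<Sum>l\<in>UNIV. ?r x * ((vol c x * oi c x $ k $ l) * dd (\<lambda>x. \<eta> c x $ l) v x
        + dd (\<lambda>x. vol c x * oi c x $ k $ l) v x * \<eta> c x $ l) + dd ?r v x * ((vol c x * oi c x $ k $ l) * \<eta> c x $ l))" for k v
    proof -
      have "(f k has_derivative (\<lambda>v. \<Sum>l\<in>UNIV. ?r x * ((vol c x * oi c x $ k $ l) * dd (\<lambda>x. \<eta> c x $ l) v x
        + dd (\<lambda>x. vol c x * oi c x $ k $ l) v x * \<eta> c x $ l) + dd ?r v x * ((vol c x * oi c x $ k $ l) * \<eta> c x $ l))) (at x)"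
        unfolding f_def[abs_def]
        by (intro has_derivative_sum has_derivative_mult[OF smooth_on_has_derivative[OF sr x]]
            has_derivative_mult[OF smooth_on_has_derivative[OF sS x]] smooth_on_has_derivative[OF s\<eta> x])
      then show ?thesis by (rule dd_eqI)
    qed
    have lr: "linear (\<lambda>v. dd ?r v x)" by (rule linear_dd[OF smooth_on_differentiable[OF sr x]])
    have "(\<Sum>k\<in>UNIV. dd (f k) (axis k 1) x)
      = ?r x * (vol c x * (\<Sum>k\<in>UNIV. \<Sum>l\<in>UNIV. oi c x $ k $ l * dd (\<lambda>x. \<eta> c x $ l) (axis k 1) x))
      + ?r x * (\<Sum>k\<in>UNIV. \<Sum>l\<in>UNIV. dd (\<lambda>x. vol c x * oi c x $ k $ l) (axis k 1) x * \<eta> c x $ l)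
      + vol c x * (\<Sum>k\<in>UNIV. dd ?r (axis k 1) x * (\<Sum>l\<in>UNIV. oi c x $ k $ l * \<eta> c x $ l))"
      unfolding 1 by (simp add: sum.distrib sum_distrib_left distrib_left mult.assoc mult.left_commute)
    also have "(\<Sum>k\<in>UNIV. \<Sum>l\<in>UNIV. dd (\<lambda>x. vol c x * oi c x $ k $ l) (axis k 1) x * \<eta> c x $ l) = 0"
    proof -
      have "(\<Sum>k\<in>UNIV. \<Sum>l\<in>UNIV. dd (\<lambda>x. vol c x * oi c x $ k $ l) (axis k 1) x * \<eta> c x $ l)
        = (\<Sum>l\<in>UNIV. \<Sum>k\<in>UNIV. dd (\<lambda>x. vol c x * oi c x $ k $ l) (axis k 1) x * \<eta> c x $ l)" by (rule sum.swap)
      also have "\<dots> = (\<Sum>l\<in>UNIV. (\<Sum>k\<in>UNIV. dd (\<lambda>x. vol c x * oi c x $ k $ l) (axis k 1) x) * \<eta> c x $ l)"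
        unfolding sum_distrib_right ..
      finally show ?thesis by (simp add: divergence_free[OF cA x])
    qed
    also have "(\<Sum>k\<in>UNIV. \<Sum>l\<in>UNIV. oi c x $ k $ l * dd (\<lambda>x. \<eta> c x $ l) (axis k 1) x)
        = - form_inner (gi c x) (om c x) (dform \<eta> c x)" by (simp add: form_inner_om[OF cA x])
    also have "(\<Sum>k\<in>UNIV. dd ?r (axis k 1) x * (\<Sum>l\<in>UNIV. oi c x $ k $ l * \<eta> c x $ l)) = ell \<eta> (\<rho> c) (chart_inv c x)"
    proof -
      have "ell \<eta> (\<rho> c) (chart_inv c x) = dd ?r (vfield \<eta> c x) x"
        using ell_eq[OF \<eta> smooth_fun_\<rho>[OF c] cA chart_inv_in[OF x]] by (simp add: chart_chart_inv[OF x])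
      also have "\<dots> = dd ?r (\<Sum>k\<in>UNIV. vfield \<eta> c x $ k *\<^sub>R axis k 1) x"
        using basis_expansion[of "vfield \<eta> c x"] by (simp add: scalar_mult_eq_scaleR)
      also have "\<dots> = (\<Sum>k\<in>UNIV. vfield \<eta> c x $ k * dd ?r (axis k 1) x)"
        unfolding linear_sum[OF lr] linear_scale[OF lr] by simp
      finally show ?thesis by (simp add: vfield_def matrix_vector_mult_def mult.commute)
    qed
    finally show ?thesis by (simp add: weight_def)
  qed
  obtain a where ab: "supp c \<subseteq> cbox (- a) a"
    using bounded_subset_cbox_symmetric compact_imp_bounded supp_compact[OF c] by blast
  have i0: "integral (chart_img c) (dd (f k) (axis k 1)) = 0" for k
    by (rule integral_dd_zero[OF op supp_compact[OF c] supp_subset[OF c] sf f0])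
  have int: "dd (f k) (axis k 1) integrable_on chart_img c" for k
  proof (rule supported_integral(1)[OF op supp_compact[OF c] supp_subset[OF c] smooth_on_continuous[OF smooth_on_dd[OF sf]] _ ab])
    fix x assume x: "x \<in> chart_img c - supp c"
    have oN: "open (chart_img c - supp c)" by (rule open_Diff[OF op compact_imp_closed[OF supp_compact[OF c]]])
    have "dd (\<lambda>_. 0::real) (axis k 1) x = dd (f k) (axis k 1) x"
      by (rule dd_cong_open[OF oN x]) (simp_all add: f0)
    then show "dd (f k) (axis k 1) x = 0" by simp
  qed
  have ce: "continuous_on UNIV (ell \<eta> (\<rho> c))"
    by (rule smooth_vfun_continuous[OF atlasA smooth_ell[OF \<eta> smooth_fun_\<rho>[OF c]]])
  have ie: "?e integrable_on chart_img c"
    by (rule chart_integrand_integrable[OF cA ce csupp[OF c] ell_outside[OF \<eta> c]])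
  have cw: "continuous_on (chart_img c) (om c)"
  proof -
    have "smooth_on (chart_img c) (\<lambda>x. \<chi> i j. om c x $ i $ j)" by (intro smooth_on_vec op smooth_om cA)
    then show ?thesis using smooth_on_continuous by fastforce
  qed
  have iw: "?w integrable_on chart_img c"
    by (rule pairing_integrable[OF c cw smooth_on_continuous[OF smooth_dform[where \<eta> = \<eta>, OF atlasA cA one_form_smooth[OF \<eta> cA]]]])
  have "integral (chart_img c) ?e - integral (chart_img c) ?w = integral (chart_img c) (\<lambda>x. ?e x - ?w x)"
    by (rule Henstock_Kurzweil_Integration.integral_diff[OF ie iw, symmetric])
  also have "\<dots> = integral (chart_img c) (\<lambda>x. \<Sum>k\<in>UNIV. dd (f k) (axis k 1) x)"
    by (rule Henstock_Kurzweil_Integration.integral_cong) (simp add: df)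
  also have "\<dots> = (\<Sum>k\<in>UNIV. integral (chart_img c) (dd (f k) (axis k 1)))"
    by (rule Henstock_Kurzweil_Integration.integral_sum) (simp_all add: int)
  also have "\<dots> = 0" by (simp add: i0)
  finally show ?thesis by (simp add: chart_integral_def)
qed

text \<open>Integration by parts leaves, for each \<open>c\<close>, the integral of
  \<open>V(\<rho> c)\<close> computed in the chart \<open>c\<close>. To let these cancel they are
  brought into common charts: the partition functions \<open>\<rho> c'\<close>, which sum to 1, are
  inserted, each product is moved to the chart \<open>c'\<close>, and the sum over \<open>c\<close>
  is taken first, where \<open>sum_ell\<close> applies.\<close>

lemma form_coclosed:
  assumes \<eta>: "one_form A \<eta>"
  shows "pairing om (dform \<eta>) = 0"
proof -
  let ?l = "\<lambda>c. ell \<eta> (\<rho> c)"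
  have c\<rho>: "continuous_on UNIV (\<rho> c)" if "c \<in> F" for c
    using smooth_vfun_continuous[OF atlasA] smooth_fun_\<rho>[OF that] by (simp add: smooth_fun_iff_vfun)
  have cl: "continuous_on UNIV (?l c)" if "c \<in> F" for c
    by (rule smooth_vfun_continuous[OF atlasA smooth_ell[OF \<eta> smooth_fun_\<rho>[OF that]]])
  have cm: "continuous_on UNIV (\<lambda>p. \<rho> c' p * ?l c p)" if "c \<in> F" "c' \<in> F" for c c'
    by (intro continuous_on_mult c\<rho> cl that)
  have one: "(\<Sum>c\<in>F. \<rho> c q) = 1" for q using partition by (simp add: partition_of_unity_def)
  have "pairing om (dform \<eta>) = (\<Sum>c\<in>F. chart_integral c (?l c))"
    unfolding pairing_def by (rule sum.cong[OF refl integration_by_parts[OF \<eta>]])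
  also have "\<dots> = (\<Sum>c\<in>F. \<Sum>c'\<in>F. chart_integral c (\<lambda>p. \<rho> c' p * ?l c p))"
  proof (rule sum.cong[OF refl])
    fix c assume c: "c \<in> F"
    have "chart_integral c (?l c) = integral (chart_img c) (\<lambda>x. \<Sum>c'\<in>F. vol c x * (\<rho> c' (chart_inv c x) * ?l c (chart_inv c x)))"
      unfolding chart_integral_def sum_distrib_left[symmetric] sum_distrib_right[symmetric] one by simp
    also have "\<dots> = (\<Sum>c'\<in>F. chart_integral c (\<lambda>p. \<rho> c' p * ?l c p))"
      unfolding chart_integral_def
    proof (rule Henstock_Kurzweil_Integration.integral_sum[OF finite_F])
      show "(\<lambda>x. vol c x * (\<rho> c' (chart_inv c x) * ?l c (chart_inv c x))) integrable_on chart_img c" if "c' \<in> F" for c'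
        by (rule chart_integrand_integrable[OF F_A[OF c] cm[OF c that] csupp[OF c]])
          (simp add: ell_outside[OF \<eta> c])
    qed
    finally show "chart_integral c (?l c) = (\<Sum>c'\<in>F. chart_integral c (\<lambda>p. \<rho> c' p * ?l c p))" .
  qed
  also have "\<dots> = (\<Sum>c\<in>F. \<Sum>c'\<in>F. chart_integral c' (\<lambda>p. \<rho> c' p * ?l c p))"
  proof (intro sum.cong refl)
    fix c c' assume c: "c \<in> F" and c': "c' \<in> F"
    \<comment> \<open>The product is supported in the intersection of the two supports, a compact
      set inside both chart domains.\<close>
    show "chart_integral c (\<lambda>p. \<rho> c' p * ?l c p) = chart_integral c' (\<lambda>p. \<rho> c' p * ?l c p)"
    proof (rule chart_integral_change[OF F_A[OF c] F_A[OF c'] cm[OF c c']])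
      show "compact (csupp c \<inter> csupp c')" by (rule compact_Int_closed[OF csupp(1)[OF c] closed_closure])
      show "csupp c \<inter> csupp c' \<subseteq> chart_dom c" "csupp c \<inter> csupp c' \<subseteq> chart_dom c'"
        using csupp(2)[OF c] csupp(2)[OF c'] by auto
      show "\<rho> c' p * ?l c p = 0" if "p \<notin> csupp c \<inter> csupp c'" for p
        using that ell_outside[OF \<eta> c, of p] \<rho>_outside[of p c'] by auto
    qed
  qed
  also have "\<dots> = (\<Sum>c'\<in>F. \<Sum>c\<in>F. chart_integral c' (\<lambda>p. \<rho> c' p * ?l c p))" by (rule sum.swap)
  also have "\<dots> = (\<Sum>c'\<in>F. chart_integral c' (\<lambda>p. \<rho> c' p * (\<Sum>c\<in>F. ?l c p)))"
  proof (rule sum.cong[OF refl])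
    fix c' assume c': "c' \<in> F"
    have "(\<Sum>c\<in>F. chart_integral c' (\<lambda>p. \<rho> c' p * ?l c p))
      = integral (chart_img c') (\<lambda>x. \<Sum>c\<in>F. vol c' x * (\<rho> c' (chart_inv c' x) * ?l c (chart_inv c' x)))"
      unfolding chart_integral_def
    proof (rule Henstock_Kurzweil_Integration.integral_sum[OF finite_F, symmetric])
      show "(\<lambda>x. vol c' x * (\<rho> c' (chart_inv c' x) * ?l c (chart_inv c' x))) integrable_on chart_img c'" if "c \<in> F" for c
        by (rule chart_integrand_integrable[OF F_A[OF c'] cm[OF that c'] csupp[OF c']]) (drule \<rho>_outside, simp)
    qed
    then show "(\<Sum>c\<in>F. chart_integral c' (\<lambda>p. \<rho> c' p * ?l c p)) = chart_integral c' (\<lambda>p. \<rho> c' p * (\<Sum>c\<in>F. ?l c p))"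
      by (simp add: chart_integral_def sum_distrib_left)
  qed
  also have "\<dots> = 0" by (simp add: sum_ell[OF \<eta>] chart_integral_def)
  finally show ?thesis .
qed

end

section \<open>Kaehler manifolds\<close>

locale kaehler =
  fixes B :: "('b::t2_space, 'n::finite) chart set" and h :: "('b, 'n) two_tensor"
    and J :: "'b \<Rightarrow> ('b, 'n) tvec \<Rightarrow> ('b, 'n) tvec"
  assumes kaehler: "kaehler_manifold B h J"
begin

lemma atlasB: "smooth_atlas B" and metricB: "riemannian_metric B h"
  and acs: "almost_complex_structure B J" and closedB: "closed_two_form B (kaehler_form h J)"
  and hermitian: "v \<in> tangent_space B p \<Longrightarrow> w \<in> tangent_space B p \<Longrightarrow> h p (J p v) (J p w) = h p v w"
  using kaehler by (simp_all add: kaehler_manifold_def complex_structure_def)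

definition Jc :: "('b, 'n) chart \<Rightarrow> real^'n \<Rightarrow> real^'n \<Rightarrow> real^'n" where
  "Jc d y u = J (chart_inv d y) (coord_vec B d (chart_inv d y) u) d"

lemma J_tangent: "v \<in> tangent_space B p \<Longrightarrow> J p v \<in> tangent_space B p"
  and J_J: "v \<in> tangent_space B p \<Longrightarrow> J p (J p v) = (\<lambda>d. - v d)"
  using acs by (simp_all add: almost_complex_structure_def)

context
  fixes d y
  assumes d: "d \<in> B" and y: "y \<in> chart_img d"
begin

abbreviation "q \<equiv> chart_inv d y"

lemma base_point: "q \<in> chart_dom d" "snd d q = y"
  using chart_inv_in[OF y] chart_chart_inv[OF y] by auto

lemma coord_tangent: "coord_vec B d q u \<in> tangent_space B q"
  by (rule coord_vec_in_tangent_space[OF atlasB d base_point(1)])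

lemma J_coord_vec: "J q (coord_vec B d q u) = coord_vec B d q (Jc d y u)"
  unfolding Jc_def by (rule coord_vec_components[OF d base_point(1) J_tangent[OF coord_tangent], symmetric])

lemma linear_Jc: "linear (Jc d y)"
  using acs d base_point(1) by (simp add: almost_complex_structure_def Jc_def[abs_def])

lemma Jc_Jc: "Jc d y (Jc d y u) = - u"
proof -
  have "Jc d y (Jc d y u) = J q (coord_vec B d q (Jc d y u)) d" by (rule Jc_def)
  also have "coord_vec B d q (Jc d y u) = J q (coord_vec B d q u)" by (rule J_coord_vec[symmetric])
  also have "J q (J q (coord_vec B d q u)) d = - coord_vec B d q u d" unfolding J_J[OF coord_tangent] ..
  finally show ?thesis by (simp add: coord_vec_self[OF atlasB d base_point(1)])
qed

lemma kaehler_local_rep: "local_rep B (kaehler_form h J) d y u v = local_rep B h d y (Jc d y u) v"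
  unfolding local_rep_def Let_def kaehler_form_def J_coord_vec ..

lemma hermitian_local: "local_rep B h d y (Jc d y u) (Jc d y v) = local_rep B h d y u v"
  unfolding local_rep_def Let_def J_coord_vec[symmetric] by (rule hermitian[OF coord_tangent coord_tangent])

lemma bilinear_h: "bilinear (local_rep B h d y)"
  using metricB d y unfolding riemannian_metric_def by blast

lemma sym_h: "local_rep B h d y u v = local_rep B h d y v u"
  using metricB coord_tangent unfolding riemannian_metric_def local_rep_def Let_def by blast

lemma pos_h: "u \<noteq> 0 \<Longrightarrow> local_rep B h d y u u > 0"
proof -
  assume "u \<noteq> 0"
  then have "coord_vec B d q u \<noteq> (\<lambda>_. 0)" using coord_vec_self[OF atlasB d base_point(1), of u] by auto
  moreover have "\<forall>p. \<forall>v\<in>tangent_space B p. v \<noteq> (\<lambda>_. 0) \<longrightarrow> h p v v > 0"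
    using metricB unfolding riemannian_metric_def by simp
  ultimately show ?thesis unfolding local_rep_def Let_def using coord_tangent by simp
qed

lemma minus_h: "local_rep B h d y (- u) v = - local_rep B h d y u v"
  using bilinear_lneg[OF bilinear_h, of u v] by simp

text \<open>Invariance of \<open>h\<close> under \<open>J\<close> together with
  \<open>J J = -1\<close> moves \<open>J\<close> to the other argument at the cost of a
  sign.\<close>

lemma kaehler_antisym:
  "local_rep B (kaehler_form h J) d y u v = - local_rep B (kaehler_form h J) d y v u"
proof -
  have "local_rep B h d y (Jc d y u) v = local_rep B h d y (Jc d y (Jc d y u)) (Jc d y v)"
    by (rule hermitian_local[symmetric])
  also have "\<dots> = - local_rep B h d y u (Jc d y v)" unfolding Jc_Jc by (rule minus_h)
  also have "local_rep B h d y u (Jc d y v) = local_rep B h d y (Jc d y v) u" by (rule sym_h)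
  finally show ?thesis unfolding kaehler_local_rep .
qed

lemma kaehler_bilinear: "bilinear (local_rep B (kaehler_form h J) d y)"
proof -
  have e: "local_rep B (kaehler_form h J) d y = (\<lambda>u v. local_rep B h d y (Jc d y u) v)"
    by (intro ext kaehler_local_rep)
  have "linear (\<lambda>u. local_rep B h d y u v)" for v using bilinear_h by (simp add: bilinear_def)
  from linear_compose[OF linear_Jc this] show ?thesis
    unfolding e bilinear_def using bilinear_h by (simp add: bilinear_def o_def)
qed

text \<open>Tested on \<open>v = J u\<close>, where the form takes the value
  \<open>- h(u, u)\<close>.\<close>

lemma kaehler_nondegenerate:
  assumes "\<And>v. local_rep B (kaehler_form h J) d y v u = 0"
  shows "u = 0"
proof (rule ccontr)
  assume "u \<noteq> 0"
  have "local_rep B h d y (- u) u = 0" using assms[of "Jc d y u"] unfolding kaehler_local_rep Jc_Jc .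
  then show False using pos_h[OF \<open>u \<noteq> 0\<close>] by (simp add: minus_h)
qed

lemma kaehler_matrix: "tmat B (kaehler_form h J) d y = transpose (matrix (Jc d y)) ** tmat B h d y"
proof -
  have "tmat B (kaehler_form h J) d y $ i $ j = (transpose (matrix (Jc d y)) ** tmat B h d y) $ i $ j" for i j
  proof -
    have "tmat B (kaehler_form h J) d y $ i $ j = Jc d y (axis i 1) \<bullet> (tmat B h d y *v axis j 1)"
      unfolding tmat_def vec_lambda_beta kaehler_local_rep by (rule bilinear_matrix[OF bilinear_h])
    also have "\<dots> = (\<Sum>k\<in>UNIV. Jc d y (axis i 1) $ k * tmat B h d y $ k $ j)"
      by (simp add: matrix_vector_mult_basis inner_vec_def column_def)
    finally show ?thesis by (simp add: matrix_matrix_mult_def transpose_def matrix_def)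
  qed
  then show ?thesis by (simp add: vec_eq_iff)
qed

lemma Jc_matrix_square: "matrix (Jc d y) ** matrix (Jc d y) = - mat 1"
proof -
  have "matrix (Jc d y) ** matrix (Jc d y) = matrix (Jc d y \<circ> Jc d y)"
    by (rule matrix_compose[OF linear_Jc linear_Jc, symmetric])
  also have "Jc d y \<circ> Jc d y = uminus" by (simp add: fun_eq_iff Jc_Jc)
  also have "matrix uminus = - (mat 1 :: real^'n^'n)" by (simp add: matrix_def mat_def axis_def vec_eq_iff)
  finally show ?thesis .
qed

text \<open>With \<open>\<omega> = J^T g\<close> the left-hand side collapses to
  \<open>J^T J^T g\<close>, and \<open>J^T\<close> squares to -1.\<close>

lemma kaehler_compatible:
  assumes inv: "invertible (tmat B h d y)"
  shows "tmat B (kaehler_form h J) d y ** matrix_inv (tmat B h d y) ** tmat B (kaehler_form h J) d y = - tmat B h d y"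
proof -
  let ?J = "transpose (matrix (Jc d y))" and ?G = "tmat B h d y"
  have "?J ** ?G ** matrix_inv ?G ** (?J ** ?G) = ?J ** (?G ** matrix_inv ?G) ** ?J ** ?G"
    by (simp only: matrix_mul_assoc)
  also have "\<dots> = (?J ** ?J) ** ?G" unfolding matrix_inv_works(1)[OF inv] by simp
  also have "?J ** ?J = - mat 1"
    unfolding matrix_transpose_mul[symmetric] Jc_matrix_square by (simp add: transpose_uminus)
  finally show ?thesis unfolding kaehler_matrix by (simp add: minus_matrix_mult)
qed

end

lemma kaehler_smooth:
  assumes d: "d \<in> B"
  shows "smooth_on (chart_img d) (\<lambda>y. local_rep B (kaehler_form h J) d y u v)"
proof -
  note op = open_chart_img[OF atlasB d]
  have sJ: "smooth_on (chart_img d) (\<lambda>y. Jc d y u)"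
    using acs d by (simp add: almost_complex_structure_def Jc_def)
  have sh: "smooth_on (chart_img d) (\<lambda>y. local_rep B h d y u v)" for u v
    using metricB d by (simp add: riemannian_metric_def)
  have "smooth_on (chart_img d) (\<lambda>y. local_rep B h d y (Jc d y u) v)"
    by (rule smooth_on_bilinear_field[OF op bilinear_h[OF d] sh op _ smooth_on_id sJ smooth_on_const])
  then show ?thesis by (rule smooth_on_cong[OF op]) (simp add: kaehler_local_rep[OF d])
qed

lemma kaehler_closed_form: "closed_form B (kaehler_form h J)"
  by unfold_locales (fact atlasB kaehler_bilinear kaehler_smooth kaehler_antisym closedB)+

end

text \<open>The witness is the very partition that \<open>volume_integral\<close> chooses; existence
  of some partition ensures that the chosen one has the required properties.\<close>

lemma riemannian_exists:
  fixes A :: "('a::t2_space, 'm::finite) chart set"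
  assumes "smooth_atlas A" "compact (UNIV :: 'a set)" "riemannian_metric A g"
  shows "\<exists>F \<rho>. riemannian A g F \<rho>"
proof -
  obtain F0 \<rho>0 where "partition_of_unity A F0 \<rho>0" using partition_of_unity_exists[OF assms(1,2)] by (elim exE) (rule that)
  then have "\<exists>z. case z of (F, \<rho>) \<Rightarrow> partition_of_unity A F \<rho>" by (intro exI[of _ "(F0, \<rho>0)"]) simp
  from someI_ex[OF this] have P: "case (SOME (F, \<rho>). partition_of_unity A F \<rho>) of (F, \<rho>) \<Rightarrow> partition_of_unity A F \<rho>" .
  obtain F \<rho> where e: "(SOME (F, \<rho>). partition_of_unity A F \<rho>) = (F, \<rho>)" by (rule prod.exhaust)
  have "riemannian A g F \<rho>"
    by unfold_locales (use assms P e in simp_all)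
  then show ?thesis by blast
qed

context energy_setting
begin

text \<open>The variation selected by the choice operator is a genuine one by
  \<open>variation2_exists\<close>, and the bound holds for every genuine one.\<close>

lemma coclosed_stable:
  assumes "coclosed \<phi>" "smooth_map A B \<phi>" "X \<in> sections_along A B \<phi>"
  shows "deriv (\<lambda>s. deriv (\<lambda>t. E ((SOME \<Phi>. variation2 A B \<phi> X X \<Phi>) (s, t))) 0) 0 \<ge> 0"
  by (rule coclosed_hessian_nonneg[OF assms(1) someI_ex[OF variation2_exists[OF assms(2,3)]]])

end

lemma smooth_map_id:
  fixes B :: "('b::t2_space, 'n::finite) chart set"
  assumes B: "smooth_atlas B"
  shows "smooth_map B B id"
  unfolding smooth_map_def using smooth_transition[OF B] by (auto intro: continuous_on_id' simp: o_def)

theorem mainTheorem10: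
  fixes B :: "('b::{t2_space,second_countable_topology}, 'n::finite) chart set"
    and h :: "('b, 'n) two_tensor"
    and J :: "'b \<Rightarrow> ('b, 'n) tvec \<Rightarrow> ('b, 'n) tvec"
  assumes "compact (UNIV :: 'b set)"
    and "kaehler_manifold B h J"
  shows "(\<forall>(A :: ('a::{t2_space,second_countable_topology}, 'm::finite) chart set) g \<phi>.
            compact (UNIV :: 'a set) \<and> oriented_atlas A \<and> riemannian_metric A g \<and>
            immersion A B \<phi> \<and> critical_point A g B h J \<phi>
            \<longrightarrow> stable_critical_point A g B h J \<phi>)
         \<and> stable_critical_point B h B h J id"
proof
  interpret kaehler B h J by unfold_locales (rule assms(2))
  let ?\<omega> = "kaehler_form h J"
  show "\<forall>(A :: ('a, 'm) chart set) g \<phi>.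
            compact (UNIV :: 'a set) \<and> oriented_atlas A \<and> riemannian_metric A g \<and>
            immersion A B \<phi> \<and> critical_point A g B h J \<phi>
            \<longrightarrow> stable_critical_point A g B h J \<phi>"
  proof (intro allI impI, elim conjE)
    fix A :: "('a, 'm) chart set" and g \<phi>
    assume cpt: "compact (UNIV :: 'a set)" and A: "oriented_atlas A" and g: "riemannian_metric A g"
      and \<phi>: "immersion A B \<phi>" and crit: "critical_point A g B h J \<phi>"
    have "smooth_atlas A" using A by (simp add: oriented_atlas_def)
    then obtain F \<rho> where "riemannian A g F \<rho>" using riemannian_exists[OF _ cpt g] by blast
    then interpret energy_setting A g F \<rho> B ?\<omega>
      by (rule energy_setting.intro[OF _ kaehler_closed_form])
    have en: "energy A g B h J = E" by (simp add: fun_eq_iff energy_def E_def Let_def)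
    have "coclosed \<phi>"
    proof (rule critical_immersion_coclosed[OF _ \<phi>])
      show "\<forall>d\<in>B. \<forall>y\<in>chart_img d. \<forall>u. (\<forall>v. local_rep B ?\<omega> d y v u = 0) \<longrightarrow> u = 0"
        using kaehler_nondegenerate by blast
      show "((\<lambda>t. E (\<Phi> t)) has_real_derivative 0) (at 0)" if "variation A B \<phi> \<Phi>" for \<Phi>
        using crit that unfolding critical_point_def en by blast
    qed
    moreover have "smooth_map A B \<phi>" using \<phi> by (simp add: immersion_def)
    ultimately show "stable_critical_point A g B h J \<phi>"
      unfolding stable_critical_point_def hessian_def Let_def en using crit coclosed_stable by blast
  qed
  show "stable_critical_point B h B h J id"
  proof -
    obtain F \<rho> where R: "riemannian B h F \<rho>" using riemannian_exists[OF atlasB assms(1) metricB] by blast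
    interpret energy_setting B h F \<rho> B ?\<omega>
      by (rule energy_setting.intro[OF R kaehler_closed_form])
    \<comment> \<open>Source and target coincide here, so the Kaehler form lives on the source and
      the divergence argument applies to it.\<close>
    interpret V: kaehler_volume B h F \<rho> ?\<omega>
      by unfold_locales (rule kaehler_compatible[OF _ _ metric_invertible])
    have en: "energy B h B h J = E" by (simp add: fun_eq_iff energy_def E_def Let_def)
    have id: "smooth_map B B id" by (rule smooth_map_id[OF atlasB])
    interpret f: form_family B ?\<omega> B "UNIV :: real set" "\<lambda>_. id"
      by (rule form_familyI[OF open_UNIV smooth_map_family[OF atlasB atlasB id open_UNIV]])
    \<comment> \<open>In a chart the identity reads \<open>snd c \<circ> chart_inv c\<close>, which
      is the identity near \<open>x\<close> and has identity derivative, so the pull-back leaves the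
      coefficients unchanged.\<close>
    have pm: "pm id c x = V.om c x" if c: "c \<in> B" and x: "x \<in> chart_img c" for c x
    proof -
      have z: "(0::real, x) \<in> loc_dom c c UNIV (\<lambda>_. id)" using x chart_inv_in[OF x] by (simp add: loc_dom_def)
      have l: "loc c c (\<lambda>_. id) (0::real, x) = x" by (simp add: loc_def chart_chart_inv[OF x])
      have "dd (loc c c (\<lambda>_. id)) (0::real, u) (0, x) = u" for u
      proof -
        have "dd (loc c c (\<lambda>_. id)) (0::real, u) (0, x) = dd (\<lambda>x. snd c (id (chart_inv c x))) u x"
          by (rule dd_eqI[OF f.dd_loc_space[OF c c z], symmetric])
        also have "\<dots> = dd (\<lambda>x. x) u x"
          by (rule dd_cong_open[OF open_chart_img[OF atlasB c] x])
            (use f.dd_loc_space[OF c c z] in \<open>simp_all add: chart_chart_inv differentiableI\<close>)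
        finally show ?thesis by simp
      qed
      then have "local_rep B (pullback_form B B id ?\<omega>) c x u v = local_rep B ?\<omega> c x u v" for u v
        using f.pullback_local_rep[OF c UNIV_I x, where t = 0] f.pb_eq[OF c c z] l by simp
      then show ?thesis by (simp add: tmat_def)
    qed
    have cc: "coclosed id" unfolding coclosed_def
    proof (intro allI impI)
      fix \<eta> assume "one_form B \<eta>"
      from V.form_coclosed[OF this] show "pairing (pm id) (dform \<eta>) = 0"
        using pairing_cong[of "pm id" V.om "dform \<eta>" "dform \<eta>"] pm by simp
    qed
    \<comment> \<open>Here the order is reversed compared with critical immersions: coclosedness is
      established directly, and criticality follows from it by the first variation formula.\<close>
    then have "critical_point B h B h J id"
      unfolding critical_point_def en using id coclosed_critical by blast
    then show ?thesis
      unfolding stable_critical_point_def hessian_def Let_def en using cc id coclosed_stable by blast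
  qed
qed

end
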